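(* For every $k\in\mathbb{N}$, the space $(\widetilde{\mathcal{W}_k},\delta_{\square_k})$ is compact.
   Context: A $k$-graphon is a symmetric, measurable function $W:[0,1]^2\to\mathcal{P}([k])$, where $\mathcal{P}([k])$ is the set of probability measures on $[k]=\{1,\dots,k\}$. For $i\in[k]$ write $W_i(x,y)$ for the mass that $W(x,y)$ assigns to $i$. For $k$-graphons $U,W$ set $$d_{\square_k}(U,W)=\sup_{S,T\subseteq[0,1]}\sum_{i=1}^k\left|\int_{S\times T}\bigl(U_i(x,y)-W_i(x,y)\bigr)\,dx\,dy\right|,$$ the supremum being over measurable sets $S,T$, and $$\delta_{\square_k}(U,W)=\inf_{\varphi}d_{\square_k}(U,W^{\varphi}),\qquad W^{\varphi}(x,y)=W(\varphi(x),\varphi(y)),$$ the infimum being over all measure-preserving transformations $\varphi:[0,1]\to[0,1]$. $\mathcal{W}_k$ is the space of $k$-graphons, and $\widetilde{\mathcal{W}_k}$ is the quotient of $\mathcal{W}_k$ obtained by identifying $U$ and $W$ whenever $\delta_{\square_k}(U,W)=0$. *)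

theory Defs
  imports "HOL-Analysis.Analysis" "HOL-Probability.Giry_Monad"
begin

text \<open>
  Functions on the unit square are total functions on the real plane whose values outside the
  unit square are irrelevant: all notions below only inspect points of the unit square, so any two
  functions agreeing there have distance 0 and are identified in the quotient. Measurability is
  with respect to the Lebesgue sigma-algebra throughout.
\<close>

abbreviation unit_interval :: "real measure" where
  "unit_interval \<equiv> lebesgue_on {0..1}"

abbreviation unit_square :: "(real \<times> real) measure" where
  "unit_square \<equiv> lebesgue_on ({0..1} \<times> {0..1})"

text \<open>
  The probability measures on \<open>{1..k}\<close>, with the sigma-algebra generated by the evaluation maps
  (equivalently, the Borel sets of the simplex), are \<open>prob_algebra (count_space {1..k})\<close>.
  There are none if \<open>k = 0\<close>.
\<close>

definition graphons :: "nat \<Rightarrow> (real \<times> real \<Rightarrow> nat measure) set" where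
  "graphons k =
    {W. W \<in> unit_square \<rightarrow>\<^sub>M prob_algebra (count_space {1..k}) \<and>
        (\<forall>x\<in>{0..1}. \<forall>y\<in>{0..1}. W (x, y) = W (y, x))}"

definition mass :: "(real \<times> real \<Rightarrow> nat measure) \<Rightarrow> nat \<Rightarrow> real \<times> real \<Rightarrow> real" where
  "mass W i p = measure (W p) {i}"

definition cut_dist ::
  "nat \<Rightarrow> (real \<times> real \<Rightarrow> nat measure) \<Rightarrow> (real \<times> real \<Rightarrow> nat measure) \<Rightarrow> real" where
  "cut_dist k U W =
    (SUP (S, T) \<in> sets unit_interval \<times> sets unit_interval.
      \<Sum>i = 1..k. \<bar>LINT p:S \<times> T|lebesgue. mass U i p - mass W i p\<bar>)"

text \<open>Measure-preserving transformations are not required to be invertible.\<close>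

definition mp_maps :: "(real \<Rightarrow> real) set" where
  "mp_maps = {\<phi>. \<phi> \<in> unit_interval \<rightarrow>\<^sub>M unit_interval \<and>
                  distr unit_interval unit_interval \<phi> = unit_interval}"

definition pullback ::
  "(real \<times> real \<Rightarrow> nat measure) \<Rightarrow> (real \<Rightarrow> real) \<Rightarrow> (real \<times> real \<Rightarrow> nat measure)" where
  "pullback W \<phi> = (\<lambda>(x, y). W (\<phi> x, \<phi> y))"

definition delta_cut ::
  "nat \<Rightarrow> (real \<times> real \<Rightarrow> nat measure) \<Rightarrow> (real \<times> real \<Rightarrow> nat measure) \<Rightarrow> real" where
  "delta_cut k U W = (INF \<phi>\<in>mp_maps. cut_dist k U (pullback W \<phi>))"

definition cut_equiv ::
  "nat \<Rightarrow> ((real \<times> real \<Rightarrow> nat measure) \<times> (real \<times> real \<Rightarrow> nat measure)) set" where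
  "cut_equiv k = {(U, W). U \<in> graphons k \<and> W \<in> graphons k \<and> delta_cut k U W = 0}"

definition graphon_space :: "nat \<Rightarrow> (real \<times> real \<Rightarrow> nat measure) set set" where
  "graphon_space k = graphons k // cut_equiv k"

text \<open>
  The distance of two classes is the common value of \<open>delta_cut\<close> on their representatives. The
  value 0 off the space is a dummy: the locale \<open>Metric_space\<close> demands nonnegativity and symmetry
  for all arguments, not only for those in the carrier.
\<close>

definition graphon_dist ::
  "nat \<Rightarrow> (real \<times> real \<Rightarrow> nat measure) set \<Rightarrow> (real \<times> real \<Rightarrow> nat measure) set \<Rightarrow> real" where
  "graphon_dist k A B =
    (if A \<in> graphon_space k \<and> B \<in> graphon_space k
     then the_elem {delta_cut k U W | U W. U \<in> A \<and> W \<in> B} else 0)"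

end

theory Submission
  imports Defs "HOL-Probability.Distribution_Functions"
begin

text \<open>
  Compactness is completeness plus total boundedness. A bounded kernel is \<open>L\<^sup>1\<close>-close to a step
  kernel on a regular grid, and the cut norm of a step kernel depends only on the measures of the
  steps, since a test set may be replaced by any set that meets every step in the same measure.
  Hence composing with a measure-preserving map does not increase the cut norm, and \<open>\<delta>\<close> is symmetric
  although its maps need not be invertible: sorting the interval by a finite labelling is measure
  preserving, and such maps reverse \<open>\<phi>\<close> on a grid. Total boundedness is the weak regularity lemma
  of Frieze and Kannan, proved by energy increments, combined with rounding of the step values and
  step lengths. For completeness, the alignments of a fast Cauchy sequence are composed, so that the
  sequence becomes Cauchy in the cut norm itself; then the integrals over rectangles converge,
  hence those over all measurable sets, and the limit measures have densities by Radon--Nikodym.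
\<close>

section \<open>Product structure of the unit square\<close>

text \<open>Two obstacles shape the proof. The measure on the square is a completion, whose
  sigma-algebra is larger than the product of the Lebesgue sigma-algebras of the sides; product
  formulas and measure preservation are therefore verified on Borel rectangles and carried over by
  completeness. Secondly, a map in \<open>mp_maps\<close> may fail to be invertible, so a test set
  for a twisted kernel need not be the preimage of any set; absence of atoms, in the form of an
  intermediate value theorem, supplies the sets that an inverse would have given. The constant
  \<open>e / (real k + 1)\<close> recurs because an error above \<open>e\<close>, summed over the
  colours, forces more than this share on one colour; the added 1 keeps it meaningful for
  \<open>k = 0\<close>. Completeness needs neither limits of partitions nor martingales: domination
  by area, uniformly along the sequence, makes the limiting set functions countably additive. For
  \<open>k = 0\<close> there are no graphons and the space is empty; the construction of a limit may
  assume \<open>1 \<le> k\<close>, since it starts from a sequence of graphons.\<close>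

lemma space_unit_interval [simp]: "space unit_interval = {0..1}"
  by simp

lemma space_unit_square [simp]: "space unit_square = {0..1} \<times> {0..1}"
  by simp

lemma square_cbox: "{0..1::real} \<times> {0..1::real} = cbox (0, 0) (1, 1)"
  by (auto simp: cbox_Pair_eq)

lemma square_sets [measurable, simp]: "{0..1::real} \<times> {0..1::real} \<in> sets lebesgue"
  unfolding square_cbox by simp

lemma square_sets_borel [measurable, simp]: "{0..1::real} \<times> {0..1::real} \<in> sets borel"
  unfolding square_cbox by simp

text \<open>The exceptional set lies in a strip over a null set, and such a strip has measure zero
  times infinity, which is zero.\<close>

lemma AE_lebesgue_fst_snd:
  fixes P :: "real \<Rightarrow> bool"
  assumes "AE x in lborel. P x"
  shows "AE p in (lborel :: (real \<times> real) measure). P (fst p)"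
    "AE p in (lborel :: (real \<times> real) measure). P (snd p)"
proof -
  obtain N where N: "{x \<in> space lborel. \<not> P x} \<subseteq> N" "emeasure lborel N = 0" "N \<in> sets lborel"
    using AE_E[OF assms] by metis
  have *: "emeasure lborel (A \<times> B) = emeasure lborel A * emeasure lborel B"
    if "A \<in> sets borel" "B \<in> sets borel" for A B :: "real set"
    using that by (simp add: lborel_prod[symmetric] lborel.emeasure_pair_measure_Times)
  have s: "A \<times> B \<in> sets borel" if "A \<in> sets borel" "B \<in> sets borel" for A B :: "real set"
    using that by (simp add: borel_Times)
  have null: "N \<times> (UNIV :: real set) \<in> null_sets lborel" "(UNIV :: real set) \<times> N \<in> null_sets lborel"
    using N s[of N UNIV] s[of UNIV N] *[of N UNIV] *[of UNIV N] by (auto intro!: null_setsI)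
  show "AE p in (lborel :: (real \<times> real) measure). P (fst p)"
    by (rule AE_I'[OF null(1)]) (use N(1) in auto)
  show "AE p in (lborel :: (real \<times> real) measure). P (snd p)"
    by (rule AE_I'[OF null(2)]) (use N(1) in auto)
qed

text \<open>Measurability for Borel sets is immediate; it extends to Lebesgue sets because preimages
  of null sets are strips of measure zero and the plane carries a complete measure.\<close>

lemma measurable_lebesgue_fst_snd:
  "fst \<in> (lebesgue :: (real \<times> real) measure) \<rightarrow>\<^sub>M (lebesgue :: real measure)"
  "snd \<in> (lebesgue :: (real \<times> real) measure) \<rightarrow>\<^sub>M (lebesgue :: real measure)"
proof -
  have m: "fst \<in> (lebesgue :: (real \<times> real) measure) \<rightarrow>\<^sub>M (lborel :: real measure)"
          "snd \<in> (lebesgue :: (real \<times> real) measure) \<rightarrow>\<^sub>M (lborel :: real measure)"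
    by (auto intro!: measurable_completion simp: borel_prod[symmetric] cong: measurable_cong_sets)
  have "N \<in> null_sets (distr (lebesgue :: (real \<times> real) measure) lborel fst)
    \<and> N \<in> null_sets (distr (lebesgue :: (real \<times> real) measure) lborel snd)"
    if "N \<in> null_sets (lborel :: real measure)" for N
  proof -
    have "AE p in (lebesgue :: (real \<times> real) measure). fst p \<notin> N"
      "AE p in (lebesgue :: (real \<times> real) measure). snd p \<notin> N"
      using AE_lebesgue_fst_snd[OF AE_not_in[OF that]] by (auto intro: AE_completion)
    then show ?thesis
      using m that by (auto simp: null_sets_distr_iff completion.null_sets_iff_AE vimage_def)
  qed
  then show "fst \<in> (lebesgue :: (real \<times> real) measure) \<rightarrow>\<^sub>M (lebesgue :: real measure)"
            "snd \<in> (lebesgue :: (real \<times> real) measure) \<rightarrow>\<^sub>M (lebesgue :: real measure)"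
    using completion.measurable_completion2[OF m(1)] completion.measurable_completion2[OF m(2)] by auto
qed

lemma measurable_square_fst_snd [measurable]:
  "fst \<in> unit_square \<rightarrow>\<^sub>M unit_interval" "snd \<in> unit_square \<rightarrow>\<^sub>M unit_interval"
  by (intro measurable_restrict_space2 measurable_restrict_space1 measurable_lebesgue_fst_snd;
      auto)+

lemma Times_in_square [measurable, intro]:
  assumes "S \<in> sets unit_interval" "T \<in> sets unit_interval"
  shows "S \<times> T \<in> sets unit_square"
proof -
  have "S \<subseteq> {0..1}" "T \<subseteq> {0..1}"
    using sets.sets_into_space[OF assms(1)] sets.sets_into_space[OF assms(2)] by auto
  then have "S \<times> T = (fst -` S \<inter> space unit_square) \<inter> (snd -` T \<inter> space unit_square)"
    by auto
  then show ?thesis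
    using assms measurable_square_fst_snd by (metis measurable_sets sets.Int)
qed

text \<open>\<open>lebesgue\<close> on the plane is a completion and not the product of two Lebesgue
  measures. The product formula is taken from Borel sets: \<open>main_part\<close> gives Borel sets
  that differ from \<open>S\<close> and \<open>T\<close> by null sets only.\<close>

lemma emeasure_square_Times:
  assumes "S \<in> sets unit_interval" "T \<in> sets unit_interval"
  shows "emeasure unit_square (S \<times> T) = emeasure unit_interval S * emeasure unit_interval T"
proof -
  have sub: "S \<subseteq> {0..1}" "T \<subseteq> {0..1}"
    using sets.sets_into_space[OF assms(1)] sets.sets_into_space[OF assms(2)] by auto
  have leb: "S \<in> sets lebesgue" "T \<in> sets lebesgue"
    using assms by (auto simp: sets_restrict_space_iff)
  define S0 T0 where "S0 = main_part lborel S" and "T0 = main_part lborel T"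
  have b: "S0 \<in> sets borel" "T0 \<in> sets borel"
    using main_part_sets[OF leb(1)] main_part_sets[OF leb(2)] by (auto simp: S0_def T0_def)
  have AE: "AE x in lborel. x \<in> S0 \<longleftrightarrow> x \<in> S" "AE x in lborel. x \<in> T0 \<longleftrightarrow> x \<in> T"
    using AE_in_main_part[OF leb(1)] AE_in_main_part[OF leb(2)] by (auto simp: S0_def T0_def)
  have "AE p in lborel. p \<in> S0 \<times> T0 \<longleftrightarrow> p \<in> S \<times> T"
    using AE_lebesgue_fst_snd(1)[OF AE(1)] AE_lebesgue_fst_snd(2)[OF AE(2)]
    by eventually_elim (auto simp: mem_Times_iff)
  then have AE2: "AE p in lebesgue. p \<in> S \<times> T \<longleftrightarrow> p \<in> S0 \<times> T0"
    by (auto intro: AE_completion)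
  have st: "S \<times> T \<in> sets lebesgue"
    using Times_in_square[OF assms] by (auto simp: sets_restrict_space_iff)
  have "emeasure unit_square (S \<times> T) = emeasure lebesgue (S \<times> T)"
    using sub by (intro emeasure_restrict_space) auto
  also have "\<dots> = emeasure lebesgue (S0 \<times> T0)"
    using AE2 st b by (intro emeasure_eq_AE) (auto simp: borel_Times)
  also have "\<dots> = emeasure lborel S0 * emeasure lborel T0"
    using b by (simp add: borel_Times lborel_prod[symmetric] lborel.emeasure_pair_measure_Times)
  also have "\<dots> = emeasure lebesgue S * emeasure lebesgue T"
    using leb by (simp add: S0_def T0_def)
  also have "\<dots> = emeasure unit_interval S * emeasure unit_interval T"
    using sub by (simp add: emeasure_restrict_space)
  finally show ?thesis .
qed

lemma prob_space_unit_interval: "prob_space unit_interval"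
  by (rule prob_spaceI) (simp add: emeasure_restrict_space)

lemma prob_space_unit_square: "prob_space unit_square"
proof (rule prob_spaceI)
  have "{0..1::real} \<in> sets unit_interval" by (auto simp: sets_restrict_space_iff)
  then show "emeasure unit_square (space unit_square) = 1"
    using emeasure_square_Times[of "{0..1}" "{0..1}"]
    by (simp add: emeasure_restrict_space)
qed

interpretation I: prob_space unit_interval by (rule prob_space_unit_interval)
interpretation Q: prob_space unit_square by (rule prob_space_unit_square)

lemma measure_square_Times:
  assumes "S \<in> sets unit_interval" "T \<in> sets unit_interval"
  shows "measure unit_square (S \<times> T) = measure unit_interval S * measure unit_interval T"
  using emeasure_square_Times[OF assms] by (simp add: measure_def enn2real_mult)

lemma complete_measure_lebesgue_on:
  assumes "A \<in> sets lebesgue" shows "complete_measure (lebesgue_on A)"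
proof
  fix N B assume "B \<subseteq> N" "N \<in> null_sets (lebesgue_on A)"
  then have "B \<in> null_sets lebesgue"
    using assms null_sets_restrict_space[OF assms] 
    by (metis (no_types, lifting) Int_iff null_sets_completion_subset)
  moreover have "B \<subseteq> A"
    using \<open>B \<subseteq> N\<close> \<open>N \<in> null_sets (lebesgue_on A)\<close> assms null_sets_restrict_space[OF assms] by auto
  ultimately show "B \<in> sets (lebesgue_on A)"
    using assms by (auto simp: sets_restrict_space_iff)
qed

section \<open>Measure-preserving maps\<close>

text \<open>A Lebesgue set is a Borel set together with a subset of a Borel null set. The hypothesis
  makes preimages of Borel null sets null, and completeness of \<open>lebesgue_on A\<close> handles
  their subsets, so testing Borel sets suffices.\<close>

lemma measure_preserving_lebesgue_onI:
  fixes h :: "'a::euclidean_space \<Rightarrow> 'a"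
  assumes A: "A \<in> sets borel"
    and h: "h \<in> lebesgue_on A \<rightarrow>\<^sub>M borel" "\<And>x. x \<in> A \<Longrightarrow> h x \<in> A"
    and eq: "\<And>B. B \<in> sets borel \<Longrightarrow> emeasure (lebesgue_on A) (h -` B \<inter> A) = emeasure lebesgue (A \<inter> B)"
  shows "h \<in> lebesgue_on A \<rightarrow>\<^sub>M lebesgue_on A"
    and "distr (lebesgue_on A) (lebesgue_on A) h = lebesgue_on A"
proof -
  have leb: "A \<in> sets lebesgue" and sp: "space (lebesgue_on A) = A"
    using A by simp_all
  interpret L: complete_measure "lebesgue_on A"
    by (rule complete_measure_lebesgue_on[OF leb])
  have h': "h \<in> lebesgue_on A \<rightarrow>\<^sub>M lborel"
    using h(1) by (simp cong: measurable_cong_sets)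
  have pre_null: "h -` N \<inter> A \<in> null_sets (lebesgue_on A)" if "N \<in> null_sets lborel" for N
  proof -
    have N: "N \<in> sets borel" "emeasure lebesgue N = 0"
      using that by (auto simp: null_sets_def)
    have "emeasure lebesgue (A \<inter> N) = 0"
      using emeasure_mono[of "A \<inter> N" N lebesgue] N by simp
    then show ?thesis
      using eq[of N] N measurable_sets[OF h(1), of N] sp by (auto intro!: null_setsI)
  qed
  have "N \<in> null_sets (distr (lebesgue_on A) lborel h)" if "N \<in> null_sets lborel" for N
    using pre_null[OF that] that h' sp by (auto simp: null_sets_distr_iff)
  then have "h \<in> lebesgue_on A \<rightarrow>\<^sub>M lebesgue"
    by (intro L.measurable_completion2[OF h']) auto
  then show m: "h \<in> lebesgue_on A \<rightarrow>\<^sub>M lebesgue_on A"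
    using h(2) sp by (intro measurable_restrict_space2) auto
  show "distr (lebesgue_on A) (lebesgue_on A) h = lebesgue_on A"
  proof (rule measure_eqI)
    fix E assume "E \<in> sets (distr (lebesgue_on A) (lebesgue_on A) h)"
    then have E: "E \<in> sets (lebesgue_on A)" "E \<in> sets lebesgue" "E \<subseteq> A"
      using leb by (auto simp: sets_restrict_space_iff)
    obtain B N N' where B: "E = B \<union> N" "N \<subseteq> N'" "N' \<in> null_sets lborel" "B \<in> sets lborel"
      using sets_completionE[OF E(2)] by metis
    have [simp]: "B \<in> sets borel" using B by simp
    have hN: "h -` N \<inter> A \<in> null_sets (lebesgue_on A)"
      by (rule L.complete2[OF _ pre_null[OF B(3)]]) (use B(2) in auto)
    have N: "N \<in> null_sets lebesgue"
      using null_sets_completion_subset[OF B(2)] B(3) by (auto intro: null_sets_completionI)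
    have "emeasure (distr (lebesgue_on A) (lebesgue_on A) h) E = emeasure (lebesgue_on A) (h -` E \<inter> A)"
      using m E sp by (subst emeasure_distr) auto
    also have "h -` E \<inter> A = (h -` B \<inter> A) \<union> (h -` N \<inter> A)"
      using B by auto
    also have "emeasure (lebesgue_on A) \<dots> = emeasure (lebesgue_on A) (h -` B \<inter> A)"
      by (rule emeasure_Un_null_set[OF _ hN]) (use measurable_sets[OF h(1), of B] sp in auto)
    also have "\<dots> = emeasure lebesgue (A \<inter> B)"
      by (rule eq) simp
    also have "A \<inter> B = B"
      using E B by auto
    also have "emeasure lebesgue B = emeasure lebesgue E"
      unfolding B(1) by (rule emeasure_Un_null_set[symmetric, OF _ N]) simp
    also have "\<dots> = emeasure (lebesgue_on A) E"
      using E leb by (simp add: emeasure_restrict_space)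
    finally show "emeasure (distr (lebesgue_on A) (lebesgue_on A) h) E = emeasure (lebesgue_on A) E" .
  qed simp
qed

text \<open>Borel rectangles are an intersection-stable generator and the image measures are finite,
  so agreement on rectangles gives agreement on all Borel sets of the plane.\<close>

lemma measure_preserving_squareI:
  assumes h: "h \<in> unit_square \<rightarrow>\<^sub>M borel" "\<And>p. p \<in> {0..1} \<times> {0..1} \<Longrightarrow> h p \<in> {0..1} \<times> {0..1}"
    and eq: "\<And>A B. A \<in> sets borel \<Longrightarrow> B \<in> sets borel \<Longrightarrow>
      emeasure unit_square (h -` (A \<times> B) \<inter> ({0..1} \<times> {0..1}))
      = emeasure unit_interval ({0..1} \<inter> A) * emeasure unit_interval ({0..1} \<inter> B)"
  shows "h \<in> unit_square \<rightarrow>\<^sub>M unit_square" "distr unit_square unit_square h = unit_square"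
proof -
  let ?E = "{a \<times> b | a b. a \<in> sets (borel :: real measure) \<and> b \<in> sets (borel :: real measure)}"
  have id: "(\<lambda>p. p) \<in> unit_square \<rightarrow>\<^sub>M borel"
    by (intro measurable_restrict_space1 measurable_completion) simp
  have sets: "sets (borel :: (real \<times> real) measure) = sigma_sets UNIV ?E"
    unfolding borel_prod[symmetric] sets_pair_measure by simp
  have D: "distr unit_square borel h = distr unit_square borel (\<lambda>p. p)"
  proof (rule measure_eqI_generator_eq[where E="?E" and \<Omega>=UNIV and A="\<lambda>_. UNIV"])
    show "Int_stable ?E" using Int_stable_pair_measure_generator[of "borel :: real measure" "borel :: real measure"] by simp
    fix X assume "X \<in> ?E"
    then obtain A B where X: "X = A \<times> B" "A \<in> sets borel" "B \<in> sets borel" by auto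
    have ab: "{0..1} \<inter> A \<in> sets unit_interval" "{0..1} \<inter> B \<in> sets unit_interval"
      using X by (auto simp: sets_restrict_space_iff)
    have "emeasure (distr unit_square borel (\<lambda>p. p)) X
        = emeasure unit_square (({0..1} \<inter> A) \<times> ({0..1} \<inter> B))"
      using X id by (subst emeasure_distr) (auto intro!: arg_cong[where f="emeasure _"] simp: borel_Times)
    also have "\<dots> = emeasure unit_interval ({0..1} \<inter> A) * emeasure unit_interval ({0..1} \<inter> B)"
      by (rule emeasure_square_Times[OF ab])
    also have "\<dots> = emeasure (distr unit_square borel h) X"
      using eq[OF X(2,3)] X h(1) by (subst emeasure_distr) (auto simp: borel_Times)
    finally show "emeasure (distr unit_square borel h) X = emeasure (distr unit_square borel (\<lambda>p. p)) X"
      by simp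
  next
    show "range (\<lambda>_. UNIV) \<subseteq> ?E"
      by (auto intro!: exI[of _ "UNIV :: real set"])
    have "prob_space (distr unit_square borel h)"
      by (rule Q.prob_space_distr[OF h(1)])
    then show "emeasure (distr unit_square borel h) UNIV \<noteq> \<infinity>"
      using prob_space.emeasure_space_1 by fastforce
  qed (use sets in auto)
  have "emeasure unit_square (h -` B \<inter> ({0..1} \<times> {0..1})) = emeasure lebesgue ({0..1} \<times> {0..1} \<inter> B)"
    if "B \<in> sets borel" for B
  proof -
    have "emeasure unit_square (h -` B \<inter> ({0..1} \<times> {0..1})) = emeasure (distr unit_square borel h) B"
      using that h(1) by (subst emeasure_distr) auto
    also have "\<dots> = emeasure unit_square ({0..1} \<times> {0..1} \<inter> B)"
      unfolding D using that id by (subst emeasure_distr) (auto simp: Int_commute)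
    finally show ?thesis
      by (simp add: emeasure_restrict_space)
  qed
  then show "h \<in> unit_square \<rightarrow>\<^sub>M unit_square" "distr unit_square unit_square h = unit_square"
    using measure_preserving_lebesgue_onI[OF square_sets_borel h(1) h(2)] by auto
qed

lemma mp_mapsD:
  assumes "\<phi> \<in> mp_maps"
  shows "\<phi> \<in> unit_interval \<rightarrow>\<^sub>M unit_interval" "distr unit_interval unit_interval \<phi> = unit_interval"
    "x \<in> {0..1} \<Longrightarrow> \<phi> x \<in> {0..1}"
  using assms measurable_space[of \<phi> unit_interval unit_interval x] by (auto simp: mp_maps_def)

lemma emeasure_mp_vimage:
  assumes "\<phi> \<in> mp_maps" "A \<in> sets unit_interval"
  shows "emeasure unit_interval (\<phi> -` A \<inter> {0..1}) = emeasure unit_interval A"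
  using mp_mapsD[OF assms(1)] emeasure_distr[of \<phi> unit_interval unit_interval A] assms(2) by simp

lemma measure_mp_vimage:
  assumes "\<phi> \<in> mp_maps" "A \<in> sets unit_interval"
  shows "measure unit_interval (\<phi> -` A \<inter> {0..1}) = measure unit_interval A"
  using emeasure_mp_vimage[OF assms] by (simp add: measure_def)

lemma AE_mp:
  assumes "\<phi> \<in> mp_maps" "AE x in unit_interval. P x"
  shows "AE x in unit_interval. P (\<phi> x)"
proof -
  have "AE x in distr unit_interval unit_interval \<phi>. P x"
    unfolding mp_mapsD(2)[OF assms(1)] by (rule assms(2))
  then show ?thesis
    by (rule AE_distrD[OF mp_mapsD(1)[OF assms(1)]])
qed

lemma mp_id: "(\<lambda>x. x) \<in> mp_maps"
  by (auto simp: mp_maps_def distr_id2)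

lemma mp_comp:
  assumes "\<phi> \<in> mp_maps" "\<psi> \<in> mp_maps"
  shows "(\<lambda>x. \<phi> (\<psi> x)) \<in> mp_maps"
  using mp_mapsD(1,2)[OF assms(1)] mp_mapsD(1,2)[OF assms(2)]
    distr_distr[of \<phi> unit_interval unit_interval \<psi> unit_interval]
  by (auto simp: mp_maps_def comp_def intro: measurable_compose)

definition square_map :: "(real \<Rightarrow> real) \<Rightarrow> real \<times> real \<Rightarrow> real \<times> real" where
  "square_map \<phi> = (\<lambda>(x, y). (\<phi> x, \<phi> y))"

lemma square_map_mp:
  assumes "\<phi> \<in> mp_maps"
  shows "square_map \<phi> \<in> unit_square \<rightarrow>\<^sub>M unit_square"
    "distr unit_square unit_square (square_map \<phi>) = unit_square"
proof -
  note mp = mp_mapsD[OF assms]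
  have b: "\<phi> \<in> unit_interval \<rightarrow>\<^sub>M borel"
    using mp(1) by (rule measurable_compose) (auto intro!: measurable_restrict_space1 measurable_completion)
  have m: "square_map \<phi> \<in> unit_square \<rightarrow>\<^sub>M borel"
  proof -
    have "(\<lambda>p. (\<phi> (fst p), \<phi> (snd p))) \<in> unit_square \<rightarrow>\<^sub>M borel \<Otimes>\<^sub>M borel"
      using b by measurable
    then show ?thesis by (simp add: square_map_def case_prod_beta' borel_prod)
  qed
  have eq: "emeasure unit_square (square_map \<phi> -` (A \<times> B) \<inter> ({0..1} \<times> {0..1}))
      = emeasure unit_interval ({0..1} \<inter> A) * emeasure unit_interval ({0..1} \<inter> B)"
    if "A \<in> sets borel" "B \<in> sets borel" for A B
  proof -
    have ab: "{0..1} \<inter> A \<in> sets unit_interval" "{0..1} \<inter> B \<in> sets unit_interval"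
      using that by (auto simp: sets_restrict_space_iff)
    have vm: "\<phi> -` ({0..1} \<inter> A) \<inter> {0..1} \<in> sets unit_interval"
      "\<phi> -` ({0..1} \<inter> B) \<inter> {0..1} \<in> sets unit_interval"
      using measurable_sets[OF mp(1) ab(1)] measurable_sets[OF mp(1) ab(2)] by auto
    have "square_map \<phi> -` (A \<times> B) \<inter> ({0..1} \<times> {0..1})
        = (\<phi> -` ({0..1} \<inter> A) \<inter> {0..1}) \<times> (\<phi> -` ({0..1} \<inter> B) \<inter> {0..1})"
      using mp(3) by (auto simp: square_map_def)
    then show ?thesis
      using emeasure_square_Times[OF vm] emeasure_mp_vimage[OF assms ab(1)] emeasure_mp_vimage[OF assms ab(2)]
      by (simp only:)
  qed
  have into: "square_map \<phi> p \<in> {0..1} \<times> {0..1}" if "p \<in> {0..1} \<times> {0..1}" for p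
    using that mp(3) by (auto simp: square_map_def simp del: atLeastAtMost_iff)
  show "square_map \<phi> \<in> unit_square \<rightarrow>\<^sub>M unit_square"
    by (rule measure_preserving_squareI(1)[OF m into eq])
  show "distr unit_square unit_square (square_map \<phi>) = unit_square"
    by (rule measure_preserving_squareI(2)[OF m into eq])
qed

lemma swap_mp:
  "prod.swap \<in> unit_square \<rightarrow>\<^sub>M unit_square"
  "distr unit_square unit_square prod.swap = unit_square"
proof -
  have m: "prod.swap \<in> unit_square \<rightarrow>\<^sub>M borel"
  proof -
    have "(\<lambda>p. (snd p, fst p)) \<in> unit_square \<rightarrow>\<^sub>M (borel :: real measure) \<Otimes>\<^sub>M (borel :: real measure)"
      by (intro measurable_Pair measurable_compose[OF measurable_square_fst_snd(1)]
          measurable_compose[OF measurable_square_fst_snd(2)] measurable_restrict_space1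
          measurable_completion) auto
    moreover have "prod.swap = (\<lambda>p :: real \<times> real. (snd p, fst p))" by auto
    ultimately show ?thesis by (simp add: borel_prod)
  qed
  have eq: "emeasure unit_square (prod.swap -` (A \<times> B) \<inter> ({0..1} \<times> {0..1}))
      = emeasure unit_interval ({0..1} \<inter> A) * emeasure unit_interval ({0..1} \<inter> B)"
    if "A \<in> sets borel" "B \<in> sets borel" for A B
  proof -
    have ab: "{0..1} \<inter> A \<in> sets unit_interval" "{0..1} \<inter> B \<in> sets unit_interval"
      using that by (auto simp: sets_restrict_space_iff)
    have "prod.swap -` (A \<times> B) \<inter> ({0..1} \<times> {0..1}) = ({0..1} \<inter> B) \<times> ({0..1} \<inter> A)"
      by auto
    then show ?thesis
      using emeasure_square_Times[OF ab(2,1)] by (simp add: mult.commute)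
  qed
  show "prod.swap \<in> unit_square \<rightarrow>\<^sub>M unit_square" "distr unit_square unit_square prod.swap = unit_square"
    by (rule measure_preserving_squareI[OF m _ eq]; fastforce)+
qed

lemma AE_square_fst_snd:
  assumes "AE x in unit_interval. P x"
  shows "AE p in unit_square. P (fst p) \<and> P (snd p)"
proof -
  have "AE x in lebesgue. x \<in> {0..1} \<longrightarrow> P x"
    using assms by (subst (asm) AE_restrict_space_iff) auto
  then have "AE x in lborel. x \<in> {0..1} \<longrightarrow> P x"
    by (simp add: AE_completion_iff)
  from AE_lebesgue_fst_snd[OF this]
  have "AE p in lborel. (fst p \<in> {0..1} \<longrightarrow> P (fst p)) \<and> (snd p \<in> {0..1} \<longrightarrow> P (snd p))"
    by eventually_elim auto
  then have "AE p in lebesgue. (fst p \<in> {0..1} \<longrightarrow> P (fst p)) \<and> (snd p \<in> {0..1} \<longrightarrow> P (snd p))"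
    by (rule AE_completion)
  then show ?thesis
    by (subst AE_restrict_space_iff) (simp, rule eventually_mono, auto)
qed

section \<open>Rank maps of labellings\<close>

abbreviation vol :: "real set \<Rightarrow> real" where
  "vol \<equiv> measure unit_interval"

lemma borel_imp_unit_interval: "A \<in> sets borel \<Longrightarrow> {0..1} \<inter> A \<in> sets unit_interval"
  by (auto simp: sets_restrict_space_iff)

lemma Int_borel_unit_interval:
  assumes "B \<in> sets unit_interval" "A \<in> sets borel" shows "B \<inter> A \<in> sets unit_interval"
proof -
  have "B \<inter> A = B \<inter> ({0..1} \<inter> A)"
    using sets.sets_into_space[OF assms(1)] by auto
  then show ?thesis
    using assms borel_imp_unit_interval by (metis sets.Int)
qed

lemma vol_Int_atMost_mono:
  assumes "B \<in> sets unit_interval" "x \<le> y"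
  shows "vol (B \<inter> {..x}) \<le> vol (B \<inter> {..y})"
  using assms by (intro I.finite_measure_mono) (auto intro: Int_borel_unit_interval)

lemma vol_Int_atMost_diff_le:
  assumes B: "B \<in> sets unit_interval" and "x \<le> y"
  shows "vol (B \<inter> {..y}) - vol (B \<inter> {..x}) \<le> y - x"
proof -
  have "vol (B \<inter> {..y}) - vol (B \<inter> {..x}) = vol (B \<inter> {..y} - B \<inter> {..x})"
    using assms by (intro I.finite_measure_Diff[symmetric] Int_borel_unit_interval) auto
  also have "\<dots> \<le> vol ({0..1} \<inter> {x..y})"
    using sets.sets_into_space[OF B]
    by (intro I.finite_measure_mono borel_imp_unit_interval) auto
  also have "\<dots> = measure lebesgue ({0..1} \<inter> {x..y})"
    by (simp add: measure_restrict_space)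
  also have "\<dots> \<le> measure lebesgue {x..y}"
    by (intro measure_mono_fmeasurable) auto
  also have "\<dots> = y - x" using assms by simp
  finally show ?thesis .
qed

lemma continuous_vol_Int_atMost:
  assumes B: "B \<in> sets unit_interval"
  shows "continuous_on UNIV (\<lambda>x. vol (B \<inter> {..x}))"
proof -
  have "\<bar>vol (B \<inter> {..x}) - vol (B \<inter> {..y})\<bar> \<le> 1 * \<bar>x - y\<bar>" for x y
    using vol_Int_atMost_diff_le[OF B, of x y] vol_Int_atMost_diff_le[OF B, of y x]
      vol_Int_atMost_mono[OF B, of x y] vol_Int_atMost_mono[OF B, of y x] by (cases "x \<le> y") auto
  then show ?thesis
    by (intro lipschitz_on_continuous_on[of 1] lipschitz_onI) (auto simp: dist_real_def)
qed

text \<open>Lebesgue measure has no atoms: the distribution function of \<open>B\<close> is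
  continuous, so the intermediate value theorem finds an initial part of \<open>B\<close> of any
  admissible measure.\<close>

lemma exists_vol_Int_atMost:
  assumes B: "B \<in> sets unit_interval" and r: "0 \<le> r" "r \<le> vol B"
  shows "\<exists>x\<in>{0..1}. vol (B \<inter> {..x}) = r"
proof -
  have sub: "B \<subseteq> {0..1}" using sets.sets_into_space[OF B] by auto
  have "vol (B \<inter> {..0}) \<le> vol {0}"
    using sub by (intro I.finite_measure_mono) (auto simp: sets_restrict_space_iff)
  also have "\<dots> = 0" by (simp add: measure_restrict_space)
  finally have "vol (B \<inter> {..0}) \<le> r" using r by simp
  moreover have "B \<inter> {..1} = B" using sub by auto
  ultimately show ?thesis
    using IVT'[of "\<lambda>x. vol (B \<inter> {..x})" 0 r 1] r continuous_on_subset[OF continuous_vol_Int_atMost[OF B]]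
    by fastforce
qed

text \<open>The distribution function of \<open>B\<close>, as a map on \<open>B\<close>, is
  uniformly distributed on the interval from 0 to \<open>vol B\<close>. This is what makes
  \<open>rank\<close> measure preserving.\<close>

lemma vol_Int_atMost_level:
  assumes B: "B \<in> sets unit_interval" and r: "0 \<le> r"
  shows "vol {x \<in> B. vol (B \<inter> {..x}) \<le> r} = min r (vol B)"
proof (cases "r < vol B")
  case False
  have "vol (B \<inter> {..x}) \<le> r" for x
  proof -
    have "vol (B \<inter> {..x}) \<le> vol B"
      using B by (intro I.finite_measure_mono) auto
    then show ?thesis using False by linarith
  qed
  then have "{x \<in> B. vol (B \<inter> {..x}) \<le> r} = B"
    by simp
  then show ?thesis using False by simp
next
  case True
  have sub: "B \<subseteq> {0..1}" using sets.sets_into_space[OF B] by auto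
  let ?K = "{x \<in> {0..1}. vol (B \<inter> {..x}) \<le> r}"
  obtain x0 where x0: "x0 \<in> {0..1}" "vol (B \<inter> {..x0}) = r"
    using exists_vol_Int_atMost[OF B r] True by auto
  have cont: "continuous_on {0..1} (\<lambda>x. vol (B \<inter> {..x}))"
    using continuous_vol_Int_atMost[OF B] continuous_on_subset by blast
  have "closed ?K"
    by (rule continuous_closed_preimage_constant[of "{0..1}" "\<lambda>x. max 0 (vol (B \<inter> {..x}) - r)" 0, THEN back_subst[of closed]])
      (auto intro!: continuous_intros cont)
  then have "compact ?K"
    using compact_Int_closed[of "{0..1::real}" ?K] by (auto simp: Int_def cong: conj_cong)
  \<comment> \<open>The distribution function is constant across gaps of \<open>B\<close>, so the
    value \<open>r\<close> may be taken on a whole interval; its rightmost point describes the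
    sublevel set exactly.\<close>
  then obtain x1 where x1: "x1 \<in> ?K" "\<And>x. x \<in> ?K \<Longrightarrow> x \<le> x1"
    using compact_attains_sup[of ?K] x0 by (metis (mono_tags, lifting) dual_order.refl empty_iff mem_Collect_eq)
  have "x0 \<le> x1" using x1(2)[of x0] x0 by auto
  then have "vol (B \<inter> {..x1}) = r"
    using vol_Int_atMost_mono[OF B, of x0 x1] x0 x1(1) by auto
  moreover have "{x \<in> B. vol (B \<inter> {..x}) \<le> r} = B \<inter> {..x1}"
  proof (intro set_eqI iffI)
    show "x \<in> B \<inter> {..x1}" if "x \<in> {x \<in> B. vol (B \<inter> {..x}) \<le> r}" for x
      using that sub x1(2)[of x] by auto
    show "x \<in> {x \<in> B. vol (B \<inter> {..x}) \<le> r}" if "x \<in> B \<inter> {..x1}" for x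
      using that vol_Int_atMost_mono[OF B, of x x1] x1(1) by auto
  qed
  ultimately show ?thesis using True by simp
qed

text \<open>The position of a point of the unit interval once the interval is sorted by the values
  of \<open>c\<close>, ties being broken by the usual order.\<close>

definition rank :: "(real \<Rightarrow> nat) \<Rightarrow> real \<Rightarrow> real" where
  "rank c x = vol {y \<in> {0..1}. c y < c x} + vol ({y \<in> {0..1}. c y = c x} \<inter> {..x})"

text \<open>The point at which the block of label \<open>i\<close> begins once the interval is
  sorted.\<close>

definition cumulative :: "(real \<Rightarrow> nat) \<Rightarrow> nat \<Rightarrow> real" where
  "cumulative c i = vol {y \<in> {0..1}. c y < i}"

text \<open>A partition into \<open>N\<close> measurable parts, some possibly empty or null. Numbers
  as labels turn refinement into arithmetic and give an order to sort by.\<close>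

definition labelling :: "nat \<Rightarrow> (real \<Rightarrow> nat) set" where
  "labelling N = {c. c \<in> unit_interval \<rightarrow>\<^sub>M count_space UNIV \<and> (\<forall>x\<in>{0..1}. c x < N)}"

lemma labelling_sets:
  assumes "c \<in> labelling N" shows "{y \<in> {0..1}. P (c y)} \<in> sets unit_interval"
proof -
  have "c \<in> unit_interval \<rightarrow>\<^sub>M count_space UNIV" using assms by (simp add: labelling_def)
  from measurable_sets[OF this, of "{i. P i}"] show ?thesis
    by (simp add: vimage_def Int_def conj_commute)
qed

lemma cumulative_0 [simp]: "cumulative c 0 = 0"
  by (simp add: cumulative_def)

lemma cumulative_N: "c \<in> labelling N \<Longrightarrow> cumulative c N = 1"
proof -
  assume "c \<in> labelling N"
  then have "{y \<in> {0..1}. c y < N} = space unit_interval" by (auto simp: labelling_def)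
  then show ?thesis unfolding cumulative_def using I.prob_space by simp
qed

lemma cumulative_mono: "c \<in> labelling N \<Longrightarrow> mono (cumulative c)"
  unfolding cumulative_def by (intro monoI I.finite_measure_mono labelling_sets) auto

lemma cumulative_Suc:
  assumes "c \<in> labelling N"
  shows "cumulative c (Suc i) = cumulative c i + vol {y \<in> {0..1}. c y = i}"
proof -
  have "{y \<in> {0..1}. c y < Suc i} = {y \<in> {0..1}. c y < i} \<union> {y \<in> {0..1}. c y = i}" by auto
  then show ?thesis
    unfolding cumulative_def
    by (simp only:, intro I.finite_measure_Union labelling_sets[OF assms]) auto
qed

lemma rank_bounds:
  assumes c: "c \<in> labelling N"
  shows "cumulative c (c x) \<le> rank c x" "rank c x \<le> cumulative c (Suc (c x))"
proof -
  have "vol ({y \<in> {0..1}. c y = c x} \<inter> {..x}) \<le> vol {y \<in> {0..1}. c y = c x}"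
    by (intro I.finite_measure_mono labelling_sets[OF c]) auto
  then show "cumulative c (c x) \<le> rank c x" "rank c x \<le> cumulative c (Suc (c x))"
    unfolding cumulative_Suc[OF c] by (auto simp: rank_def cumulative_def)
qed

lemma rank_in_unit:
  assumes c: "c \<in> labelling N" shows "rank c x \<in> {0..1}"
proof -
  have "0 \<le> cumulative c (c x)" "cumulative c (Suc (c x)) \<le> 1"
    by (auto simp: cumulative_def)
  then show ?thesis using rank_bounds[OF c, of x] by simp
qed

text \<open>On each of the finitely many fibres \<open>rank c\<close> coincides with a continuous
  function, the start of the block plus the distribution function of the fibre.\<close>

lemma rank_measurable:
  assumes c: "c \<in> labelling N" shows "rank c \<in> borel_measurable unit_interval"
proof -
  have *: "(\<lambda>x. cumulative c i + vol ({y \<in> {0..1}. c y = i} \<inter> {..x})) \<in> borel_measurable unit_interval" for i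
    by (intro borel_measurable_add borel_measurable_const measurable_restrict_space1 measurable_completion)
      (use borel_measurable_continuous_onI[OF continuous_vol_Int_atMost[OF labelling_sets[OF c]]] in simp)
  let ?g = "(\<lambda>x. \<Sum>i<N. (cumulative c i + vol ({y \<in> {0..1}. c y = i} \<inter> {..x})) * indicator {y \<in> {0..1}. c y = i} x)"
  have g: "?g \<in> borel_measurable unit_interval"
    by (intro borel_measurable_sum borel_measurable_times * borel_measurable_indicator labelling_sets[OF c])
  have eq: "?g x = rank c x"
    if "x \<in> space unit_interval" for x
  proof -
    define h where "h i = (cumulative c i + vol ({y \<in> {0..1}. c y = i} \<inter> {..x}))" for i
    define k :: "nat \<Rightarrow> real" where "k i = indicator {y \<in> {0..1}. c y = i} x" for i
    have "c x < N" "k (c x) = 1" "\<And>i. i \<noteq> c x \<Longrightarrow> k i = 0"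
      using that c by (auto simp: labelling_def k_def)
    then have "(\<Sum>i<N. h i * k i) = h (c x)"
      by (subst sum.remove[of _ "c x"]) (auto intro!: sum.neutral)
    then show ?thesis
      by (simp only: h_def k_def rank_def cumulative_def)
  qed
  show ?thesis
    by (rule iffD1[OF measurable_cong[of unit_interval ?g "rank c" borel, OF eq] g])
qed

text \<open>Label \<open>i\<close> fills the interval from \<open>cumulative c i\<close> to
  \<open>cumulative c (Suc i)\<close> uniformly, so it contributes the length of this interval below
  \<open>t\<close>; the contributions telescope.\<close>

lemma vol_rank_le:
  assumes c: "c \<in> labelling N" and t: "0 \<le> t" "t \<le> 1"
  shows "vol {x \<in> {0..1}. rank c x \<le> t} = t"
proof -
  let ?B = "\<lambda>i. {y \<in> {0..1}. c y = i}" and ?s = "cumulative c"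
  have B: "?B i \<in> sets unit_interval" for i by (rule labelling_sets[OF c])
  have r: "{x \<in> {0..1}. rank c x \<le> t \<and> c x = i} \<in> sets unit_interval" for i
  proof -
    have "{x \<in> space unit_interval. rank c x \<le> t} \<in> sets unit_interval"
      using rank_measurable[OF c] by measurable
    then have "{x \<in> {0..1}. rank c x \<le> t} \<inter> ?B i \<in> sets unit_interval"
      using B[of i] by (simp add: sets.Int)
    moreover have "{x \<in> {0..1}. rank c x \<le> t} \<inter> ?B i = {x \<in> {0..1}. rank c x \<le> t \<and> c x = i}" by auto
    ultimately show ?thesis by simp
  qed
  have step: "vol {x \<in> {0..1}. rank c x \<le> t \<and> c x = i} = min t (?s (Suc i)) - min t (?s i)" for i
  proof -
    have eq: "{x \<in> {0..1}. rank c x \<le> t \<and> c x = i} = {x \<in> ?B i. vol (?B i \<inter> {..x}) \<le> t - ?s i}"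
      by (auto simp: rank_def cumulative_def)
    have s: "?s (Suc i) = ?s i + vol (?B i)" by (rule cumulative_Suc[OF c])
    show ?thesis
    proof (cases "?s i \<le> t")
      case True
      then show ?thesis
        unfolding eq using vol_Int_atMost_level[OF B, of "t - ?s i" i] s by (auto simp: min_def)
    next
      case False
      have "\<not> vol (?B i \<inter> {..x}) \<le> t - ?s i" for x
        using False measure_nonneg[of unit_interval "?B i \<inter> {..x}"] by linarith
      then have "{x \<in> ?B i. vol (?B i \<inter> {..x}) \<le> t - ?s i} = {}"
        by simp
      moreover have "min t (?s (Suc i)) = t" "min t (?s i) = t"
        using False s measure_nonneg[of unit_interval "?B i"] by linarith+
      ultimately show ?thesis
        unfolding eq by (simp only: measure_empty diff_self)
    qed
  qed
  have "{x \<in> {0..1}. rank c x \<le> t} = (\<Union>i<N. {x \<in> {0..1}. rank c x \<le> t \<and> c x = i})"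
    using c by (auto simp: labelling_def)
  also have "vol \<dots> = (\<Sum>i<N. vol {x \<in> {0..1}. rank c x \<le> t \<and> c x = i})"
    by (intro I.finite_measure_finite_Union image_subsetI r) (auto simp: disjoint_family_on_def)
  also have "\<dots> = min t (?s N) - min t (?s 0)"
    unfolding step by (rule sum_lessThan_telescope)
  finally show ?thesis
    using t cumulative_N[OF c] by simp
qed

text \<open>A probability distribution on the line is determined by its distribution function, here
  the uniform one. This settles Borel sets, and completeness extends it to Lebesgue sets.\<close>

lemma mp_mapsI_cdf:
  assumes m: "h \<in> borel_measurable unit_interval" and into: "\<And>x. x \<in> {0..1} \<Longrightarrow> h x \<in> {0..1}"
    and cdf: "\<And>t. 0 \<le> t \<Longrightarrow> t \<le> 1 \<Longrightarrow> vol {x \<in> {0..1}. h x \<le> t} = t"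
  shows "h \<in> mp_maps"
proof -
  have id: "(\<lambda>x. x) \<in> borel_measurable unit_interval"
    by (intro measurable_restrict_space1 measurable_completion) simp
  have "cdf (distr unit_interval borel h) t = cdf (distr unit_interval borel (\<lambda>x. x)) t" for t
  proof -
    have "cdf (distr unit_interval borel h) t = vol {x \<in> {0..1}. h x \<le> t}"
      using m unfolding cdf_def by (subst measure_distr) (auto intro!: arg_cong[where f=vol])
    also have "\<dots> = vol {x \<in> {0..1}. x \<le> t}"
    proof -
      consider "t < 0" | "0 \<le> t" "t \<le> 1" | "t > 1" by linarith
      then show ?thesis
      proof cases
        case 1
        then have "{x \<in> {0..1}. h x \<le> t} = {}" "{x \<in> {0..1}. x \<le> t} = {}"
          using into by force+
        then show ?thesis by (simp only:)
      next
        case 2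
        have "{x \<in> {0..1}. x \<le> t} = {0..t}" using 2 by auto
        then show ?thesis using cdf[OF 2] 2 by (simp add: measure_restrict_space)
      next
        case 3
        then have "{x \<in> {0..1}. h x \<le> t} = {0..1}" "{x \<in> {0..1}. x \<le> t} = {0..1}"
          using into by force+
        then show ?thesis by (simp only:)
      qed
    qed
    also have "\<dots> = cdf (distr unit_interval borel (\<lambda>x. x)) t"
      using id unfolding cdf_def by (subst measure_distr) (auto intro!: arg_cong[where f=vol])
    finally show ?thesis .
  qed
  then have D: "distr unit_interval borel h = distr unit_interval borel (\<lambda>x. x)"
    using m id by (intro cdf_unique) (auto simp: real_distribution_def real_distribution_axioms_def
        intro!: I.prob_space_distr)
  have eq: "emeasure unit_interval (h -` B \<inter> {0..1}) = emeasure lebesgue ({0..1} \<inter> B)"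
    if "B \<in> sets borel" for B
  proof -
    have "emeasure unit_interval (h -` B \<inter> {0..1}) = emeasure (distr unit_interval borel h) B"
      using that m by (subst emeasure_distr) auto
    also have "\<dots> = emeasure unit_interval ({0..1} \<inter> B)"
      unfolding D using that id by (subst emeasure_distr) (auto simp: Int_commute)
    finally show ?thesis by (simp add: emeasure_restrict_space)
  qed
  have A: "{0..1::real} \<in> sets borel" by simp
  show ?thesis
    using measure_preserving_lebesgue_onI[OF A m into eq] by (simp add: mp_maps_def)
qed

lemma rank_mp: "c \<in> labelling N \<Longrightarrow> rank c \<in> mp_maps"
  by (intro mp_mapsI_cdf rank_measurable rank_in_unit vol_rank_le)

section \<open>Interval partitions given by breakpoints\<close>

text \<open>The index \<open>i < N\<close> with \<open>s i < t \<le> s (i + 1)\<close>, for increasing \<open>s\<close> running from 0 to 1.\<close>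

definition level :: "(nat \<Rightarrow> real) \<Rightarrow> nat \<Rightarrow> real \<Rightarrow> nat" where
  "level s N t = card {j \<in> {1..<N}. s j < t}"

lemma level_eq:
  assumes "mono s" "i < N" "s i < t" "t \<le> s (Suc i)"
  shows "level s N t = i"
proof -
  have "s j < t \<longleftrightarrow> j \<le> i" for j
  proof
    show "s j < t" if "j \<le> i" using monoD[OF assms(1) that] assms(3) by simp
    show "j \<le> i" if "s j < t"
    proof (rule ccontr)
      assume "\<not> j \<le> i"
      then have "s (Suc i) \<le> s j" using assms(1) by (auto intro: monoD)
      then show False using that assms(4) by simp
    qed
  qed
  \<comment> \<open>The count in \<open>level\<close> skips index 0, so the \<open>Suc i\<close>
    breakpoints below \<open>t\<close> are counted as \<open>i\<close>.\<close>
  then have "{j \<in> {1..<N}. s j < t} = {j \<in> {1..<N}. j \<le> i}" by simp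
  also have "\<dots> = {1..i}" using assms(2) by auto
  finally have "{j \<in> {1..<N}. s j < t} = {1..i}" .
  then show ?thesis by (simp add: level_def)
qed

lemma level_less: "0 < N \<Longrightarrow> level s N t < N"
proof -
  assume "0 < N"
  have "level s N t \<le> card {1..<N}" unfolding level_def by (intro card_mono) auto
  then show ?thesis using \<open>0 < N\<close> by simp
qed

lemma level_bounds:
  assumes "mono s" "s 0 = 0" "s N = 1" "0 < t" "t \<le> 1"
  shows "level s N t < N" "s (level s N t) < t" "t \<le> s (Suc (level s N t))"
proof -
  \<comment> \<open>The block of \<open>t\<close> ends at the first breakpoint that reaches
    \<open>t\<close>; positivity of \<open>t\<close> keeps that breakpoint away from index
    0.\<close>
  define k where "k = (LEAST k. t \<le> s k)"
  have k: "t \<le> s k" unfolding k_def by (rule LeastI[of _ N]) (use assms in simp)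
  have less: "s j < t" if "j < k" for j
    using not_less_Least[OF that[unfolded k_def]] by simp
  have "k \<noteq> 0" using k assms by (metis not_less)
  then obtain i where i: "k = Suc i" by (cases k) auto
  have "k \<le> N" unfolding k_def by (rule Least_le) (use assms in simp)
  then have "level s N t = i"
    using less[of i] k i assms by (intro level_eq) auto
  then show "level s N t < N" "s (level s N t) < t" "t \<le> s (Suc (level s N t))"
    using i k less \<open>k \<le> N\<close> by auto
qed

lemma level_measurable: "level s N \<in> borel \<rightarrow>\<^sub>M count_space UNIV"
proof -
  have "(\<lambda>t. \<Sum>j\<in>{1..<N}. if s j < t then 1 else 0 :: nat) \<in> borel \<rightarrow>\<^sub>M count_space UNIV"
    by measurable
  moreover have "(\<lambda>t. \<Sum>j\<in>{1..<N}. if s j < t then 1 else 0 :: nat) = level s N"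
    by (auto simp: level_def sum.If_cases Int_def)
  ultimately show ?thesis by metis
qed

lemma level_labelling: "0 < N \<Longrightarrow> level s N \<in> labelling N"
  by (auto simp: labelling_def level_less intro!: measurable_restrict_space1 measurable_completion level_measurable)

lemma AE_unit_not_in_finite: "finite F \<Longrightarrow> AE x in unit_interval. x \<notin> F"
proof -
  assume "finite F"
  then have "negligible F" by (rule negligible_finite)
  then have "{0..1} \<inter> F \<in> null_sets unit_interval"
    using negligible_subset[of F "{0..1} \<inter> F"]
    by (simp add: negligible_iff_null_sets null_sets_restrict_space)
  from AE_not_in[OF this] show ?thesis
    by (auto simp: AE_restrict_space_iff elim: eventually_mono)
qed

text \<open>Every labelling is, up to a null set, an interval partition composed with a
  measure-preserving map. The two can disagree only where \<open>rank c\<close> hits a breakpoint,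
  and the preimage of a finite set is null.\<close>

lemma AE_level_rank:
  assumes c: "c \<in> labelling N"
  shows "AE x in unit_interval. level (cumulative c) N (rank c x) = c x"
proof -
  have "AE x in unit_interval. x \<notin> cumulative c ` {..N}"
    by (rule AE_unit_not_in_finite) simp
  from AE_mp[OF rank_mp[OF c] this] AE_space
  show ?thesis
  proof eventually_elim
    case (elim x)
    then have "c x < N" using c by (simp add: labelling_def)
    moreover from this have "rank c x \<noteq> cumulative c (c x)" using elim by auto
    ultimately show ?case
      using rank_bounds[OF c, of x] by (intro level_eq cumulative_mono[OF c]) auto
  qed
qed

section \<open>The cut norm of kernels and of step kernels\<close>

type_synonym kernel = "nat \<Rightarrow> real \<times> real \<Rightarrow> real"

text \<open>The bound may depend on the colour \<open>i\<close>, so that step kernels with arbitrary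
  coefficients qualify.\<close>

definition bounded_kernel :: "kernel \<Rightarrow> bool" where
  "bounded_kernel f \<longleftrightarrow>
    (\<forall>i. f i \<in> borel_measurable unit_square \<and> (\<exists>B. \<forall>p\<in>{0..1} \<times> {0..1}. \<bar>f i p\<bar> \<le> B))"

definition rect_int :: "(real \<times> real \<Rightarrow> real) \<Rightarrow> real set \<Rightarrow> real set \<Rightarrow> real" where
  "rect_int g S T = (LINT p|unit_square. indicator (S \<times> T) p * g p)"

definition cut_norm :: "nat \<Rightarrow> kernel \<Rightarrow> real" where
  "cut_norm k f = (SUP (S, T)\<in>sets unit_interval \<times> sets unit_interval. \<Sum>i = 1..k. \<bar>rect_int (f i) S T\<bar>)"

definition kdiff :: "kernel \<Rightarrow> kernel \<Rightarrow> kernel" where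
  "kdiff f g = (\<lambda>i p. f i p - g i p)"

definition twist :: "kernel \<Rightarrow> (real \<Rightarrow> real) \<Rightarrow> kernel" where
  "twist f \<phi> = (\<lambda>i p. f i (square_map \<phi> p))"

definition step :: "(nat \<Rightarrow> nat \<Rightarrow> nat \<Rightarrow> real) \<Rightarrow> (real \<Rightarrow> nat) \<Rightarrow> kernel" where
  "step F c = (\<lambda>i p. F i (c (fst p)) (c (snd p)))"

lemma bounded_kernelD:
  assumes "bounded_kernel f"
  shows "f i \<in> borel_measurable unit_square" "integrable unit_square (f i)"
proof -
  show "f i \<in> borel_measurable unit_square" using assms by (simp add: bounded_kernel_def)
  obtain B where "\<forall>p\<in>{0..1} \<times> {0..1}. \<bar>f i p\<bar> \<le> B"
    using assms unfolding bounded_kernel_def by blast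
  then show "integrable unit_square (f i)"
    using \<open>f i \<in> borel_measurable unit_square\<close>
    by (intro Q.integrable_const_bound[where B=B] AE_I2) auto
qed

lemma bounded_kernel_kdiff:
  assumes "bounded_kernel f" "bounded_kernel g" shows "bounded_kernel (kdiff f g)"
  unfolding bounded_kernel_def
proof (intro allI conjI)
  fix i
  show "kdiff f g i \<in> borel_measurable unit_square"
    using bounded_kernelD(1)[OF assms(1), of i] bounded_kernelD(1)[OF assms(2), of i]
    unfolding kdiff_def by measurable
  obtain A B where "\<forall>p\<in>{0..1} \<times> {0..1}. \<bar>f i p\<bar> \<le> A" "\<forall>p\<in>{0..1} \<times> {0..1}. \<bar>g i p\<bar> \<le> B"
    using assms unfolding bounded_kernel_def by blast
  then have "\<bar>kdiff f g i p\<bar> \<le> A + B" if "p \<in> {0..1} \<times> {0..1}" for p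
    using that unfolding kdiff_def by (meson abs_triangle_ineq4 add_mono order_trans)
  then show "\<exists>B. \<forall>p\<in>{0..1} \<times> {0..1}. \<bar>kdiff f g i p\<bar> \<le> B" by blast
qed

lemma square_map_in:
  assumes "\<phi> \<in> mp_maps" "p \<in> {0..1} \<times> {0..1}" shows "square_map \<phi> p \<in> {0..1} \<times> {0..1}"
  using measurable_space[OF square_map_mp(1)[OF assms(1)]] assms(2) by simp

lemma bounded_kernel_twist:
  assumes "bounded_kernel f" "\<phi> \<in> mp_maps" shows "bounded_kernel (twist f \<phi>)"
  unfolding bounded_kernel_def
proof (intro allI conjI)
  fix i
  show "twist f \<phi> i \<in> borel_measurable unit_square"
    using measurable_compose[OF square_map_mp(1)[OF assms(2)] bounded_kernelD(1)[OF assms(1)]]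
    unfolding twist_def .
  obtain B where "\<forall>p\<in>{0..1} \<times> {0..1}. \<bar>f i p\<bar> \<le> B"
    using assms(1) unfolding bounded_kernel_def by blast
  then show "\<exists>B. \<forall>p\<in>{0..1} \<times> {0..1}. \<bar>twist f \<phi> i p\<bar> \<le> B"
    using square_map_in[OF assms(2)] unfolding twist_def by blast
qed

lemma twist_kdiff: "twist (kdiff f g) \<phi> = kdiff (twist f \<phi>) (twist g \<phi>)"
  by (simp add: twist_def kdiff_def)

lemma twist_twist: "twist (twist f \<phi>) \<psi> = twist f (\<lambda>x. \<phi> (\<psi> x))"
  by (simp add: twist_def square_map_def case_prod_beta)

lemma twist_id: "twist f (\<lambda>x. x) = f"
  by (simp add: twist_def square_map_def)

lemma twist_step: "twist (step F c) \<phi> = step F (\<lambda>x. c (\<phi> x))"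
  by (simp add: twist_def square_map_def case_prod_beta step_def)

lemma LINT_square_map:
  fixes g :: "real \<times> real \<Rightarrow> real"
  assumes "\<phi> \<in> mp_maps" "g \<in> borel_measurable unit_square"
  shows "(LINT p|unit_square. g (square_map \<phi> p)) = (LINT p|unit_square. g p)"
  using integral_distr[OF square_map_mp(1)[OF assms(1)] assms(2)] square_map_mp(2)[OF assms(1)] by simp

lemma integrable_rect:
  fixes g :: "real \<times> real \<Rightarrow> real"
  assumes "integrable unit_square g" "S \<in> sets unit_interval" "T \<in> sets unit_interval"
  shows "integrable unit_square (\<lambda>p. indicator (S \<times> T) p * g p)"
  using integrable_mult_indicator[OF Times_in_square[OF assms(2,3)] assms(1)] by simp

lemma abs_rect_int_le:
  assumes "integrable unit_square g" "S \<in> sets unit_interval" "T \<in> sets unit_interval"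
  shows "\<bar>rect_int g S T\<bar> \<le> (LINT p|unit_square. \<bar>g p\<bar>)"
proof -
  have "\<bar>rect_int g S T\<bar> \<le> (LINT p|unit_square. \<bar>indicator (S \<times> T) p * g p\<bar>)"
    unfolding rect_int_def by (rule integral_abs_bound)
  also have "\<dots> \<le> (LINT p|unit_square. \<bar>g p\<bar>)"
    using integrable_rect[OF assms] assms(1)
    by (intro integral_mono integrable_abs) (auto simp: indicator_def)
  finally show ?thesis .
qed

lemma rect_int_kdiff:
  assumes "bounded_kernel f" "bounded_kernel g" "S \<in> sets unit_interval" "T \<in> sets unit_interval"
  shows "rect_int (kdiff f g i) S T = rect_int (f i) S T - rect_int (g i) S T"
  using integrable_rect[OF bounded_kernelD(2)[OF assms(1)] assms(3,4)]
    integrable_rect[OF bounded_kernelD(2)[OF assms(2)] assms(3,4)]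
  by (simp add: rect_int_def kdiff_def right_diff_distrib)

lemma cut_norm_bound:
  assumes "\<And>S T. S \<in> sets unit_interval \<Longrightarrow> T \<in> sets unit_interval \<Longrightarrow> (\<Sum>i = 1..k. \<bar>rect_int (f i) S T\<bar>) \<le> c"
  shows "cut_norm k f \<le> c"
  unfolding cut_norm_def by (rule cSUP_least) (use assms in \<open>auto intro!: exI[of _ "{}"]\<close>)

lemma cut_norm_upper:
  assumes "bounded_kernel f" "S \<in> sets unit_interval" "T \<in> sets unit_interval"
  shows "(\<Sum>i = 1..k. \<bar>rect_int (f i) S T\<bar>) \<le> cut_norm k f"
proof -
  let ?h = "\<lambda>(S, T). \<Sum>i = 1..k. \<bar>rect_int (f i) S T\<bar>"
  have "bdd_above (?h ` (sets unit_interval \<times> sets unit_interval))"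
  proof (rule bdd_aboveI2)
    fix x assume "x \<in> sets unit_interval \<times> sets unit_interval"
    then show "?h x \<le> (\<Sum>i = 1..k. LINT p|unit_square. \<bar>f i p\<bar>)"
      by (auto intro!: sum_mono abs_rect_int_le bounded_kernelD(2)[OF assms(1)])
  qed
  then have "?h (S, T) \<le> (SUP x\<in>sets unit_interval \<times> sets unit_interval. ?h x)"
    using assms by (intro cSUP_upper) auto
  then show ?thesis by (simp add: cut_norm_def)
qed

lemma cut_norm_nonneg: "bounded_kernel f \<Longrightarrow> 0 \<le> cut_norm k f"
  using cut_norm_upper[of f "{}" "{}" k] by (simp add: rect_int_def)

lemma cut_norm_le_L1:
  assumes "bounded_kernel f"
  shows "cut_norm k f \<le> (\<Sum>i = 1..k. LINT p|unit_square. \<bar>f i p\<bar>)"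
  by (intro cut_norm_bound sum_mono abs_rect_int_le bounded_kernelD(2)[OF assms])

lemma cut_norm_kdiff_commute: "cut_norm k (kdiff f g) = cut_norm k (kdiff g f)"
proof -
  have "rect_int (kdiff f g i) S T = - rect_int (kdiff g f i) S T" for i S T
    unfolding rect_int_def kdiff_def
    by (subst integral_minus[symmetric]) (simp add: right_diff_distrib)
  then show ?thesis by (simp add: cut_norm_def)
qed

lemma cut_norm_triangle:
  assumes "bounded_kernel f" "bounded_kernel g" "bounded_kernel h"
  shows "cut_norm k (kdiff f h) \<le> cut_norm k (kdiff f g) + cut_norm k (kdiff g h)"
proof (rule cut_norm_bound)
  fix S T assume S: "S \<in> sets unit_interval" "T \<in> sets unit_interval"
  have "(\<Sum>i = 1..k. \<bar>rect_int (kdiff f h i) S T\<bar>)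
    \<le> (\<Sum>i = 1..k. \<bar>rect_int (kdiff f g i) S T\<bar> + \<bar>rect_int (kdiff g h i) S T\<bar>)"
    by (intro sum_mono) (simp add: rect_int_kdiff assms S)
  also have "\<dots> \<le> cut_norm k (kdiff f g) + cut_norm k (kdiff g h)"
    unfolding sum.distrib
    by (intro add_mono cut_norm_upper bounded_kernel_kdiff assms S)
  finally show "(\<Sum>i = 1..k. \<bar>rect_int (kdiff f h i) S T\<bar>) \<le> cut_norm k (kdiff f g) + cut_norm k (kdiff g h)" .
qed

lemma bounded_kernel_zero: "bounded_kernel (\<lambda>i p. 0)"
  by (auto simp: bounded_kernel_def)

lemma kdiff_zero: "kdiff f (\<lambda>i p. 0) = f"
  by (simp add: kdiff_def)

lemma cut_norm_le_add_diff:
  assumes "bounded_kernel f" "bounded_kernel g"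
  shows "cut_norm k f \<le> cut_norm k g + cut_norm k (kdiff f g)"
  using cut_norm_triangle[OF assms bounded_kernel_zero, of k] by (simp add: kdiff_zero)

lemma measurable_label_fst_snd:
  assumes "c \<in> labelling N"
  shows "(\<lambda>p. c (fst p)) \<in> unit_square \<rightarrow>\<^sub>M count_space UNIV" "(\<lambda>p. c (snd p)) \<in> unit_square \<rightarrow>\<^sub>M count_space UNIV"
  using assms measurable_compose[OF measurable_square_fst_snd(1)] measurable_compose[OF measurable_square_fst_snd(2)]
  by (auto simp: labelling_def)

lemma step_measurable:
  assumes "c \<in> labelling N" shows "step F c i \<in> borel_measurable unit_square"
proof -
  have "(\<lambda>p. (c (fst p), c (snd p))) \<in> unit_square \<rightarrow>\<^sub>M count_space UNIV \<Otimes>\<^sub>M count_space UNIV"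
    by (intro measurable_Pair measurable_label_fst_snd[OF assms])
  then have "(\<lambda>p. (c (fst p), c (snd p))) \<in> unit_square \<rightarrow>\<^sub>M count_space UNIV"
    by (simp add: pair_measure_countable)
  from measurable_compose[OF this, of "\<lambda>(a, b). F i a b"] show ?thesis
    by (simp add: step_def)
qed

lemma bounded_kernel_step:
  assumes "c \<in> labelling N" shows "bounded_kernel (step F c)"
  unfolding bounded_kernel_def
proof (intro allI conjI step_measurable[OF assms])
  fix i
  have "\<bar>step F c i p\<bar> \<le> (\<Sum>a<N. \<Sum>b<N. \<bar>F i a b\<bar>)" if "p \<in> {0..1} \<times> {0..1}" for p
  proof -
    have "c (fst p) < N" "c (snd p) < N"
      using that assms by (auto simp: labelling_def)
    then have "\<bar>F i (c (fst p)) (c (snd p))\<bar> \<le> (\<Sum>b<N. \<bar>F i (c (fst p)) b\<bar>)"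
      "(\<Sum>b<N. \<bar>F i (c (fst p)) b\<bar>) \<le> (\<Sum>a<N. \<Sum>b<N. \<bar>F i a b\<bar>)"
      by (auto intro!: member_le_sum[where f="\<lambda>b. \<bar>F i (c (fst p)) b\<bar>"]
          member_le_sum[where f="\<lambda>a. \<Sum>b<N. \<bar>F i a b\<bar>"] sum_nonneg)
    then show ?thesis by (simp add: step_def)
  qed
  then show "\<exists>B. \<forall>p\<in>{0..1} \<times> {0..1}. \<bar>step F c i p\<bar> \<le> B" by blast
qed

lemma step_expand:
  assumes "c \<in> labelling N" "p \<in> {0..1} \<times> {0..1}"
  shows "indicator (S \<times> T) p * step F c i p
    = (\<Sum>a<N. \<Sum>b<N. F i a b * indicator ((S \<inter> {x \<in> {0..1}. c x = a}) \<times> (T \<inter> {x \<in> {0..1}. c x = b})) p)"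
proof -
  obtain x y where p: "p = (x, y)" by (cases p)
  define h where "h a = (indicator (S \<inter> {x \<in> {0..1}. c x = a}) x :: real)" for a
  define l where "l b = (indicator (T \<inter> {x \<in> {0..1}. c x = b}) y :: real)" for b
  have xy: "c x < N" "c y < N" "x \<in> {0..1}" "y \<in> {0..1}"
    using assms p by (auto simp: labelling_def)
  have ne: "a \<noteq> c x \<Longrightarrow> h a = 0" "a \<noteq> c y \<Longrightarrow> l a = 0" for a
    by (auto simp: h_def l_def)
  have hl: "h (c x) = indicator S x" "l (c y) = indicator T y"
    using xy by (auto simp: h_def l_def indicator_def)
  have "(\<Sum>a<N. \<Sum>b<N. F i a b * (h a * l b)) = (\<Sum>b<N. F i (c x) b * (h (c x) * l b))"
    using xy ne by (subst sum.remove[of _ "c x"]) (auto intro!: sum.neutral)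
  also have "\<dots> = F i (c x) (c y) * (h (c x) * l (c y))"
    using xy ne by (subst sum.remove[of _ "c y"]) (auto intro!: sum.neutral)
  finally show ?thesis
    unfolding p hl by (simp add: step_def h_def l_def indicator_times)
qed

lemma rect_int_step:
  assumes c: "c \<in> labelling N" and S: "S \<in> sets unit_interval" "T \<in> sets unit_interval"
  shows "rect_int (step F c i) S T = (\<Sum>a<N. \<Sum>b<N. F i a b *
    (vol (S \<inter> {x \<in> {0..1}. c x = a}) * vol (T \<inter> {x \<in> {0..1}. c x = b})))"
proof -
  let ?R = "\<lambda>a b. (S \<inter> {x \<in> {0..1}. c x = a}) \<times> (T \<inter> {x \<in> {0..1}. c x = b})"
  have m: "S \<inter> {x \<in> {0..1}. c x = a} \<in> sets unit_interval" "T \<inter> {x \<in> {0..1}. c x = a} \<in> sets unit_interval" for a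
    using S by (intro sets.Int labelling_sets[OF c]; simp)+
  have R: "?R a b \<in> sets unit_square" for a b
    by (intro Times_in_square m)
  have "rect_int (step F c i) S T = (LINT p|unit_square. (\<Sum>a<N. \<Sum>b<N. F i a b * indicator (?R a b) p))"
    unfolding rect_int_def by (intro Bochner_Integration.integral_cong refl step_expand[OF c]) simp
  also have "\<dots> = (\<Sum>a<N. \<Sum>b<N. F i a b * measure unit_square (?R a b))"
  proof -
    have i: "integrable unit_square (\<lambda>p. F i a b * indicator (?R a b) p)" for a b
      using R by (intro integrable_mult_right integrable_real_indicator) (auto simp: Q.emeasure_eq_measure)
    have "(LINT p|unit_square. F i a b * indicator (?R a b) p) = F i a b * measure unit_square (?R a b)" for a b
      using sets.sets_into_space[OF R] by (simp add: Int_absorb2 del: Times_Int_Times)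
    then show ?thesis
      by (simp only: i Bochner_Integration.integral_sum Bochner_Integration.integrable_sum)
  qed
  finally show ?thesis
    using measure_square_Times[OF m(1) m(2)] by simp
qed

text \<open>The hypothesis is symmetric in \<open>c\<close> and \<open>d\<close>, so two
  applications give equality. One direction serves both the contraction under \<open>twist\<close>
  and the reversal of a map.\<close>

lemma cut_norm_step_le:
  assumes c: "c \<in> labelling N" and d: "d \<in> labelling N"
    and eq: "\<And>a. vol {x \<in> {0..1}. c x = a} = vol {x \<in> {0..1}. d x = a}"
  shows "cut_norm k (step F c) \<le> cut_norm k (step F d)"
proof (rule cut_norm_bound)
  have transfer: "\<exists>S'\<in>sets unit_interval. \<forall>a. vol (S' \<inter> {x \<in> {0..1}. d x = a}) = vol (S \<inter> {x \<in> {0..1}. c x = a})"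
    if S: "S \<in> sets unit_interval" for S
  proof -
    let ?D = "\<lambda>a. {x \<in> {0..1}. d x = a}"
    have "\<exists>t. vol (?D a \<inter> {..t}) = vol (S \<inter> {x \<in> {0..1}. c x = a})" for a
    proof -
      have "vol (S \<inter> {x \<in> {0..1}. c x = a}) \<le> vol (?D a)"
        unfolding eq[symmetric] by (intro I.finite_measure_mono labelling_sets[OF c]) auto
      then show ?thesis
        using exists_vol_Int_atMost[OF labelling_sets[OF d], of "vol (S \<inter> {x \<in> {0..1}. c x = a})" "\<lambda>b. b = a"]
        by auto
    qed
    then have "\<exists>t. \<forall>a. vol (?D a \<inter> {..t a}) = vol (S \<inter> {x \<in> {0..1}. c x = a})"
      by (intro choice allI)
    then obtain t where t: "\<And>a. vol (?D a \<inter> {..t a}) = vol (S \<inter> {x \<in> {0..1}. c x = a})"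
      by blast
    \<comment> \<open>Initial parts of the fibres of \<open>d\<close> realise the prescribed
      measures; by \<open>rect_int_step\<close> nothing but these measures enters the
      integral.\<close>
    let ?S = "\<Union>a<N. ?D a \<inter> {..t a}"
    have "?S \<in> sets unit_interval"
      by (intro sets.finite_UN Int_borel_unit_interval labelling_sets[OF d]) auto
    moreover have "vol (?S \<inter> ?D a) = vol (S \<inter> {x \<in> {0..1}. c x = a})" for a
    proof (cases "a < N")
      case True
      then have "?S \<inter> ?D a = ?D a \<inter> {..t a}" by auto
      then show ?thesis using t by simp
    next
      case False
      then have "?S \<inter> ?D a = {}" "S \<inter> {x \<in> {0..1}. c x = a} = {}"
        using c d by (auto simp: labelling_def)
      then show ?thesis by (simp only:)
    qed
    ultimately show ?thesis by blast
  qed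
  fix S T assume S: "S \<in> sets unit_interval" "T \<in> sets unit_interval"
  obtain S' where S': "S' \<in> sets unit_interval"
      "\<And>a. vol (S' \<inter> {x \<in> {0..1}. d x = a}) = vol (S \<inter> {x \<in> {0..1}. c x = a})"
    using transfer[OF S(1)] by blast
  obtain T' where T': "T' \<in> sets unit_interval"
      "\<And>a. vol (T' \<inter> {x \<in> {0..1}. d x = a}) = vol (T \<inter> {x \<in> {0..1}. c x = a})"
    using transfer[OF S(2)] by blast
  have "rect_int (step F c i) S T = rect_int (step F d i) S' T'" for i
    unfolding rect_int_step[OF c S] rect_int_step[OF d S'(1) T'(1)] S'(2) T'(2) ..
  then show "(\<Sum>i = 1..k. \<bar>rect_int (step F c i) S T\<bar>) \<le> cut_norm k (step F d)"
    using cut_norm_upper[OF bounded_kernel_step[OF d] S'(1) T'(1)] by simp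
qed

lemma labelling_mp:
  assumes "c \<in> labelling N" "\<phi> \<in> mp_maps"
  shows "(\<lambda>x. c (\<phi> x)) \<in> labelling N"
    "vol {x \<in> {0..1}. P (c (\<phi> x))} = vol {x \<in> {0..1}. P (c x)}"
proof -
  show "(\<lambda>x. c (\<phi> x)) \<in> labelling N"
    using assms mp_mapsD[OF assms(2)] measurable_compose[OF mp_mapsD(1)[OF assms(2)]]
    by (auto simp: labelling_def)
  have "{x \<in> {0..1}. P (c (\<phi> x))} = \<phi> -` {x \<in> {0..1}. P (c x)} \<inter> {0..1}"
    using mp_mapsD(3)[OF assms(2)] by (auto simp del: atLeastAtMost_iff)
  then show "vol {x \<in> {0..1}. P (c (\<phi> x))} = vol {x \<in> {0..1}. P (c x)}"
    using measure_mp_vimage[OF assms(2) labelling_sets[OF assms(1)]] by simp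
qed

section \<open>Approximation by grid step kernels\<close>

text \<open>For positive \<open>n\<close>, the regular partition into intervals that are open on the
  left, with the point 0 put into block 0.\<close>

definition grid :: "nat \<Rightarrow> real \<Rightarrow> nat" where
  "grid n = level (\<lambda>j. real j / real n) n"

lemma grid_labelling: "0 < n \<Longrightarrow> grid n \<in> labelling n"
  unfolding grid_def by (rule level_labelling)

lemma mono_grid: "mono (\<lambda>j. real j / real n)"
  by (intro monoI divide_right_mono) auto

lemma grid_bounds:
  assumes "0 < n" "t \<in> {0..1}"
  shows "real (grid n t) / real n \<le> t" "t \<le> real (grid n t) / real n + 1 / real n"
proof -
  have "real (grid n t) / real n \<le> t \<and> t \<le> real (grid n t) / real n + 1 / real n"
  proof (cases "t = 0")
    case True
    have "\<not> real j / real n < 0" for j by (simp add: not_less)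
    then have "grid n t = 0" using True by (simp add: grid_def level_def)
    then show ?thesis using True by simp
  next
    case False
    then have "real (grid n t) / real n < t" "t \<le> real (Suc (grid n t)) / real n"
      using level_bounds[of "\<lambda>j. real j / real n" n t] assms mono_grid unfolding grid_def by auto
    then show ?thesis by (simp add: add_divide_distrib)
  qed
  then show "real (grid n t) / real n \<le> t" "t \<le> real (grid n t) / real n + 1 / real n" by auto
qed

lemma continuous_measurable_square:
  fixes h :: "real \<times> real \<Rightarrow> real"
  assumes "continuous_on UNIV h" shows "h \<in> borel_measurable unit_square"
  using borel_measurable_continuous_onI[OF assms]
  by (intro measurable_restrict_space1 measurable_completion) simp

text \<open>A Lebesgue measurable function is an almost-everywhere limit of continuous ones;
  dominated convergence turns this into closeness in the mean.\<close>

lemma bounded_approx_continuous: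
  fixes g :: "real \<times> real \<Rightarrow> real"
  assumes g: "g \<in> borel_measurable unit_square" and B: "\<And>p. p \<in> {0..1} \<times> {0..1} \<Longrightarrow> \<bar>g p\<bar> \<le> B" and "0 < e"
  shows "\<exists>h. continuous_on UNIV h \<and> (\<forall>p. \<bar>h p\<bar> \<le> B) \<and> (LINT p|unit_square. \<bar>g p - h p\<bar>) < e"
proof -
  have "0 \<le> B" using B[of "(0, 0)"] by simp
  have "(\<lambda>p. if p \<in> {0..1} \<times> {0..1} then g p else 0) \<in> borel_measurable lebesgue"
    using g by (rule borel_measurable_if_I) simp
  then have "(\<lambda>p. if p \<in> {0..1} \<times> {0..1} then g p else 0) measurable_on UNIV"
    by (rule lebesgue_measurable_imp_measurable_on) simp
  then obtain N h where N: "negligible N" and h: "\<And>n. continuous_on UNIV (h n)"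
    and lim: "\<And>p. p \<notin> N \<Longrightarrow> (\<lambda>n. h n p) \<longlonglongrightarrow> (if p \<in> {0..1} \<times> {0..1} then g p else 0)"
    unfolding measurable_on_def by force
  \<comment> \<open>Clipping at \<open>B\<close> keeps continuity and the limit, and provides the
    dominating constant \<open>2 * B\<close>.\<close>
  define k where "k n p = max (- B) (min B (h n p))" for n :: nat and p
  have k: "continuous_on UNIV (k n)" for n
    unfolding k_def by (intro continuous_intros h)
  have km: "k n \<in> borel_measurable unit_square" for n
    by (rule continuous_measurable_square[OF k])
  have kB: "\<bar>k n p\<bar> \<le> B" for n p
    using \<open>0 \<le> B\<close> by (auto simp: k_def)
  have klim: "(\<lambda>n. \<bar>g p - k n p\<bar>) \<longlonglongrightarrow> 0" if "p \<notin> N" "p \<in> {0..1} \<times> {0..1}" for p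
  proof -
    have "(\<lambda>n. h n p) \<longlonglongrightarrow> g p" using lim[OF that(1)] that(2) by (simp only: if_True)
    then have "(\<lambda>n. k n p) \<longlonglongrightarrow> max (- B) (min B (g p))"
      unfolding k_def by (intro tendsto_intros)
    moreover have "max (- B) (min B (g p)) = g p" using B[OF that(2)] by auto
    ultimately have "(\<lambda>n. k n p) \<longlonglongrightarrow> g p" by simp
    from tendsto_rabs[OF tendsto_diff[OF tendsto_const[of "g p"] this]] show ?thesis by simp
  qed
  have "AE p in lebesgue. p \<notin> N"
    using N by (intro AE_not_in) (simp add: negligible_iff_null_sets)
  then have AE: "AE p in unit_square. p \<notin> N"
    by (subst AE_restrict_space_iff) (auto elim: eventually_mono)
  have "(\<lambda>n. LINT p|unit_square. \<bar>g p - k n p\<bar>) \<longlonglongrightarrow> (LINT p|unit_square. 0)"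
  proof (rule integral_dominated_convergence[where w="\<lambda>_. 2 * B"])
    show "(\<lambda>p. \<bar>g p - k n p\<bar>) \<in> borel_measurable unit_square" for n
      using g km by measurable
    show "AE p in unit_square. (\<lambda>n. \<bar>g p - k n p\<bar>) \<longlonglongrightarrow> 0"
      using AE AE_space by eventually_elim (rule klim, auto)
    show "AE p in unit_square. norm \<bar>g p - k n p\<bar> \<le> 2 * B" for n
    proof (rule AE_I2)
      fix p :: "real \<times> real" assume "p \<in> space unit_square"
      then show "norm \<bar>g p - k n p\<bar> \<le> 2 * B" using B[of p] kB[of n p] by auto
    qed
  qed auto
  then have "eventually (\<lambda>n. (LINT p|unit_square. \<bar>g p - k n p\<bar>) < e) sequentially"
    using order_tendstoD(2)[of _ 0 sequentially e] \<open>0 < e\<close> by simp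
  then obtain n where "(LINT p|unit_square. \<bar>g p - k n p\<bar>) < e"
    using eventually_happens by fastforce
  then show ?thesis using k kB by blast
qed

text \<open>Since this holds for all large \<open>n\<close>, finitely many functions can use one
  common grid; several colours, and later two kernels, share a grid in this way.\<close>

lemma grid_approx:
  fixes g :: "real \<times> real \<Rightarrow> real"
  assumes g: "g \<in> borel_measurable unit_square" and B: "\<And>p. p \<in> {0..1} \<times> {0..1} \<Longrightarrow> \<bar>g p\<bar> \<le> B" and "0 < e"
  shows "\<forall>\<^sub>F n in sequentially. \<exists>F. (LINT p|unit_square. \<bar>g p - F (grid n (fst p)) (grid n (snd p))\<bar>) < e"
proof -
  obtain h where h: "continuous_on UNIV h" "\<And>p. \<bar>h p\<bar> \<le> B" "(LINT p|unit_square. \<bar>g p - h p\<bar>) < e / 2"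
    using bounded_approx_continuous[OF g B, of "e / 2"] \<open>0 < e\<close> by auto
  have "uniformly_continuous_on ({0..1} \<times> {0..1}) h"
    using h(1) by (intro compact_uniformly_continuous compact_Times) (auto intro: continuous_on_subset)
  then obtain d where "0 < d" and d: "\<And>p q. p \<in> {0..1} \<times> {0..1} \<Longrightarrow> q \<in> {0..1} \<times> {0..1} \<Longrightarrow>
      dist q p < d \<Longrightarrow> dist (h q) (h p) < e / 4"
    unfolding uniformly_continuous_on_def using \<open>0 < e\<close> by (metis divide_pos_pos zero_less_numeral)
  have "(\<lambda>n. 2 / real n) \<longlonglongrightarrow> 0" by (rule lim_const_over_n)
  then have "\<forall>\<^sub>F n in sequentially. 2 / real n < d"
    using \<open>0 < d\<close> by (rule order_tendstoD(2))
  then show ?thesis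
    using eventually_gt_at_top[of 0]
  proof eventually_elim
    case (elim n)
    \<comment> \<open>Each cell takes the value of \<open>h\<close> at its lower left corner, which
      is within \<open>2 / real n\<close> of all its points.\<close>
    define F where "F a b = h (real a / real n, real b / real n)" for a b
    let ?s = "\<lambda>p. F (grid n (fst p)) (grid n (snd p))"
    have sm: "?s \<in> borel_measurable unit_square"
      using step_measurable[OF grid_labelling[OF elim(2)], of "\<lambda>_. F"] by (simp add: step_def)
    have hm: "h \<in> borel_measurable unit_square" by (rule continuous_measurable_square[OF h(1)])
    have close: "\<bar>h p - ?s p\<bar> \<le> e / 4" if p: "p \<in> {0..1} \<times> {0..1}" for p
    proof -
      obtain x y where xy: "p = (x, y)" "x \<in> {0..1}" "y \<in> {0..1}" using p by auto
      note bnd_x = grid_bounds[OF elim(2) xy(2)] and bnd_y = grid_bounds[OF elim(2) xy(3)]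
      let ?q = "(real (grid n x) / real n, real (grid n y) / real n)"
      have "?q \<in> {0..1} \<times> {0..1}" using bnd_x bnd_y xy by auto
      moreover have "dist ?q p < d"
      proof -
        have "dist ?q p \<le> \<bar>real (grid n x) / real n - x\<bar> + \<bar>real (grid n y) / real n - y\<bar>"
          unfolding xy dist_Pair_Pair dist_real_def
          using sqrt_sum_squares_le_sum_abs[of "\<bar>real (grid n x) / real n - x\<bar>" "\<bar>real (grid n y) / real n - y\<bar>"]
          by simp
        also have "\<dots> \<le> 2 / real n" using bnd_x bnd_y by auto
        finally show ?thesis using elim(1) by simp
      qed
      ultimately have "dist (h ?q) (h p) < e / 4" using d[OF p] by simp
      then show ?thesis by (simp add: F_def xy dist_real_def abs_minus_commute)
    qed
    have i1: "integrable unit_square (\<lambda>p. \<bar>g p - h p\<bar>)"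
    proof (rule Q.integrable_const_bound[where B="2 * B"])
      show "AE p in unit_square. norm \<bar>g p - h p\<bar> \<le> 2 * B"
      proof (rule AE_I2)
        fix p :: "real \<times> real" assume "p \<in> space unit_square"
        then show "norm \<bar>g p - h p\<bar> \<le> 2 * B" using B[of p] h(2)[of p] by auto
      qed
      show "(\<lambda>p. \<bar>g p - h p\<bar>) \<in> borel_measurable unit_square" using g hm by measurable
    qed
    have i2: "integrable unit_square (\<lambda>p. \<bar>h p - ?s p\<bar>)"
    proof (rule Q.integrable_const_bound[where B="e / 4"])
      show "AE p in unit_square. norm \<bar>h p - ?s p\<bar> \<le> e / 4"
        by (rule AE_I2) (use close in auto)
      show "(\<lambda>p. \<bar>h p - ?s p\<bar>) \<in> borel_measurable unit_square" using hm sm by measurable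
    qed
    have i3: "integrable unit_square (\<lambda>p. \<bar>g p - ?s p\<bar>)"
    proof (rule Bochner_Integration.integrable_bound[OF Bochner_Integration.integrable_add[OF i1 i2]])
      show "(\<lambda>p. \<bar>g p - ?s p\<bar>) \<in> borel_measurable unit_square" using g sm by measurable
    qed (auto intro!: AE_I2)
    have "(LINT p|unit_square. \<bar>g p - ?s p\<bar>) \<le> (LINT p|unit_square. \<bar>g p - h p\<bar> + \<bar>h p - ?s p\<bar>)"
      by (intro integral_mono i3 Bochner_Integration.integrable_add i1 i2) linarith
    also have "\<dots> = (LINT p|unit_square. \<bar>g p - h p\<bar>) + (LINT p|unit_square. \<bar>h p - ?s p\<bar>)"
      by (rule Bochner_Integration.integral_add[OF i1 i2])
    also have "(LINT p|unit_square. \<bar>h p - ?s p\<bar>) \<le> (LINT p|unit_square. e / 4)"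
      by (intro integral_mono i2) (use close in auto)
    also have "\<dots> = e / 4" using Q.prob_space by simp
    finally have "(LINT p|unit_square. \<bar>g p - ?s p\<bar>) < e" using h(3) \<open>0 < e\<close> by simp
    then show ?case by blast
  qed
qed

lemma bounded_kernel_grid_approx:
  assumes f: "bounded_kernel f" and "0 < e"
  shows "\<forall>\<^sub>F n in sequentially. \<exists>F. \<forall>i\<in>{1..k}. (LINT p|unit_square. \<bar>kdiff f (step F (grid n)) i p\<bar>) \<le> e"
proof -
  have "\<forall>\<^sub>F n in sequentially. \<forall>i\<in>{1..k}. \<exists>G. (LINT p|unit_square. \<bar>f i p - G (grid n (fst p)) (grid n (snd p))\<bar>) < e"
  proof (rule eventually_ball_finite)
    show "\<forall>i\<in>{1..k}. \<forall>\<^sub>F n in sequentially. \<exists>G. (LINT p|unit_square. \<bar>f i p - G (grid n (fst p)) (grid n (snd p))\<bar>) < e"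
    proof
      fix i
      obtain B where "\<forall>p\<in>{0..1} \<times> {0..1}. \<bar>f i p\<bar> \<le> B" using f unfolding bounded_kernel_def by blast
      then show "\<forall>\<^sub>F n in sequentially. \<exists>G. (LINT p|unit_square. \<bar>f i p - G (grid n (fst p)) (grid n (snd p))\<bar>) < e"
        using bounded_kernelD(1)[OF f] \<open>0 < e\<close> by (intro grid_approx[of _ B]) auto
    qed
  qed simp
  then show ?thesis
  proof eventually_elim
    case (elim n)
    then obtain F where "\<forall>i\<in>{1..k}. (LINT p|unit_square. \<bar>f i p - F i (grid n (fst p)) (grid n (snd p))\<bar>) < e"
      by (rule bchoice[THEN exE])
    then show ?case unfolding kdiff_def step_def by (intro exI[of _ F]) (auto intro: less_imp_le)
  qed
qed

text \<open>The error is controlled in the \<open>L1\<close> norm, which is invariant under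
  measure-preserving maps, so one step kernel serves all \<open>\<phi>\<close> at once. Contraction
  of the cut norm under twisting is derived from this and cannot be used here.\<close>

lemma grid_approx_cut_norm:
  assumes f: "bounded_kernel f" and "0 < e"
  shows "\<forall>\<^sub>F n in sequentially. \<exists>F. \<forall>\<phi>\<in>mp_maps. cut_norm k (kdiff (twist f \<phi>) (twist (step F (grid n)) \<phi>)) \<le> e"
proof -
  have "0 < e / (real k + 1)" using \<open>0 < e\<close> by simp
  from bounded_kernel_grid_approx[OF f this, of k] eventually_gt_at_top[of 0]
  show ?thesis
  proof eventually_elim
    case (elim n)
    then obtain F where F: "\<And>i. i \<in> {1..k} \<Longrightarrow> (LINT p|unit_square. \<bar>kdiff f (step F (grid n)) i p\<bar>) \<le> e / (real k + 1)"
      by blast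
    have kd: "bounded_kernel (kdiff f (step F (grid n)))"
      by (intro bounded_kernel_kdiff f bounded_kernel_step[OF grid_labelling[OF elim(2)]])
    have "cut_norm k (kdiff (twist f \<phi>) (twist (step F (grid n)) \<phi>)) \<le> e" if \<phi>: "\<phi> \<in> mp_maps" for \<phi>
    proof -
      have "cut_norm k (twist (kdiff f (step F (grid n))) \<phi>)
        \<le> (\<Sum>i = 1..k. LINT p|unit_square. \<bar>twist (kdiff f (step F (grid n))) \<phi> i p\<bar>)"
        by (intro cut_norm_le_L1 bounded_kernel_twist kd \<phi>)
      also have "\<dots> = (\<Sum>i = 1..k. LINT p|unit_square. \<bar>kdiff f (step F (grid n)) i p\<bar>)"
        unfolding twist_def
        using bounded_kernelD(1)[OF kd]
        by (intro sum.cong refl LINT_square_map[OF \<phi>, of "\<lambda>p. \<bar>kdiff f (step F (grid n)) _ p\<bar>"]) measurable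
      also have "\<dots> \<le> real k * (e / (real k + 1))"
        using sum_bounded_above[of "{1..k}" "\<lambda>i. LINT p|unit_square. \<bar>kdiff f (step F (grid n)) i p\<bar>", OF F] by simp
      also have "\<dots> \<le> e" using \<open>0 < e\<close> by (simp add: field_simps)
      finally show ?thesis by (simp add: twist_kdiff)
    qed
    then show ?case by blast
  qed
qed

text \<open>Test rectangles for the twisted kernel need not be preimages under
  \<open>square_map \<phi>\<close>, so a change of variables gives only the opposite inequality. For
  step kernels twisting changes no step measure, and the general case follows by approximating both
  sides.\<close>

lemma cut_norm_twist_le:
  assumes f: "bounded_kernel f" and \<phi>: "\<phi> \<in> mp_maps"
  shows "cut_norm k (twist f \<phi>) \<le> cut_norm k f"
proof (rule field_le_epsilon)
  fix e :: real assume "0 < e"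
  then have "0 < e / 2" by simp
  from eventually_happens[OF eventually_conj[OF grid_approx_cut_norm[OF f this, of k] eventually_gt_at_top[of 0]]]
  obtain n F where n: "0 < n" and F: "\<And>\<phi>. \<phi> \<in> mp_maps \<Longrightarrow> cut_norm k (kdiff (twist f \<phi>) (twist (step F (grid n)) \<phi>)) \<le> e / 2"
    by auto
  let ?s = "step F (grid n)"
  have s: "bounded_kernel ?s" by (rule bounded_kernel_step[OF grid_labelling[OF n]])
  have "cut_norm k (twist f \<phi>) \<le> cut_norm k (twist ?s \<phi>) + e / 2"
    using cut_norm_le_add_diff[OF bounded_kernel_twist[OF f \<phi>] bounded_kernel_twist[OF s \<phi>], of k] F[OF \<phi>] by simp
  also have "cut_norm k (twist ?s \<phi>) \<le> cut_norm k ?s"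
    unfolding twist_step
    by (rule cut_norm_step_le[OF labelling_mp(1)[OF grid_labelling[OF n] \<phi>] grid_labelling[OF n]])
      (rule labelling_mp(2)[OF grid_labelling[OF n] \<phi>])
  also have "cut_norm k ?s \<le> cut_norm k f + e / 2"
    using cut_norm_le_add_diff[OF s f, of k] F[OF mp_id] by (simp add: twist_id cut_norm_kdiff_commute)
  finally show "cut_norm k (twist f \<phi>) \<le> cut_norm k f + e" by simp
qed

section \<open>The cut distance on kernels\<close>

text \<open>Defined on kernels, so that step kernels, which need not come from graphons, can be
  compared with graphons.\<close>

definition kdelta :: "nat \<Rightarrow> kernel \<Rightarrow> kernel \<Rightarrow> real" where
  "kdelta k f g = (INF \<phi>\<in>mp_maps. cut_norm k (kdiff f (twist g \<phi>)))"

lemma kdelta_le: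
  assumes "bounded_kernel f" "bounded_kernel g" "\<phi> \<in> mp_maps"
  shows "kdelta k f g \<le> cut_norm k (kdiff f (twist g \<phi>))"
proof -
  have "bdd_below ((\<lambda>\<phi>. cut_norm k (kdiff f (twist g \<phi>))) ` mp_maps)"
    by (rule bdd_belowI2[where m=0]) (intro cut_norm_nonneg bounded_kernel_kdiff bounded_kernel_twist assms)
  then show ?thesis
    unfolding kdelta_def using assms(3) by (rule cINF_lower)
qed

lemma kdelta_ge:
  assumes "\<And>\<phi>. \<phi> \<in> mp_maps \<Longrightarrow> c \<le> cut_norm k (kdiff f (twist g \<phi>))"
  shows "c \<le> kdelta k f g"
  unfolding kdelta_def using assms mp_id by (intro cINF_greatest) auto

lemma kdelta_less:
  assumes "kdelta k f g < c"
  shows "\<exists>\<phi>\<in>mp_maps. cut_norm k (kdiff f (twist g \<phi>)) < c"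
  using kdelta_ge[of c k f g] assms by (meson not_less)

lemma kdelta_nonneg:
  assumes "bounded_kernel f" "bounded_kernel g" shows "0 \<le> kdelta k f g"
  by (intro kdelta_ge cut_norm_nonneg bounded_kernel_kdiff bounded_kernel_twist assms)

lemma kdelta_le_cut_norm:
  assumes "bounded_kernel f" "bounded_kernel g" shows "kdelta k f g \<le> cut_norm k (kdiff f g)"
  using kdelta_le[OF assms mp_id] by (simp add: twist_id)

text \<open>If \<open>\<phi>\<close> nearly aligns \<open>g\<close> with \<open>f\<close> and
  \<open>\<psi>\<close> nearly aligns \<open>h\<close> with \<open>g\<close>, then
  \<open>\<psi>\<close> after \<open>\<phi>\<close> nearly aligns \<open>h\<close> with
  \<open>f\<close>: twisting the second comparison by \<open>\<phi>\<close> does not increase its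
  cut norm.\<close>

lemma kdelta_triangle:
  assumes f: "bounded_kernel f" and g: "bounded_kernel g" and h: "bounded_kernel h"
  shows "kdelta k f h \<le> kdelta k f g + kdelta k g h"
proof (rule field_le_epsilon)
  fix e :: real assume "0 < e"
  obtain \<phi> where \<phi>: "\<phi> \<in> mp_maps" "cut_norm k (kdiff f (twist g \<phi>)) < kdelta k f g + e / 2"
    using kdelta_less[of k f g "kdelta k f g + e / 2"] \<open>0 < e\<close> by auto
  obtain \<psi> where \<psi>: "\<psi> \<in> mp_maps" "cut_norm k (kdiff g (twist h \<psi>)) < kdelta k g h + e / 2"
    using kdelta_less[of k g h "kdelta k g h + e / 2"] \<open>0 < e\<close> by auto
  have "kdelta k f h \<le> cut_norm k (kdiff f (twist h (\<lambda>x. \<psi> (\<phi> x))))"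
    by (rule kdelta_le[OF f h mp_comp[OF \<psi>(1) \<phi>(1)]])
  also have "\<dots> \<le> cut_norm k (kdiff f (twist g \<phi>)) + cut_norm k (kdiff (twist g \<phi>) (twist (twist h \<psi>) \<phi>))"
    unfolding twist_twist[symmetric] by (intro cut_norm_triangle bounded_kernel_twist f g h \<phi> \<psi>)
  also have "cut_norm k (kdiff (twist g \<phi>) (twist (twist h \<psi>) \<phi>)) \<le> cut_norm k (kdiff g (twist h \<psi>))"
    unfolding twist_kdiff[symmetric] by (intro cut_norm_twist_le bounded_kernel_kdiff bounded_kernel_twist g h \<phi> \<psi>)
  finally show "kdelta k f h \<le> kdelta k f g + kdelta k g h + e"
    using \<phi>(2) \<psi>(2) by simp
qed

section \<open>Symmetry of the cut distance\<close>

lemma cut_norm_AE: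
  assumes "bounded_kernel f" "bounded_kernel g" "\<And>i. AE p in unit_square. f i p = g i p"
  shows "cut_norm k (kdiff f g) = 0"
proof -
  have "(LINT p|unit_square. \<bar>kdiff f g i p\<bar>) = 0" for i
  proof -
    have "AE p in unit_square. \<bar>kdiff f g i p\<bar> = 0"
      using assms(3)[of i] by eventually_elim (simp add: kdiff_def)
    then show ?thesis by (rule integral_eq_zero_AE)
  qed
  then show ?thesis
    using cut_norm_le_L1[OF bounded_kernel_kdiff[OF assms(1,2)], of k]
      cut_norm_nonneg[OF bounded_kernel_kdiff[OF assms(1,2)], of k] by simp
qed

lemma step_AE:
  assumes "AE x in unit_interval. c x = d x"
  shows "AE p in unit_square. step F c i p = step F d i p"
  using AE_square_fst_snd[OF assms] by eventually_elim (simp add: step_def)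

lemma vol_AE_eq:
  assumes "c \<in> labelling N" "d \<in> labelling M" "AE x in unit_interval. c x = d x"
  shows "vol {x \<in> {0..1}. P (c x)} = vol {x \<in> {0..1}. P (d x)}"
proof (rule I.finite_measure_eq_AE)
  show "AE x in unit_interval. (x \<in> {x \<in> {0..1}. P (c x)}) = (x \<in> {x \<in> {0..1}. P (d x)})"
    using assms(3) by eventually_elim auto
qed (rule labelling_sets[OF assms(1)] labelling_sets[OF assms(2)])+

lemma labelling_map:
  assumes "c \<in> labelling N" "\<And>a. a < N \<Longrightarrow> h a < M"
  shows "(\<lambda>x. h (c x)) \<in> labelling M"
proof -
  have "c \<in> unit_interval \<rightarrow>\<^sub>M count_space UNIV" using assms(1) by (simp add: labelling_def)
  from measurable_compose[OF this, of h "count_space UNIV"] show ?thesis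
    using assms by (auto simp: labelling_def)
qed

text \<open>The code has leading digit \<open>c x\<close> and last digit \<open>d x\<close> in base
  \<open>M\<close>, so sorting by it sorts by \<open>c\<close> first, and \<open>div\<close> and
  \<open>mod\<close> recover both labels.\<close>

lemma labelling_pair:
  assumes c: "c \<in> labelling N" and d: "d \<in> labelling M"
  shows "(\<lambda>x. d x + M * c x) \<in> labelling (N * M)"
proof -
  have "(\<lambda>x. d x + M * c x) \<in> unit_interval \<rightarrow>\<^sub>M count_space UNIV"
  proof -
    have "c \<in> unit_interval \<rightarrow>\<^sub>M count_space UNIV" "d \<in> unit_interval \<rightarrow>\<^sub>M count_space UNIV"
      using c d by (simp_all add: labelling_def)
    then show ?thesis by measurable
  qed
  moreover have "d x + M * c x < N * M" if "x \<in> {0..1}" for x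
  proof -
    have "d x < M" "c x < N" using that c d by (auto simp: labelling_def)
    then have "d x + M * c x < M + M * c x" by simp
    also have "\<dots> = M * Suc (c x)" by simp
    also have "\<dots> \<le> M * N" using \<open>c x < N\<close> by (intro mult_le_mono2) simp
    finally show ?thesis by (simp add: mult.commute)
  qed
  ultimately show ?thesis by (simp add: labelling_def)
qed

lemma cumulative_grid:
  assumes "0 < n" "j \<le> n" shows "cumulative (grid n) j = real j / real n"
proof -
  let ?t = "real j / real n"
  have t: "0 \<le> ?t" "?t \<le> 1" using assms by auto
  have AE: "AE x in unit_interval. x \<notin> {0, ?t}"
    by (rule AE_unit_not_in_finite) simp
  have "vol {x \<in> {0..1}. grid n x < j} = vol ({0..1} \<inter> {0..?t})"
  proof (rule I.finite_measure_eq_AE)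
    show "AE x in unit_interval. (x \<in> {x \<in> {0..1}. grid n x < j}) = (x \<in> {0..1} \<inter> {0..?t})"
      using AE AE_space
    proof eventually_elim
      case (elim x)
      then have x: "0 < x" "x \<le> 1" "x \<noteq> ?t" by auto
      have b: "grid n x < n" "real (grid n x) / real n < x" "x \<le> real (Suc (grid n x)) / real n"
        using level_bounds[of "\<lambda>j. real j / real n" n x] mono_grid x assms by (auto simp: grid_def)
      have "grid n x < j \<longleftrightarrow> x \<le> ?t"
      proof
        assume "grid n x < j"
        then have "real (Suc (grid n x)) / real n \<le> ?t" by (intro divide_right_mono) auto
        then show "x \<le> ?t" using b by simp
      next
        assume "x \<le> ?t"
        then have "real (grid n x) / real n < ?t" using b by simp
        then show "grid n x < j" using assms by (simp add: divide_less_cancel)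
      qed
      then show ?case using elim x by auto
    qed
  next
    show "{x \<in> {0..1}. grid n x < j} \<in> sets unit_interval"
      by (rule labelling_sets[OF grid_labelling[OF assms(1)]])
    show "{0..1} \<inter> {0..?t} \<in> sets unit_interval"
      by (rule borel_imp_unit_interval) simp
  qed
  also have "{0..1} \<inter> {0..?t} = {0..?t}" using t by auto
  also have "vol {0..?t} = ?t" using t by (simp add: measure_restrict_space)
  finally show ?thesis by (simp add: cumulative_def)
qed

text \<open>The rank maps of a labelling that refines \<open>grid n \<circ> \<phi>\<close> and of its rearrangement undo the
  transformation \<open>\<phi>\<close>, as far as the grid can tell.\<close>

lemma exists_reversing_map:
  assumes n: "0 < n" and \<phi>: "\<phi> \<in> mp_maps"
  shows "\<exists>\<psi>\<in>mp_maps. cut_norm k (kdiff (step G (grid n)) (twist (step F (grid n)) \<psi>))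
    \<le> cut_norm k (kdiff (step F (grid n)) (twist (step G (grid n)) \<phi>))"
proof -
  let ?g = "grid n"
  have g: "?g \<in> labelling n" by (rule grid_labelling[OF n])
  note g\<phi> = labelling_mp[OF g \<phi>]
  \<comment> \<open>The leading digit is the grid cell of \<open>\<phi> x\<close> and the last digit
    that of \<open>x\<close>, so \<open>e\<close> records how \<open>\<phi>\<close> distributes each
    cell over the others.\<close>
  define e where "e x = ?g x + n * ?g (\<phi> x)" for x
  have e: "e \<in> labelling (n * n)" unfolding e_def by (rule labelling_pair[OF g\<phi>(1) g])
  \<comment> \<open>The blocks of \<open>e\<close>, rearranged into consecutive intervals of the
    same measures.\<close>
  define A where "A = level (cumulative e) (n * n)"
  have A: "A \<in> labelling (n * n)" unfolding A_def using n by (intro level_labelling) simp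
  have eA: "AE x in unit_interval. A (rank e x) = e x"
    unfolding A_def by (rule AE_level_rank[OF e])
  have e_mod: "e x mod n = ?g x" "e x div n = ?g (\<phi> x)" if "x \<in> {0..1}" for x
    using that g n by (auto simp: e_def labelling_def)
  \<comment> \<open>As \<open>\<phi>\<close> preserves measure, the points with leading digit below
    \<open>j\<close> have measure \<open>j / n\<close>; after sorting, the leading digit is
    therefore the grid label itself.\<close>
  have cum_e: "cumulative e (n * j) = real j / real n" if "j \<le> n" for j
  proof -
    have "cumulative e (n * j) = vol {x \<in> {0..1}. ?g (\<phi> x) < j}"
      unfolding cumulative_def
    proof (intro arg_cong[where f=vol] Collect_cong conj_cong refl)
      fix x :: real assume "x \<in> {0..1}"
      then have "e x div n = ?g (\<phi> x)" by (rule e_mod)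
      then show "(e x < n * j) = (?g (\<phi> x) < j)"
        using n by (metis less_mult_imp_div_less mult.commute div_less_iff_less_mult)
    qed
    also have "\<dots> = cumulative ?g j" unfolding cumulative_def by (rule g\<phi>(2))
    also have "\<dots> = real j / real n" by (rule cumulative_grid[OF n that])
    finally show ?thesis .
  qed
  have A_div: "AE x in unit_interval. A x div n = ?g x"
    using AE_unit_not_in_finite[OF finite.insertI[OF finite.emptyI], of 0] AE_space
  proof eventually_elim
    case (elim x)
    then have x: "0 < x" "x \<le> 1" by auto
    note b = level_bounds[OF cumulative_mono[OF e] cumulative_0 cumulative_N[OF e] x, folded A_def]
    define j where "j = A x div n"
    have j: "j < n" unfolding j_def using b(1) by (simp add: less_mult_imp_div_less)
    have "cumulative e (n * j) \<le> cumulative e (A x)"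
      by (rule monoD[OF cumulative_mono[OF e]]) (simp add: j_def)
    then have 1: "real j / real n < x" using b(2) cum_e[of j] j by simp
    have "A x < n * Suc j"
      unfolding j_def using n by (metis dividend_less_times_div mult_Suc_right)
    then have "cumulative e (Suc (A x)) \<le> cumulative e (n * Suc j)"
      by (intro monoD[OF cumulative_mono[OF e]]) simp
    then have 2: "x \<le> real (Suc j) / real n" using b(3) cum_e[of "Suc j"] j by simp
    show "A x div n = ?g x"
      using level_eq[OF mono_grid[of n] j 1 2] by (simp add: grid_def j_def)
  qed
  \<comment> \<open>In sorted order the roles are exchanged: the leading digit is the plain grid,
    and the last digit \<open>B\<close> is a rearranged copy of it, which \<open>\<psi>\<close> has
    to produce.\<close>
  define B where "B x = A x mod n" for x
  have B: "B \<in> labelling n" unfolding B_def by (rule labelling_map[OF A]) (use n in simp)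
  have vol_B: "vol {x \<in> {0..1}. B x = a} = vol {x \<in> {0..1}. ?g x = a}" for a
  proof -
    have "vol {x \<in> {0..1}. B x = a} = vol {x \<in> {0..1}. A (rank e x) mod n = a}"
      unfolding B_def by (rule labelling_mp(2)[OF A rank_mp[OF e], symmetric])
    also have "\<dots> = vol {x \<in> {0..1}. e x mod n = a}"
      by (rule vol_AE_eq[OF labelling_mp(1)[OF A rank_mp[OF e]] e eA])
    also have "\<dots> = vol {x \<in> {0..1}. ?g x = a}"
      by (intro arg_cong[where f=vol] Collect_cong conj_cong refl) (simp add: e_mod)
    finally show ?thesis .
  qed
  have cum_B: "cumulative B j = real j / real n" if "j \<le> n" for j
    using that
  proof (induction j)
    case (Suc j)
    then show ?case
      using cumulative_Suc[OF B, of j] cumulative_Suc[OF g, of j] vol_B[of j]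
        cumulative_grid[OF n, of j] cumulative_grid[OF n, of "Suc j"] by simp
  qed simp
  define \<psi> where "\<psi> = rank B"
  have \<psi>: "\<psi> \<in> mp_maps" unfolding \<psi>_def by (rule rank_mp[OF B])
  \<comment> \<open>\<open>B\<close> has the breakpoints of the grid, so sorting by \<open>B\<close>
    sends almost every point into the grid cell numbered by its value of \<open>B\<close>.\<close>
  have "level (cumulative B) n t = ?g t" for t
    unfolding level_def grid_def using cum_B by (intro arg_cong[where f=card] Collect_cong) auto
  then have g\<psi>: "AE x in unit_interval. ?g (\<psi> x) = B x"
    using AE_level_rank[OF B] by (simp add: \<psi>_def)
  \<comment> \<open>One array of coefficients for both differences: over \<open>e\<close> it gives
    \<open>F\<close> minus the twisted \<open>G\<close>, over \<open>A\<close> the twisted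
    \<open>F\<close> minus \<open>G\<close>. As \<open>e\<close> and \<open>A\<close> have equal
    block measures, the two norms can be compared.\<close>
  define H where "H i a b = F i (a mod n) (b mod n) - G i (a div n) (b div n)" for i a b
  have F_G: "bounded_kernel (step F ?g)" "bounded_kernel (step G ?g)"
    by (intro bounded_kernel_step[OF g])+
  have HA: "bounded_kernel (step H A)" by (rule bounded_kernel_step[OF A])
  have He: "bounded_kernel (step H e)" by (rule bounded_kernel_step[OF e])
  have GF: "bounded_kernel (kdiff (twist (step F ?g) \<psi>) (step G ?g))"
    by (intro bounded_kernel_kdiff bounded_kernel_twist F_G \<psi>)
  have FG: "bounded_kernel (kdiff (step F ?g) (twist (step G ?g) \<phi>))"
    by (intro bounded_kernel_kdiff bounded_kernel_twist F_G \<phi>)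
  have AE1: "AE p in unit_square. kdiff (twist (step F ?g) \<psi>) (step G ?g) i p = step H A i p" for i
    using AE_square_fst_snd[OF g\<psi>] AE_square_fst_snd[OF A_div]
    by eventually_elim (simp add: twist_step, simp add: kdiff_def step_def H_def B_def)
  have AE2: "AE p in unit_square. step H e i p = kdiff (step F ?g) (twist (step G ?g) \<phi>) i p" for i
    unfolding twist_step using AE_space
    by eventually_elim (auto simp: kdiff_def step_def H_def e_mod)
  have "cut_norm k (kdiff (step G ?g) (twist (step F ?g) \<psi>)) = cut_norm k (kdiff (twist (step F ?g) \<psi>) (step G ?g))"
    by (rule cut_norm_kdiff_commute)
  also have "\<dots> \<le> cut_norm k (step H A)"
    using cut_norm_le_add_diff[OF GF HA, of k] cut_norm_AE[OF GF HA AE1, of k] by simp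
  also have "\<dots> \<le> cut_norm k (step H e)"
  proof (rule cut_norm_step_le[OF A e])
    fix a
    have "vol {x \<in> {0..1}. A x = a} = vol {x \<in> {0..1}. A (rank e x) = a}"
      by (rule labelling_mp(2)[OF A rank_mp[OF e], symmetric])
    also have "\<dots> = vol {x \<in> {0..1}. e x = a}"
      by (rule vol_AE_eq[OF labelling_mp(1)[OF A rank_mp[OF e]] e eA])
    finally show "vol {x \<in> {0..1}. A x = a} = vol {x \<in> {0..1}. e x = a}" .
  qed
  also have "\<dots> \<le> cut_norm k (kdiff (step F ?g) (twist (step G ?g) \<phi>))"
    using cut_norm_le_add_diff[OF He FG, of k] cut_norm_AE[OF He FG AE2, of k] by simp
  finally show ?thesis using \<psi> by blast
qed

lemma kdelta_commute_le:
  assumes f: "bounded_kernel f" and g: "bounded_kernel g"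
  shows "kdelta k g f \<le> kdelta k f g"
proof (rule field_le_epsilon)
  fix e :: real assume "0 < e"
  \<comment> \<open>Each of the two kernels is replaced by a step kernel once untwisted and once
    twisted, which makes four errors; the choice of \<open>\<phi>\<close> makes the fifth.\<close>
  then have e: "0 < e / 5" by simp
  obtain \<phi> where \<phi>: "\<phi> \<in> mp_maps" "cut_norm k (kdiff f (twist g \<phi>)) < kdelta k f g + e / 5"
    using kdelta_less[of k f g "kdelta k f g + e / 5"] e by auto
  from eventually_happens'[OF trivial_limit_sequentially eventually_conj[OF grid_approx_cut_norm[OF f e, of k]
        eventually_conj[OF grid_approx_cut_norm[OF g e, of k] eventually_gt_at_top[of 0]]]]
  obtain n where n: "0 < n"
    and ex: "\<exists>F. \<forall>\<phi>\<in>mp_maps. cut_norm k (kdiff (twist f \<phi>) (twist (step F (grid n)) \<phi>)) \<le> e / 5"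
      "\<exists>G. \<forall>\<phi>\<in>mp_maps. cut_norm k (kdiff (twist g \<phi>) (twist (step G (grid n)) \<phi>)) \<le> e / 5"
    by (elim exE conjE) (rule that, assumption, (rule exI, assumption)+)
  obtain F where F: "\<And>\<phi>. \<phi> \<in> mp_maps \<Longrightarrow> cut_norm k (kdiff (twist f \<phi>) (twist (step F (grid n)) \<phi>)) \<le> e / 5"
    using ex(1) by blast
  obtain G where G: "\<And>\<phi>. \<phi> \<in> mp_maps \<Longrightarrow> cut_norm k (kdiff (twist g \<phi>) (twist (step G (grid n)) \<phi>)) \<le> e / 5"
    using ex(2) by blast
  let ?F = "step F (grid n)" and ?G = "step G (grid n)"
  have b: "bounded_kernel ?F" "bounded_kernel ?G"
    by (intro bounded_kernel_step[OF grid_labelling[OF n]])+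
  obtain \<psi> where \<psi>: "\<psi> \<in> mp_maps" "cut_norm k (kdiff ?G (twist ?F \<psi>)) \<le> cut_norm k (kdiff ?F (twist ?G \<phi>))"
    using exists_reversing_map[OF n \<phi>(1)] by blast
  note bt = bounded_kernel_twist[OF f \<psi>(1)] bounded_kernel_twist[OF b(1) \<psi>(1)]
    bounded_kernel_twist[OF b(2) \<phi>(1)] bounded_kernel_twist[OF g \<phi>(1)]
  have "cut_norm k (kdiff g (twist f \<psi>)) \<le> cut_norm k (kdiff g ?G) + cut_norm k (kdiff ?G (twist f \<psi>))"
    by (rule cut_norm_triangle[OF g b(2) bt(1)])
  also have "cut_norm k (kdiff ?G (twist f \<psi>)) \<le> cut_norm k (kdiff ?G (twist ?F \<psi>)) + cut_norm k (kdiff (twist ?F \<psi>) (twist f \<psi>))"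
    by (rule cut_norm_triangle[OF b(2) bt(2) bt(1)])
  finally have 1: "cut_norm k (kdiff g (twist f \<psi>)) \<le> cut_norm k (kdiff ?F (twist ?G \<phi>)) + 2 * (e / 5)"
    using \<psi>(2) F[OF \<psi>(1)] G[OF mp_id] cut_norm_kdiff_commute[of k "twist ?F \<psi>" "twist f \<psi>"]
    by (simp add: twist_id)
  have "cut_norm k (kdiff ?F (twist ?G \<phi>)) \<le> cut_norm k (kdiff ?F f) + cut_norm k (kdiff f (twist ?G \<phi>))"
    by (rule cut_norm_triangle[OF b(1) f bt(3)])
  also have "cut_norm k (kdiff f (twist ?G \<phi>)) \<le> cut_norm k (kdiff f (twist g \<phi>)) + cut_norm k (kdiff (twist g \<phi>) (twist ?G \<phi>))"
    by (rule cut_norm_triangle[OF f bt(4) bt(3)])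
  finally have "cut_norm k (kdiff ?F (twist ?G \<phi>)) \<le> kdelta k f g + 3 * (e / 5)"
    using \<phi>(2) F[OF mp_id] G[OF \<phi>(1)] cut_norm_kdiff_commute[of k ?F f] by (simp add: twist_id)
  then have "cut_norm k (kdiff g (twist f \<psi>)) \<le> kdelta k f g + e" using 1 by simp
  then show "kdelta k g f \<le> kdelta k f g + e"
    using kdelta_le[OF g f \<psi>(1), of k] by simp
qed

lemma kdelta_commute:
  assumes "bounded_kernel f" "bounded_kernel g" shows "kdelta k f g = kdelta k g f"
  using kdelta_commute_le[OF assms] kdelta_commute_le[OF assms(2,1)] by (rule antisym[rotated])

section \<open>Weak regularity and total boundedness\<close>

definition unit_kernel :: "kernel \<Rightarrow> bool" where
  "unit_kernel f \<longleftrightarrow>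
    (\<forall>i. f i \<in> borel_measurable unit_square \<and> (\<forall>p\<in>{0..1} \<times> {0..1}. f i p \<in> {0..1}))"

lemma unit_kernel_bounded: "unit_kernel f \<Longrightarrow> bounded_kernel f"
  unfolding unit_kernel_def bounded_kernel_def by (auto intro!: exI[of _ 1])

definition fibre :: "(real \<Rightarrow> nat) \<Rightarrow> nat \<Rightarrow> real set" where
  "fibre c a = {x \<in> {0..1}. c x = a}"

text \<open>On a null block the quotient is 0 by the convention for division, which keeps the means
  of a unit kernel in the unit interval.\<close>

definition block_mean :: "(real \<times> real \<Rightarrow> real) \<Rightarrow> (real \<Rightarrow> nat) \<Rightarrow> nat \<Rightarrow> nat \<Rightarrow> real" where
  "block_mean g c a b = rect_int g (fibre c a) (fibre c b) / (vol (fibre c a) * vol (fibre c b))"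

text \<open>The conditional expectation of each colour given the product partition into
  blocks.\<close>

definition averaged :: "kernel \<Rightarrow> (real \<Rightarrow> nat) \<Rightarrow> kernel" where
  "averaged f c = step (\<lambda>i. block_mean (f i) c) c"

lemma fibre_sets: "c \<in> labelling N \<Longrightarrow> fibre c a \<in> sets unit_interval"
  unfolding fibre_def by (rule labelling_sets)

text \<open>Makes the default value of \<open>block_mean\<close> on null blocks harmless: every
  function integrates to 0 there.\<close>

lemma rect_int_null:
  assumes "S \<in> sets unit_interval" "T \<in> sets unit_interval" "vol S * vol T = 0"
  shows "rect_int g S T = 0"
  unfolding rect_int_def
proof (rule integral_eq_zero_AE)
  have "measure unit_square (S \<times> T) = 0"
    using measure_square_Times[OF assms(1,2)] assms(3) by simp
  then have "AE p in unit_square. p \<notin> S \<times> T"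
    using Times_in_square[OF assms(1,2)] by (intro AE_not_in null_setsI) (simp_all add: Q.emeasure_eq_measure)
  then show "AE p in unit_square. indicator (S \<times> T) p * g p = 0"
    by eventually_elim simp
qed

lemma rect_int_averaged:
  assumes f: "bounded_kernel f" and c: "c \<in> labelling N" and ab: "a < N" "b < N"
  shows "rect_int (averaged f c i) (fibre c a) (fibre c b) = rect_int (f i) (fibre c a) (fibre c b)"
proof -
  have *: "vol (fibre c a \<inter> {x \<in> {0..1}. c x = a'}) = (if a' = a then vol (fibre c a) else 0)" for a a'
  proof -
    have "fibre c a \<inter> {x \<in> {0..1}. c x = a'} = (if a' = a then fibre c a else {})"
      by (auto simp: fibre_def)
    then show ?thesis by (cases "a' = a") (simp_all only: measure_empty if_True if_False refl)
  qed
  have "rect_int (averaged f c i) (fibre c a) (fibre c b)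
      = (\<Sum>a'<N. \<Sum>b'<N. block_mean (f i) c a' b' *
          ((if a' = a then vol (fibre c a) else 0) * (if b' = b then vol (fibre c b) else 0)))"
    unfolding averaged_def by (subst rect_int_step[OF c fibre_sets[OF c] fibre_sets[OF c]]) (simp only: *)
  also have "\<dots> = (\<Sum>a'<N. \<Sum>b'<N. if b' = b then (if a' = a then block_mean (f i) c a' b' * (vol (fibre c a) * vol (fibre c b)) else 0) else 0)"
    by (intro sum.cong refl) auto
  also have "\<dots> = block_mean (f i) c a b * (vol (fibre c a) * vol (fibre c b))"
    using ab by (simp add: sum.delta)
  also have "\<dots> = rect_int (f i) (fibre c a) (fibre c b)"
    using rect_int_null[OF fibre_sets[OF c] fibre_sets[OF c], of a b "f i"] by (auto simp: block_mean_def)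
  finally show ?thesis .
qed

lemma bounded_kernel_averaged: "c \<in> labelling N \<Longrightarrow> bounded_kernel (averaged f c)"
  unfolding averaged_def by (rule bounded_kernel_step)

text \<open>\<open>f\<close> and its block means have equal integrals over each block, and a
  function of the two labels is a linear combination of block indicators.\<close>

lemma averaged_orthogonal:
  assumes f: "bounded_kernel f" and c: "c \<in> labelling N"
  shows "(LINT p|unit_square. kdiff f (averaged f c) i p * G (c (fst p)) (c (snd p))) = 0"
proof -
  let ?h = "kdiff f (averaged f c) i"
  have bk: "bounded_kernel (kdiff f (averaged f c))"
    by (intro bounded_kernel_kdiff f bounded_kernel_averaged[OF c])
  have exp: "?h p * G (c (fst p)) (c (snd p)) = (\<Sum>a<N. \<Sum>b<N. G a b * (indicator (fibre c a \<times> fibre c b) p * ?h p))"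
    if "p \<in> space unit_square" for p
  proof -
    have "indicator ({0..1} \<times> {0..1}) p * step (\<lambda>_. G) c i p
      = (\<Sum>a<N. \<Sum>b<N. G a b * indicator (({0..1} \<inter> {x \<in> {0..1}. c x = a}) \<times> ({0..1} \<inter> {x \<in> {0..1}. c x = b})) p)"
      using that by (intro step_expand[OF c]) simp
    moreover have "{0..1} \<inter> {x \<in> {0..1}. c x = a} = fibre c a" for a by (auto simp: fibre_def)
    moreover have "indicator ({0..1} \<times> {0..1}) p = (1 :: real)" using that by (auto simp: indicator_def)
    ultimately have "G (c (fst p)) (c (snd p)) = (\<Sum>a<N. \<Sum>b<N. G a b * indicator (fibre c a \<times> fibre c b) p)"
      by (simp only: step_def mult_1)
    then show ?thesis by (simp only: sum_distrib_left mult_ac)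
  qed
  have int: "integrable unit_square (\<lambda>p. G a b * (indicator (fibre c a \<times> fibre c b) p * ?h p))" for a b
    by (intro integrable_mult_right integrable_rect bounded_kernelD[OF bk] fibre_sets[OF c])
  have "(LINT p|unit_square. ?h p * G (c (fst p)) (c (snd p)))
      = (LINT p|unit_square. (\<Sum>a<N. \<Sum>b<N. G a b * (indicator (fibre c a \<times> fibre c b) p * ?h p)))"
    by (intro Bochner_Integration.integral_cong refl exp)
  also have "\<dots> = (\<Sum>a<N. \<Sum>b<N. G a b * rect_int ?h (fibre c a) (fibre c b))"
    by (simp only: int Bochner_Integration.integral_sum Bochner_Integration.integrable_sum
        Bochner_Integration.integral_mult_right_zero rect_int_def)
  also have "\<dots> = 0"
    using rect_int_averaged[OF f c, of _ _ i]
    by (intro sum.neutral ballI) (simp add: rect_int_kdiff[OF f bounded_kernel_averaged[OF c] fibre_sets[OF c] fibre_sets[OF c]])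
  finally show ?thesis .
qed

lemma block_mean_in_unit:
  assumes f: "unit_kernel f" and c: "c \<in> labelling N"
  shows "block_mean (f i) c a b \<in> {0..1}"
proof -
  note fs = fibre_sets[OF c]
  let ?R = "fibre c a \<times> fibre c b"
  have R: "?R \<in> sets unit_square" by (intro Times_in_square fs)
  have m: "measure unit_square ?R = vol (fibre c a) * vol (fibre c b)" by (rule measure_square_Times[OF fs fs])
  have v: "f i p \<in> {0..1}" if "p \<in> space unit_square" for p
    using f that unfolding unit_kernel_def by (metis space_unit_square)
  have "0 \<le> rect_int (f i) (fibre c a) (fibre c b)"
    unfolding rect_int_def
    by (rule Bochner_Integration.integral_nonneg_AE, rule AE_I2) (use v in \<open>auto simp: indicator_def\<close>)
  moreover have "rect_int (f i) (fibre c a) (fibre c b) \<le> (LINT p|unit_square. indicator ?R p)"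
    unfolding rect_int_def
  proof (rule integral_mono)
    show "integrable unit_square (\<lambda>p. indicator ?R p * f i p)"
      by (intro integrable_rect bounded_kernelD[OF unit_kernel_bounded[OF f]] fs)
    show "integrable unit_square (indicator ?R :: _ \<Rightarrow> real)"
      using R by (intro integrable_real_indicator) (auto simp: Q.emeasure_eq_measure)
    show "indicator ?R p * f i p \<le> indicator ?R p" if "p \<in> space unit_square" for p
      using v[OF that] by (simp add: indicator_def)
  qed
  moreover have "(LINT p|unit_square. indicator ?R p) = vol (fibre c a) * vol (fibre c b)"
    using m sets.sets_into_space[OF R] by (simp add: Int_absorb2 del: Times_Int_Times)
  ultimately have "0 \<le> rect_int (f i) (fibre c a) (fibre c b)"
    "rect_int (f i) (fibre c a) (fibre c b) \<le> vol (fibre c a) * vol (fibre c b)" by simp_all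
  moreover have "r / v \<in> {0..1}" if "0 \<le> r" "r \<le> v" for r v :: real
    using that by (cases "v = 0") (auto simp: divide_le_eq_1)
  ultimately show ?thesis unfolding block_mean_def by blast
qed

text \<open>By orthogonality this is the squared \<open>L2\<close> norm of \<open>f\<close> minus
  that of its average, for bounded \<open>f\<close>. The latter is the energy usually considered, so
  an energy increment appears here as a decrease.\<close>

definition energy :: "kernel \<Rightarrow> (real \<Rightarrow> nat) \<Rightarrow> nat \<Rightarrow> real" where
  "energy f c i = (LINT p|unit_square. (kdiff f (averaged f c) i p)\<^sup>2)"

lemma integrable_bounded_mult:
  assumes f: "bounded_kernel f" and g: "bounded_kernel g"
  shows "integrable unit_square (\<lambda>p. f i p * g j p)"
proof -
  obtain A where A: "\<And>p. p \<in> {0..1} \<times> {0..1} \<Longrightarrow> \<bar>f i p\<bar> \<le> A"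
    using f unfolding bounded_kernel_def by blast
  obtain B where B: "\<And>p. p \<in> {0..1} \<times> {0..1} \<Longrightarrow> \<bar>g j p\<bar> \<le> B"
    using g unfolding bounded_kernel_def by blast
  show ?thesis
  proof (rule Q.integrable_const_bound[where B="A * B"])
    show "AE p in unit_square. norm (f i p * g j p) \<le> A * B"
    proof (rule AE_I2)
      fix p :: "real \<times> real" assume "p \<in> space unit_square"
      then have "p \<in> {0..1} \<times> {0..1}" by simp
      from A[OF this] B[OF this] show "norm (f i p * g j p) \<le> A * B"
        unfolding real_norm_def abs_mult by (intro mult_mono) auto
    qed
    show "(\<lambda>p. f i p * g j p) \<in> borel_measurable unit_square"
      using bounded_kernelD(1)[OF f, of i] bounded_kernelD(1)[OF g, of j] by measurable
  qed
qed

text \<open>Pythagoras: as \<open>c\<close> is a function of \<open>d\<close>, the difference of the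
  two averages depends on the labels of \<open>d\<close> only and is orthogonal to \<open>f\<close>
  minus its finer average.\<close>

lemma energy_refine:
  assumes f: "bounded_kernel f" and c: "c \<in> labelling N" and d: "d \<in> labelling M"
    and h: "\<And>x. x \<in> {0..1} \<Longrightarrow> c x = h (d x)"
  shows "energy f c i = energy f d i + (LINT p|unit_square. (kdiff (averaged f d) (averaged f c) i p)\<^sup>2)"
proof -
  let ?u = "kdiff f (averaged f d)" and ?D = "kdiff (averaged f d) (averaged f c)"
  have bk: "bounded_kernel ?u" "bounded_kernel ?D"
    by (intro bounded_kernel_kdiff f bounded_kernel_averaged[OF c] bounded_kernel_averaged[OF d])+
  define G where "G a b = block_mean (f i) d a b - block_mean (f i) c (h a) (h b)" for a b
  have "(LINT p|unit_square. ?u i p * ?D i p) = (LINT p|unit_square. ?u i p * G (d (fst p)) (d (snd p)))"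
    by (intro Bochner_Integration.integral_cong refl) (auto simp: kdiff_def averaged_def step_def G_def h)
  then have 0: "(LINT p|unit_square. ?u i p * ?D i p) = 0"
    using averaged_orthogonal[OF f d, of i G] by simp
  have "energy f c i = (LINT p|unit_square. ?u i p * ?u i p + (2 * (?u i p * ?D i p) + ?D i p * ?D i p))"
    unfolding energy_def
    by (intro Bochner_Integration.integral_cong refl) (simp add: kdiff_def power2_eq_square algebra_simps)
  also have "\<dots> = (LINT p|unit_square. ?u i p * ?u i p) + (2 * (LINT p|unit_square. ?u i p * ?D i p) + (LINT p|unit_square. ?D i p * ?D i p))"
    by (simp add: integrable_bounded_mult bk)
  finally show ?thesis
    unfolding 0 by (simp add: energy_def power2_eq_square)
qed

lemma energy_nonneg: "0 \<le> energy f c i"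
  unfolding energy_def by simp

lemma energy_le_1:
  assumes f: "unit_kernel f" and c: "c \<in> labelling N"
  shows "energy f c i \<le> 1"
proof -
  have bk: "bounded_kernel (kdiff f (averaged f c))"
    by (intro bounded_kernel_kdiff unit_kernel_bounded[OF f] bounded_kernel_averaged[OF c])
  have "energy f c i \<le> (LINT p|unit_square. 1)"
    unfolding energy_def
  proof (rule integral_mono)
    show "integrable unit_square (\<lambda>p. (kdiff f (averaged f c) i p)\<^sup>2)"
      using integrable_bounded_mult[OF bk bk] by (simp add: power2_eq_square)
    fix p :: "real \<times> real" assume p: "p \<in> space unit_square"
    then have "f i p \<in> {0..1}" using f unfolding unit_kernel_def by (metis space_unit_square)
    moreover have "averaged f c i p \<in> {0..1}"
      unfolding averaged_def step_def by (rule block_mean_in_unit[OF f c])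
    ultimately have "\<bar>kdiff f (averaged f c) i p\<bar> \<le> 1" by (auto simp: kdiff_def)
    then show "(kdiff f (averaged f c) i p)\<^sup>2 \<le> 1" by (simp add: abs_square_le_1)
  qed simp
  then show ?thesis using Q.prob_space by simp
qed

text \<open>\<open>S \<times> T\<close> is a union of blocks of \<open>d\<close>, so
  \<open>f\<close> may be replaced there by its finer average. The integral on the left is thus one
  of the difference of the averages, and Cauchy-Schwarz bounds its square by the energy
  drop.\<close>

lemma energy_increment:
  assumes f: "bounded_kernel f" and c: "c \<in> labelling N" and d: "d \<in> labelling M"
    and h: "\<And>x. x \<in> {0..1} \<Longrightarrow> c x = h (d x)"
    and S: "S \<in> sets unit_interval" "T \<in> sets unit_interval"
    and SP: "\<And>x. x \<in> {0..1} \<Longrightarrow> x \<in> S \<longleftrightarrow> P (d x)" and TR: "\<And>x. x \<in> {0..1} \<Longrightarrow> x \<in> T \<longleftrightarrow> R (d x)"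
  shows "energy f d i + (rect_int (kdiff f (averaged f c) i) S T)\<^sup>2 \<le> energy f c i"
proof -
  let ?u = "kdiff f (averaged f d)" and ?D = "kdiff (averaged f d) (averaged f c)"
  have bk: "bounded_kernel ?u" "bounded_kernel ?D"
    by (intro bounded_kernel_kdiff f bounded_kernel_averaged[OF c] bounded_kernel_averaged[OF d])+
  define G where "G a b = (if P a \<and> R b then 1 else 0 :: real)" for a b
  have ind: "indicator (S \<times> T) p = G (d (fst p)) (d (snd p))" if "p \<in> space unit_square" for p
    using that by (auto simp: G_def indicator_def SP TR)
  have "rect_int (?u i) S T = (LINT p|unit_square. ?u i p * G (d (fst p)) (d (snd p)))"
    unfolding rect_int_def by (intro Bochner_Integration.integral_cong refl) (simp add: ind mult.commute)
  then have 0: "rect_int (?u i) S T = 0"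
    using averaged_orthogonal[OF f d, of i G] by simp
  have "rect_int (kdiff f (averaged f c) i) S T = rect_int (?u i) S T + rect_int (?D i) S T"
    by (simp add: rect_int_kdiff f bounded_kernel_averaged[OF c] bounded_kernel_averaged[OF d] S)
  then have eq: "rect_int (kdiff f (averaged f c) i) S T = rect_int (?D i) S T" using 0 by simp
  let ?X = "\<lambda>p. indicator (S \<times> T) p * ?D i p"
  have iX: "integrable unit_square ?X"
    by (intro integrable_rect bounded_kernelD[OF bk(2)] S)
  have iD: "integrable unit_square (\<lambda>p. (?D i p)\<^sup>2)"
    using integrable_bounded_mult[OF bk(2) bk(2)] by (simp add: power2_eq_square)
  have sq: "(?X p)\<^sup>2 = indicator (S \<times> T) p * (?D i p)\<^sup>2" for p
    by (simp add: indicator_def)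
  have iX2: "integrable unit_square (\<lambda>p. (?X p)\<^sup>2)"
    unfolding sq by (intro integrable_rect iD S)
  \<comment> \<open>On a probability space, nonnegativity of the variance is Cauchy-Schwarz against
    the constant 1.\<close>
  have "0 \<le> Q.variance ?X" by (rule Q.variance_positive)
  then have "(rect_int (?D i) S T)\<^sup>2 \<le> (LINT p|unit_square. (?X p)\<^sup>2)"
    using Q.variance_eq[OF iX iX2] by (simp add: rect_int_def)
  also have "\<dots> \<le> (LINT p|unit_square. (?D i p)\<^sup>2)"
    by (intro integral_mono iX2 iD) (auto simp: indicator_def)
  finally show ?thesis
    unfolding eq using energy_refine[OF f c d h, of i] by simp
qed

lemma labelling_mono: "N \<le> M \<Longrightarrow> labelling N \<subseteq> labelling M"
  unfolding labelling_def by fastforce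

text \<open>A round refines a bad partition by a violating pair \<open>S\<close>, \<open>T\<close>,
  which splits each part into at most 4 and lowers the total energy by a fixed amount. The
  alternative allows a partition that is already good to be kept.\<close>

lemma energy_descent:
  assumes f: "unit_kernel f" and "0 < e"
  shows "\<exists>c\<in>labelling (4 ^ m). cut_norm k (kdiff f (averaged f c)) \<le> e \<or>
    (\<Sum>i = 1..k. energy f c i) \<le> real k - real m * (e / (real k + 1))\<^sup>2"
proof (induction m)
  case 0
  have c: "(\<lambda>_. 0) \<in> labelling 1" by (simp add: labelling_def)
  have "(\<Sum>i = 1..k. energy f (\<lambda>_. 0) i) \<le> real k"
    using sum_bounded_above[of "{1..k}" "energy f (\<lambda>_. 0)" 1, OF energy_le_1[OF f c]] by simp
  then show ?case using c by auto
next
  case (Suc m)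
  then obtain c where c: "c \<in> labelling (4 ^ m)" and
    or: "cut_norm k (kdiff f (averaged f c)) \<le> e \<or> (\<Sum>i = 1..k. energy f c i) \<le> real k - real m * (e / (real k + 1))\<^sup>2"
    by blast
  show ?case
  proof (cases "cut_norm k (kdiff f (averaged f c)) \<le> e")
    case True
    moreover have "c \<in> labelling (4 ^ Suc m)" using labelling_mono[of "4 ^ m" "4 ^ Suc m"] c by auto
    ultimately show ?thesis by blast
  next
    case False
    let ?u = "kdiff f (averaged f c)"
    let ?t = "e / (real k + 1)"
    obtain S T where S: "S \<in> sets unit_interval" "T \<in> sets unit_interval" and ST: "\<not> (\<Sum>i = 1..k. \<bar>rect_int (?u i) S T\<bar>) \<le> e"
      using cut_norm_bound[of ?u k e] False by blast
    \<comment> \<open>If each of the \<open>k\<close> colours had error at most \<open>?t\<close>,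
      the sum would not exceed \<open>e\<close>.\<close>
    have "\<exists>j\<in>{1..k}. ?t < \<bar>rect_int (?u j) S T\<bar>"
    proof (rule ccontr)
      assume "\<not> (\<exists>j\<in>{1..k}. ?t < \<bar>rect_int (?u j) S T\<bar>)"
      then have "(\<Sum>i = 1..k. \<bar>rect_int (?u i) S T\<bar>) \<le> real (card {1..k}) * ?t"
        by (intro sum_bounded_above) force
      also have "\<dots> \<le> e" using \<open>0 < e\<close> by (simp add: field_simps)
      finally show False using ST by simp
    qed
    then obtain j where j: "j \<in> {1..k}" "?t < \<bar>rect_int (?u j) S T\<bar>" by blast
    \<comment> \<open>Two bits: membership in \<open>S\<close> is worth 2, in \<open>T\<close> it is
      worth 1. The last digit of \<open>d\<close> in base 4 decides both sets.\<close>
    define s :: "real \<Rightarrow> nat" where "s x = (if x \<in> S then 2 else 0) + (if x \<in> T then 1 else 0)" for x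
    have s: "s \<in> labelling 4"
    proof -
      have "s \<in> unit_interval \<rightarrow>\<^sub>M count_space UNIV"
        unfolding s_def using S by measurable
      then show ?thesis by (auto simp: labelling_def s_def)
    qed
    define d where "d x = s x + 4 * c x" for x
    have d: "d \<in> labelling (4 ^ Suc m)"
      unfolding d_def using labelling_pair[OF c s] by (simp add: mult.commute)
    have s4: "s x < 4" for x by (simp add: s_def)
    have h: "c x = d x div 4" for x using s4[of x] by (simp add: d_def)
    have md: "d x mod 4 = s x" for x using s4[of x] by (simp add: d_def)
    have P: "x \<in> S \<longleftrightarrow> 2 \<le> d x mod 4" and R: "x \<in> T \<longleftrightarrow> odd (d x mod 4)" for x
      unfolding md by (auto simp: s_def)
    note inc = energy_increment[OF unit_kernel_bounded[OF f] c d, of "\<lambda>n. n div 4" S T "\<lambda>n. 2 \<le> n mod 4" "\<lambda>n. odd (n mod 4)", OF h S P R]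
    \<comment> \<open>Refinement raises the energy of no colour, so the drop for \<open>j\<close>
      survives in the sum.\<close>
    have le: "energy f d i \<le> energy f c i" for i using inc[of i] zero_le_power2[of "rect_int (?u i) S T"] by linarith
    have "?t\<^sup>2 \<le> (rect_int (?u j) S T)\<^sup>2"
      using j(2) \<open>0 < e\<close> by (simp add: abs_le_square_iff[symmetric])
    then have drop: "energy f d j + ?t\<^sup>2 \<le> energy f c j" using inc[of j] by simp
    have "(\<Sum>i = 1..k. energy f d i) + ?t\<^sup>2 = energy f d j + ?t\<^sup>2 + (\<Sum>i\<in>{1..k} - {j}. energy f d i)"
      using sum.remove[OF _ j(1), of "energy f d"] by simp
    also have "\<dots> \<le> energy f c j + (\<Sum>i\<in>{1..k} - {j}. energy f c i)"
      by (intro add_mono drop sum_mono le)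
    also have "\<dots> = (\<Sum>i = 1..k. energy f c i)"
      using sum.remove[OF _ j(1), of "energy f c"] by simp
    also have "\<dots> \<le> real k - real m * ?t\<^sup>2" using or False by simp
    finally have "(\<Sum>i = 1..k. energy f d i) \<le> real k - real (Suc m) * ?t\<^sup>2"
      by (simp add: algebra_simps)
    then show ?thesis using d by blast
  qed
qed

text \<open>The total energy is at most \<open>k\<close> at the start and never negative, so the
  number of rounds is bounded in terms of \<open>e\<close> and \<open>k\<close>, uniformly in the
  kernel.\<close>

lemma weak_regularity:
  assumes "0 < e"
  shows "\<exists>N>0. \<forall>f. unit_kernel f \<longrightarrow> (\<exists>c\<in>labelling N. cut_norm k (kdiff f (averaged f c)) \<le> e)"
proof -
  let ?t = "(e / (real k + 1))\<^sup>2"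
  have "0 < ?t" using assms by simp
  then obtain m where m: "real k < real m * ?t"
    using reals_Archimedean3 by blast
  have "\<exists>c\<in>labelling (4 ^ m). cut_norm k (kdiff f (averaged f c)) \<le> e" if f: "unit_kernel f" for f
  proof -
    obtain c where c: "c \<in> labelling (4 ^ m)" and or: "cut_norm k (kdiff f (averaged f c)) \<le> e \<or>
        (\<Sum>i = 1..k. energy f c i) \<le> real k - real m * ?t"
      using energy_descent[OF f assms] by blast
    have "0 \<le> (\<Sum>i = 1..k. energy f c i)" by (intro sum_nonneg energy_nonneg)
    then show ?thesis using c or m by auto
  qed
  then show ?thesis by (intro exI[of _ "4 ^ m"]) simp
qed

section \<open>Rounding of step values and breakpoints\<close>

lemma level_disagree:
  assumes "level s N x \<noteq> level s' N x"
  shows "\<exists>j\<in>{1..<N}. min (s j) (s' j) \<le> x \<and> x \<le> max (s j) (s' j)"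
proof (rule ccontr)
  assume "\<not> ?thesis"
  then have "s j < x \<longleftrightarrow> s' j < x" if "j \<in> {1..<N}" for j
    using that by (auto simp: min_le_iff_disj le_max_iff_disj not_le dest!: bspec)
  then have "{j \<in> {1..<N}. s j < x} = {j \<in> {1..<N}. s' j < x}" by blast
  then show False using assms by (simp add: level_def)
qed

text \<open>A point gets different labels only if it lies between two corresponding breakpoints, and
  these are at most \<open>\<eta>\<close> apart.\<close>

lemma vol_level_disagree:
  assumes "0 < N" "0 \<le> \<eta>" "\<And>j. j < N \<Longrightarrow> \<bar>s j - s' j\<bar> \<le> \<eta>"
  shows "{x \<in> {0..1}. level s N x \<noteq> level s' N x} \<in> sets unit_interval"
    "vol {x \<in> {0..1}. level s N x \<noteq> level s' N x} \<le> real N * \<eta>"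
proof -
  let ?J = "\<lambda>j. {0..1} \<inter> {min (s j) (s' j)..max (s j) (s' j)}"
  have "(\<lambda>x. (level s N x, level s' N x)) \<in> unit_interval \<rightarrow>\<^sub>M count_space UNIV \<Otimes>\<^sub>M count_space UNIV"
    using level_labelling[OF assms(1), of s] level_labelling[OF assms(1), of s']
    by (intro measurable_Pair) (simp_all add: labelling_def)
  then have "(\<lambda>x. (level s N x, level s' N x)) \<in> unit_interval \<rightarrow>\<^sub>M count_space UNIV"
    by (simp add: pair_measure_countable)
  from measurable_sets[OF this, of "{p. fst p \<noteq> snd p}"]
  show m: "{x \<in> {0..1}. level s N x \<noteq> level s' N x} \<in> sets unit_interval"
    by (simp add: vimage_def Int_def conj_commute)
  have J: "?J j \<in> sets unit_interval" for j by (rule borel_imp_unit_interval) simp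
  have "vol {x \<in> {0..1}. level s N x \<noteq> level s' N x} \<le> vol (\<Union>j\<in>{1..<N}. ?J j)"
    by (rule I.finite_measure_mono) (use level_disagree J in fastforce)+
  also have "\<dots> \<le> (\<Sum>j\<in>{1..<N}. vol (?J j))"
    by (rule I.finite_measure_subadditive_finite) (use J in auto)
  also have "\<dots> \<le> (\<Sum>j\<in>{1..<N}. \<eta>)"
  proof (rule sum_mono)
    fix j assume "j \<in> {1..<N}"
    then have "max (s j) (s' j) - min (s j) (s' j) \<le> \<eta>" using assms(3)[of j] by (auto simp: max_def min_def)
    moreover have "vol (?J j) = measure lebesgue (?J j)" by (simp add: measure_restrict_space)
    moreover have "measure lebesgue (?J j) \<le> measure lebesgue {min (s j) (s' j)..max (s j) (s' j)}"
      by (intro measure_mono_fmeasurable) auto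
    moreover have "measure lebesgue {min (s j) (s' j)..max (s j) (s' j)} = max (s j) (s' j) - min (s j) (s' j)"
      by simp
    ultimately show "vol (?J j) \<le> \<eta>" by linarith
  qed
  also have "\<dots> \<le> real N * \<eta>" using assms(2) by (simp add: mult_right_mono)
  finally show "vol {x \<in> {0..1}. level s N x \<noteq> level s' N x} \<le> real N * \<eta>" .
qed

text \<open>Where both coordinates are labelled alike, the coefficients differ by at most
  \<open>\<eta>\<close>; the rest lies in two strips of area at most \<open>real N * \<eta>\<close>
  each, on which values in the unit interval differ by at most 1.\<close>

lemma cut_norm_level_steps:
  assumes N: "0 < N" and \<eta>: "0 \<le> \<eta>" and s: "\<And>j. j < N \<Longrightarrow> \<bar>s j - s' j\<bar> \<le> \<eta>"
    and F: "\<And>i a b. i \<in> {1..k} \<Longrightarrow> a < N \<Longrightarrow> b < N \<Longrightarrow> \<bar>F i a b - F' i a b\<bar> \<le> \<eta>"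
    and F01: "\<And>i a b. F i a b \<in> {0..1}" and F'01: "\<And>i a b. F' i a b \<in> {0..1}"
  shows "cut_norm k (kdiff (step F (level s N)) (step F' (level s' N))) \<le> real k * (\<eta> + 2 * (real N * \<eta>))"
proof -
  let ?A = "level s N" and ?B = "level s' N"
  define D where "D = {x \<in> {0..1}. ?A x \<noteq> ?B x}"
  note D = vol_level_disagree[of N \<eta> s s', OF N \<eta> s, folded D_def]
  let ?f = "kdiff (step F ?A) (step F' ?B)"
  have bk: "bounded_kernel ?f"
    by (intro bounded_kernel_kdiff bounded_kernel_step[OF level_labelling[OF N]])
  have U: "{0..1} \<in> sets unit_interval" using sets.top[of unit_interval] by simp
  let ?I = "\<lambda>p. \<eta> + (indicator (D \<times> {0..1}) p + indicator ({0..1} \<times> D) p) :: real"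
  have ii: "integrable unit_square (indicator (D \<times> {0..1}) :: _ \<Rightarrow> real)"
    "integrable unit_square (indicator ({0..1} \<times> D) :: _ \<Rightarrow> real)"
    using Times_in_square[OF D(1) U] Times_in_square[OF U D(1)]
    by (auto intro!: integrable_real_indicator simp: Q.emeasure_eq_measure)
  have "(LINT p|unit_square. \<bar>?f i p\<bar>) \<le> \<eta> + 2 * (real N * \<eta>)" if i: "i \<in> {1..k}" for i
  proof -
    have "(LINT p|unit_square. \<bar>?f i p\<bar>) \<le> (LINT p|unit_square. ?I p)"
    proof (rule integral_mono)
      show "integrable unit_square (\<lambda>p. \<bar>?f i p\<bar>)"
        by (intro integrable_abs bounded_kernelD[OF bk])
      show "integrable unit_square ?I" using ii by simp
      fix p :: "real \<times> real" assume "p \<in> space unit_square"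
      then obtain x y where p: "p = (x, y)" "x \<in> {0..1}" "y \<in> {0..1}" by auto
      show "\<bar>?f i p\<bar> \<le> ?I p"
      proof (cases "x \<in> D \<or> y \<in> D")
        case True
        then have "1 \<le> (indicator (D \<times> {0..1}) p + indicator ({0..1} \<times> D) p :: real)"
          using p by (auto simp: indicator_def)
        moreover have "\<bar>?f i p\<bar> \<le> 1"
          using F01[of i "?A x" "?A y"] F'01[of i "?B x" "?B y"] by (auto simp: p kdiff_def step_def)
        ultimately show ?thesis using \<eta> by linarith
      next
        case False
        then have "?B x = ?A x" "?B y = ?A y" using p by (auto simp: D_def)
        then have "\<bar>?f i p\<bar> \<le> \<eta>"
          using F[OF i level_less[OF N] level_less[OF N], of s x s y] by (simp add: p kdiff_def step_def)
        then show ?thesis by (auto simp: indicator_def)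
      qed
    qed
    also have "\<dots> = \<eta> + (measure unit_square (D \<times> {0..1}) + measure unit_square ({0..1} \<times> D))"
    proof -
      have "D \<times> {0..1} \<inter> space unit_square = D \<times> {0..1}" "{0..1} \<times> D \<inter> space unit_square = {0..1} \<times> D"
        by (auto simp: D_def)
      then have "(LINT p|unit_square. indicator (D \<times> {0..1}) p) = measure unit_square (D \<times> {0..1})"
        "(LINT p|unit_square. indicator ({0..1} \<times> D) p) = measure unit_square ({0..1} \<times> D)"
        by (simp_all only: Bochner_Integration.integral_indicator)
      then show ?thesis
        using ii Q.prob_space by simp
    qed
    also have "\<dots> = \<eta> + 2 * vol D"
      using measure_square_Times[OF D(1) U] measure_square_Times[OF U D(1)] I.prob_space
      by (simp only: space_unit_interval mult_1_right mult_1_left)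
    finally show ?thesis using D(2) by simp
  qed
  then have "(\<Sum>i = 1..k. LINT p|unit_square. \<bar>?f i p\<bar>) \<le> real (card {1..k}) * (\<eta> + 2 * (real N * \<eta>))"
    by (intro sum_bounded_above)
  then show ?thesis using cut_norm_le_L1[OF bk, of k] by simp
qed

lemma abs_diff_le_floor:
  fixes x y \<eta> :: real
  assumes "0 < \<eta>" "\<lfloor>x / \<eta>\<rfloor> = \<lfloor>y / \<eta>\<rfloor>" shows "\<bar>x - y\<bar> \<le> \<eta>"
proof -
  have "\<bar>x / \<eta> - y / \<eta>\<bar> \<le> 1" using assms(2) by linarith
  then show ?thesis using assms(1) by (simp add: diff_divide_distrib[symmetric] divide_le_eq)
qed

text \<open>Finitely many signatures stand in for finitely many centres: balls can then be centred
  at graphons, without showing that the approximating step kernels arise from graphons.\<close>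

lemma kdelta_totally_bounded:
  assumes "0 < e"
  shows "\<exists>K (sig :: kernel \<Rightarrow> (nat \<times> nat \<times> nat \<Rightarrow> int) \<times> (nat \<Rightarrow> int)). finite K \<and>
    (\<forall>f. unit_kernel f \<longrightarrow> sig f \<in> K) \<and>
    (\<forall>f g. unit_kernel f \<and> unit_kernel g \<and> sig f = sig g \<longrightarrow> kdelta k f g \<le> e)"
proof -
  have "0 < e / 3" using assms by simp
  from weak_regularity[OF this, of k] obtain N where N: "0 < N"
    and reg: "\<And>f. unit_kernel f \<Longrightarrow> \<exists>c\<in>labelling N. cut_norm k (kdiff f (averaged f c)) \<le> e / 3"
    by blast
  have "\<forall>f. \<exists>c. unit_kernel f \<longrightarrow> c \<in> labelling N \<and> cut_norm k (kdiff f (averaged f c)) \<le> e / 3"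
    using reg by blast
  then obtain C where C: "\<And>f. unit_kernel f \<Longrightarrow> C f \<in> labelling N"
    "\<And>f. unit_kernel f \<Longrightarrow> cut_norm k (kdiff f (averaged f (C f))) \<le> e / 3"
    by (rule choice[THEN exE]) blast
  define F where "F f i = block_mean (f i) (C f)" for f i
  define s where "s f = cumulative (C f)" for f
  define A where "A f = level (s f) N" for f
  \<comment> \<open>Chosen so that the bound of \<open>cut_norm_level_steps\<close> becomes at most
    \<open>e / 3\<close>.\<close>
  define \<eta> where "\<eta> = e / 3 / ((real k + 1) * (1 + 2 * real N))"
  have \<eta>: "0 < \<eta>" unfolding \<eta>_def using assms by (intro divide_pos_pos mult_pos_pos) auto
  have \<eta>k: "real k * (\<eta> + 2 * (real N * \<eta>)) \<le> e / 3"
  proof -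
    have "real k * (\<eta> + 2 * (real N * \<eta>)) \<le> (real k + 1) * (1 + 2 * real N) * \<eta>"
      using \<eta> by (simp add: algebra_simps)
    also have "\<dots> = e / 3"
      unfolding \<eta>_def by (rule nonzero_mult_div_cancel_left[of _ "e / 3", unfolded times_divide_eq_right[symmetric]]) auto
    finally show ?thesis .
  qed
  have AL: "A f \<in> labelling N" for f unfolding A_def by (rule level_labelling[OF N])
  have bA: "bounded_kernel (step (F f) (A g))" for f g by (rule bounded_kernel_step[OF AL])
  \<comment> \<open>The map \<open>rank (C f)\<close> turns an arbitrary partition into intervals,
    so breakpoints and coefficients describe the step kernel completely.\<close>
  have close: "kdelta k f (step (F f) (A f)) \<le> e / 3" if f: "unit_kernel f" for f
  proof -
    note c = C(1)[OF f] and fb = unit_kernel_bounded[OF f]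
    have \<rho>: "rank (C f) \<in> mp_maps" by (rule rank_mp[OF c])
    let ?t = "twist (step (F f) (A f)) (rank (C f))"
    have bt: "bounded_kernel ?t" by (rule bounded_kernel_twist[OF bA \<rho>])
    have ba: "bounded_kernel (averaged f (C f))" by (rule bounded_kernel_averaged[OF c])
    have "AE p in unit_square. averaged f (C f) i p = ?t i p" for i
      unfolding averaged_def twist_step F_def[symmetric, abs_def] A_def s_def
      using AE_level_rank[OF c] by (intro step_AE) (auto elim: eventually_mono)
    then have "cut_norm k (kdiff (averaged f (C f)) ?t) = 0"
      by (intro cut_norm_AE ba bt)
    then have "cut_norm k (kdiff f ?t) \<le> e / 3"
      using cut_norm_triangle[OF fb ba bt, of k] C(2)[OF f] by simp
    then show ?thesis using kdelta_le[OF fb bA[of f f] \<rho>, of k] by simp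
  qed
  let ?X = "{1..k} \<times> {..<N} \<times> {..<N}"
  \<comment> \<open>Coefficients and breakpoints are measured in units of \<open>\<eta>\<close>,
    rounded down and restricted to finite index sets, so that only finitely many signatures
    occur.\<close>
  define sig where "sig f = (restrict (\<lambda>(i, a, b). \<lfloor>F f i a b / \<eta>\<rfloor>) ?X, restrict (\<lambda>j. \<lfloor>s f j / \<eta>\<rfloor>) {..<N})" for f
  let ?V = "{0..\<lfloor>1 / \<eta>\<rfloor>}"
  let ?K = "(?X \<rightarrow>\<^sub>E ?V) \<times> ({..<N} \<rightarrow>\<^sub>E ?V)"
  have V: "\<lfloor>x / \<eta>\<rfloor> \<in> ?V" if "x \<in> {0..1}" for x
    using that \<eta> by (auto intro!: floor_mono divide_right_mono)
  have F01: "F f i a b \<in> {0..1}" if "unit_kernel f" for f i a b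
    unfolding F_def by (rule block_mean_in_unit[OF that C(1)[OF that]])
  have s01: "s f j \<in> {0..1}" for f j
    unfolding s_def cumulative_def by simp
  have "finite ?K" by (intro finite_cartesian_product finite_PiE) auto
  moreover have "sig f \<in> ?K" if "unit_kernel f" for f
    using V[OF F01[OF that]] V[OF s01] by (auto simp: sig_def simp del: atLeastAtMost_iff)
  moreover have "kdelta k f g \<le> e" if f: "unit_kernel f" and g: "unit_kernel g" and eq: "sig f = sig g" for f g
  proof -
    have Feq: "\<bar>F f i a b - F g i a b\<bar> \<le> \<eta>" if "i \<in> {1..k}" "a < N" "b < N" for i a b
    proof (rule abs_diff_le_floor[OF \<eta>])
      have "fst (sig f) (i, a, b) = fst (sig g) (i, a, b)" using eq by simp
      then show "\<lfloor>F f i a b / \<eta>\<rfloor> = \<lfloor>F g i a b / \<eta>\<rfloor>" using that by (simp add: sig_def)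
    qed
    have seq: "\<bar>s f j - s g j\<bar> \<le> \<eta>" if "j < N" for j
    proof (rule abs_diff_le_floor[OF \<eta>])
      have "snd (sig f) j = snd (sig g) j" using eq by simp
      then show "\<lfloor>s f j / \<eta>\<rfloor> = \<lfloor>s g j / \<eta>\<rfloor>" using that by (simp add: sig_def)
    qed
    have "cut_norm k (kdiff (step (F f) (A f)) (step (F g) (A g))) \<le> e / 3"
      using cut_norm_level_steps[of N \<eta> "s f" "s g" k "F f" "F g", OF N less_imp_le[OF \<eta>] seq Feq F01[OF f] F01[OF g]] \<eta>k
      by (simp add: A_def)
    then have mid: "kdelta k (step (F f) (A f)) (step (F g) (A g)) \<le> e / 3"
      using kdelta_le_cut_norm[OF bA[of f f] bA[of g g], of k] by simp
    note fb = unit_kernel_bounded[OF f] and gb = unit_kernel_bounded[OF g]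
    \<comment> \<open>Symmetry of \<open>kdelta\<close> enters here, because \<open>close\<close>
      has the kernel on the left and twists the step kernel.\<close>
    have "kdelta k (step (F g) (A g)) g \<le> e / 3"
      using close[OF g] kdelta_commute[OF gb bA[of g g], of k] by simp
    then show ?thesis
      using close[OF f] mid kdelta_triangle[OF fb bA[of f f] gb, of k]
        kdelta_triangle[OF bA[of f f] bA[of g g] gb, of k] by linarith
  qed
  ultimately show ?thesis
    by (intro exI[of _ ?K] exI[of _ sig]) blast
qed

section \<open>Limits in the cut norm\<close>

definition set_int :: "(real \<times> real \<Rightarrow> real) \<Rightarrow> (real \<times> real) set \<Rightarrow> real" where
  "set_int g E = (LINT p|unit_square. indicator E p * g p)"

definition unit_function :: "(real \<times> real \<Rightarrow> real) \<Rightarrow> bool" where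
  "unit_function g \<longleftrightarrow> g \<in> borel_measurable unit_square \<and> (\<forall>p\<in>{0..1} \<times> {0..1}. g p \<in> {0..1})"

lemma unit_function_integrable: "unit_function g \<Longrightarrow> integrable unit_square g"
  unfolding unit_function_def
  by (intro Q.integrable_const_bound[where B=1] AE_I2) auto

lemma integrable_set_int:
  fixes g :: "real \<times> real \<Rightarrow> real"
  assumes "integrable unit_square g" "E \<in> sets unit_square"
  shows "integrable unit_square (\<lambda>p. indicator E p * g p)"
  using integrable_mult_indicator[OF assms(2,1)] by simp

lemma set_int_bounds:
  assumes g: "unit_function g" and E: "E \<in> sets unit_square"
  shows "0 \<le> set_int g E" "set_int g E \<le> measure unit_square E"
proof -
  have v: "g p \<in> {0..1}" if "p \<in> space unit_square" for p
    using g that unfolding unit_function_def by (metis space_unit_square)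
  show "0 \<le> set_int g E"
    unfolding set_int_def
    by (rule Bochner_Integration.integral_nonneg_AE, rule AE_I2) (use v in \<open>auto simp: indicator_def\<close>)
  have "set_int g E \<le> (LINT p|unit_square. indicator E p)"
    unfolding set_int_def
  proof (rule integral_mono)
    show "integrable unit_square (indicator E :: _ \<Rightarrow> real)"
      using E by (intro integrable_real_indicator) (auto simp: Q.emeasure_eq_measure)
    show "indicator E p * g p \<le> indicator E p" if "p \<in> space unit_square" for p
      using v[OF that] by (simp add: indicator_def)
  qed (intro integrable_set_int unit_function_integrable g E)
  also have "\<dots> = measure unit_square E"
    using sets.sets_into_space[OF E] by (simp add: Int_absorb2)
  finally show "set_int g E \<le> measure unit_square E" .
qed

text \<open>The measures of the \<open>A j\<close> are a summable bound that is uniform in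
  \<open>n\<close>, so limit and sum may be exchanged. This serves both the closure of convergence
  under disjoint unions and the countable additivity of the limit.\<close>

lemma set_int_UN_limit:
  fixes A :: "nat \<Rightarrow> (real \<times> real) set"
  assumes g: "\<And>n :: nat. unit_function (g n)" and A: "\<And>j. A j \<in> sets unit_square" and disj: "disjoint_family A"
    and conv: "\<And>j. convergent (\<lambda>n. set_int (g n) (A j))"
  shows "summable (\<lambda>j. lim (\<lambda>n. set_int (g n) (A j)))"
    "(\<lambda>n. set_int (g n) (\<Union>j. A j)) \<longlonglongrightarrow> (\<Sum>j. lim (\<lambda>n. set_int (g n) (A j)))"
proof -
  have UN: "(\<Union>j. A j) \<in> sets unit_square" using A by auto
  have split: "set_int (g n) (\<Union>j. A j) = (\<Sum>j. set_int (g n) (A j))" for n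
  proof -
    have "(LINT p:(\<Union>j. A j)|unit_square. g n p) = (\<Sum>j. LINT p:A j|unit_square. g n p)"
    proof (rule lebesgue_integral_countable_add[OF A])
      show "A i \<inter> A j = {}" if "i \<noteq> j" for i j
        using disj that by (auto simp: disjoint_family_on_def)
      show "set_integrable unit_square (\<Union>j. A j) (g n)"
        unfolding set_integrable_def
        by (intro integrable_mult_indicator[OF UN] unit_function_integrable g)
    qed
    then show ?thesis by (simp add: set_lebesgue_integral_def set_int_def)
  qed
  have "summable (\<lambda>j. measure unit_square (A j))"
    using Q.finite_measure_UNION[of A] A disj by (auto simp: sums_iff)
  note tannery = tannerys_theorem[of "\<lambda>j n. set_int (g n) (A j)" "\<lambda>j. lim (\<lambda>n. set_int (g n) (A j))" sequentially,
      OF _ _ this]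
  have lims: "(\<lambda>n. set_int (g n) (A j)) \<longlonglongrightarrow> lim (\<lambda>n. set_int (g n) (A j))" for j
    using conv[of j] by (simp add: convergent_LIMSEQ_iff)
  have bound: "\<forall>\<^sub>F (j, n) in at_top \<times>\<^sub>F sequentially. norm (set_int (g n) (A j)) \<le> measure unit_square (A j)"
    by (rule always_eventually) (auto simp: abs_le_iff intro: order_trans[OF _ set_int_bounds(2)] set_int_bounds(2)[OF g A] order_trans[OF _ set_int_bounds(1)[OF g A]] simp: set_int_bounds(1)[OF g A])
  have "summable (\<lambda>j. norm (lim (\<lambda>n. set_int (g n) (A j))))"
    and lim: "(\<lambda>n. \<Sum>j. set_int (g n) (A j)) \<longlonglongrightarrow> (\<Sum>j. lim (\<lambda>n. set_int (g n) (A j)))"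
    using tannery[OF lims bound trivial_limit_sequentially] by simp_all
  then show "summable (\<lambda>j. lim (\<lambda>n. set_int (g n) (A j)))"
    by (auto intro: summable_norm_cancel)
  show "(\<lambda>n. set_int (g n) (\<Union>j. A j)) \<longlonglongrightarrow> (\<Sum>j. lim (\<lambda>n. set_int (g n) (A j)))"
    unfolding split by (rule lim)
qed

lemma set_int_cong_AE:
  assumes "AE p in unit_square. p \<in> E \<longleftrightarrow> p \<in> F" "E \<in> sets unit_square" "F \<in> sets unit_square"
    "g \<in> borel_measurable unit_square"
  shows "set_int g E = set_int g F"
  unfolding set_int_def
proof (rule integral_cong_AE)
  show "AE p in unit_square. indicator E p * g p = indicator F p * g p"
    using assms(1) by eventually_elim (simp add: indicator_def)
qed (use assms in measurable)

lemma rect_int_set_int: "rect_int g S T = set_int g (S \<times> T)"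
  by (simp add: rect_int_def set_int_def)

lemma borel_Int_square: "E \<in> sets borel \<Longrightarrow> E \<inter> ({0..1} \<times> {0..1}) \<in> sets unit_square"
  by (auto simp: sets_restrict_space_iff)

text \<open>The sets on which the integrals converge form a Dynkin system.\<close>

lemma set_int_convergent:
  assumes g: "\<And>n :: nat. unit_function (g n)"
    and conv: "\<And>S T. S \<in> sets unit_interval \<Longrightarrow> T \<in> sets unit_interval \<Longrightarrow> convergent (\<lambda>n. rect_int (g n) S T)"
    and E: "E \<in> sets unit_square"
  shows "convergent (\<lambda>n. set_int (g n) E)"
proof -
  let ?sq = "{0..1} \<times> {0..1} :: (real \<times> real) set"
  let ?P = "\<lambda>E. convergent (\<lambda>n. set_int (g n) (E \<inter> ?sq))"
  let ?G = "{a \<times> b | a b. a \<in> sets (borel :: real measure) \<and> b \<in> sets (borel :: real measure)}"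
  have gm: "g n \<in> borel_measurable unit_square" for n using g by (simp add: unit_function_def)
  have sets: "sets (borel :: (real \<times> real) measure) = sigma_sets UNIV ?G"
    unfolding borel_prod[symmetric] sets_pair_measure by simp
  have rect: "convergent (\<lambda>n. set_int (g n) ((A \<times> B) \<inter> ?sq))" if "A \<in> sets borel" "B \<in> sets borel" for A B
  proof -
    have "(A \<times> B) \<inter> ?sq = ({0..1} \<inter> A) \<times> ({0..1} \<inter> B)" by auto
    then show ?thesis
      using conv[OF borel_imp_unit_interval[OF that(1)] borel_imp_unit_interval[OF that(2)]]
      by (simp only: rect_int_set_int)
  qed
  have borel: "?P B" if "B \<in> sets borel" for B
  proof -
    have st: "Int_stable ?G" using Int_stable_pair_measure_generator[of "borel :: real measure" "borel :: real measure"] by simp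
    have B: "B \<in> sigma_sets UNIV ?G" using that sets by simp
    have cl: "?G \<subseteq> Pow UNIV" by simp
    show ?thesis
      using st cl B
    proof (induction rule: sigma_sets_induct_disjoint)
      case (basic A)
      then show ?case using rect by blast
    next
      case empty
      then show ?case by (simp add: set_int_def convergent_const)
    next
      case (compl A)
      then have A: "A \<inter> ?sq \<in> sets unit_square" using sets by (intro borel_Int_square) simp
      \<comment> \<open>The whole square is itself a rectangle, so convergence on it takes care of
        complements.\<close>
      have "set_int (g n) ((UNIV - A) \<inter> ?sq) = set_int (g n) ((UNIV \<times> UNIV) \<inter> ?sq) - set_int (g n) (A \<inter> ?sq)" for n
      proof -
        have "set_int (g n) ((UNIV \<times> UNIV) \<inter> ?sq) - set_int (g n) (A \<inter> ?sq)
          = (LINT p|unit_square. indicator ((UNIV \<times> UNIV) \<inter> ?sq) p * g n p - indicator (A \<inter> ?sq) p * g n p)"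
          unfolding set_int_def
          by (intro Bochner_Integration.integral_diff[symmetric] integrable_set_int unit_function_integrable g A borel_Int_square) simp
        also have "\<dots> = set_int (g n) ((UNIV - A) \<inter> ?sq)"
          unfolding set_int_def
          by (intro Bochner_Integration.integral_cong refl) (auto simp: indicator_def)
        finally show ?thesis ..
      qed
      then show ?case
        using convergent_diff[OF rect[of UNIV UNIV] compl(2)] by simp
    next
      case (union A)
      have "(\<lambda>n. set_int (g n) (\<Union>j. A j \<inter> ?sq)) \<longlonglongrightarrow> (\<Sum>j. lim (\<lambda>n. set_int (g n) (A j \<inter> ?sq)))"
      proof (rule set_int_UN_limit(2)[OF g _ _ union(3)])
        show "A j \<inter> ?sq \<in> sets unit_square" for j
          using union(2) sets by (intro borel_Int_square) auto
        show "disjoint_family (\<lambda>j. A j \<inter> ?sq)"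
          using union(1) by (auto simp: disjoint_family_on_def)
      qed
      moreover have "(\<Union>j. A j \<inter> ?sq) = (\<Union>j. A j) \<inter> ?sq" by blast
      ultimately show ?case by (auto simp: convergent_def)
    qed
  qed
  \<comment> \<open>From Borel to Lebesgue sets: \<open>E\<close> agrees almost everywhere with a
    Borel set, which leaves all integrals unchanged.\<close>
  have "E \<in> sets lebesgue" "E \<subseteq> ?sq" using E by (auto simp: sets_restrict_space_iff)
  then obtain B N N' where B: "E = B \<union> N" "N \<subseteq> N'" "N' \<in> null_sets lborel" "B \<in> sets lborel"
    using sets_completionE by metis
  have "AE p in lborel. p \<notin> N'" by (rule AE_not_in[OF B(3)])
  then have "AE p in lebesgue. p \<notin> N'" by (rule AE_completion)
  then have "AE p in unit_square. p \<notin> N'"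
    by (subst AE_restrict_space_iff) (simp, rule eventually_mono, auto)
  then have AE: "AE p in unit_square. p \<in> E \<longleftrightarrow> p \<in> B \<inter> ?sq"
    using AE_space by eventually_elim (use B(1,2) in auto)
  have "set_int (g n) E = set_int (g n) (B \<inter> ?sq)" for n
    by (rule set_int_cong_AE[OF AE E borel_Int_square gm]) (use B in simp)
  then show ?thesis using borel[of B] B(4) by simp
qed

text \<open>Each \<open>set_int (g n)\<close> lies between 0 and the area, hence so does the limit,
  which yields absolute continuity. The density obtained is \<open>ennreal\<close>-valued; its
  finiteness is recovered later from the sum over the colours.\<close>

lemma exists_limit_density:
  assumes g: "\<And>n :: nat. unit_function (g n)"
    and conv: "\<And>S T. S \<in> sets unit_interval \<Longrightarrow> T \<in> sets unit_interval \<Longrightarrow> convergent (\<lambda>n. rect_int (g n) S T)"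
  shows "\<exists>f :: real \<times> real \<Rightarrow> ennreal. f \<in> borel_measurable unit_square \<and>
    (\<forall>E\<in>sets unit_square. (\<integral>\<^sup>+p. f p * indicator E p \<partial>unit_square) = ennreal (lim (\<lambda>n. set_int (g n) E)))"
proof -
  let ?L = "\<lambda>E. lim (\<lambda>n. set_int (g n) E)"
  have cv: "convergent (\<lambda>n. set_int (g n) E)" if "E \<in> sets unit_square" for E
    by (rule set_int_convergent[of g]) (use g conv that in blast)+
  have L: "(\<lambda>n. set_int (g n) E) \<longlonglongrightarrow> ?L E" if "E \<in> sets unit_square" for E
    using cv[OF that] by (simp add: convergent_LIMSEQ_iff)
  have L_nonneg: "0 \<le> ?L E" if "E \<in> sets unit_square" for E
    by (rule LIMSEQ_le_const[OF L[OF that]]) (use set_int_bounds(1)[OF g that] in auto)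
  have L_le: "?L E \<le> measure unit_square E" if "E \<in> sets unit_square" for E
    by (rule LIMSEQ_le_const2[OF L[OF that]]) (use set_int_bounds(2)[OF g that] in auto)
  define N where "N = measure_of (space unit_square) (sets unit_square) (\<lambda>E. ennreal (?L E))"
  have sets_N: "sets N = sets unit_square" unfolding N_def by (rule sets.sets_measure_of_eq)
  have emeasure_N: "emeasure N E = ennreal (?L E)" if "E \<in> sets unit_square" for E
  proof (rule emeasure_measure_of[OF N_def])
    show "sets unit_square \<subseteq> Pow (space unit_square)" by (rule sets.space_closed)
    show "positive (sets N) (\<lambda>E. ennreal (?L E))"
      unfolding positive_def by (simp add: set_int_def)
    show "countably_additive (sets N) (\<lambda>E. ennreal (?L E))"
      unfolding sets_N
    proof (rule countably_additiveI)
      fix A :: "nat \<Rightarrow> (real \<times> real) set"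
      assume A: "range A \<subseteq> sets unit_square" "disjoint_family A" "(\<Union>i. A i) \<in> sets unit_square"
      have Aj: "A j \<in> sets unit_square" for j using A(1) by auto
      note lim = set_int_UN_limit[OF g Aj A(2) cv[OF Aj]]
      have "(\<Sum>i. ennreal (?L (A i))) = ennreal (\<Sum>i. ?L (A i))"
        by (intro suminf_ennreal2 L_nonneg Aj lim(1))
      also have "(\<Sum>i. ?L (A i)) = ?L (\<Union>i. A i)"
        using LIMSEQ_unique[OF lim(2) L[OF A(3)]] .
      finally show "(\<Sum>i. ennreal (?L (A i))) = ennreal (?L (\<Union>i. A i))" .
    qed
    show "E \<in> sets N" using that sets_N by simp
  qed
  have "absolutely_continuous unit_square N"
    unfolding absolutely_continuous_def
  proof
    fix E assume "E \<in> null_sets unit_square"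
    then have E: "E \<in> sets unit_square" "measure unit_square E = 0" by (auto simp: null_sets_def measure_def)
    then have "?L E = 0" using L_nonneg[OF E(1)] L_le[OF E(1)] by simp
    then show "E \<in> null_sets N" using emeasure_N[OF E(1)] E(1) sets_N by (auto intro: null_setsI)
  qed
  from Q.Radon_Nikodym[OF this sets_N] obtain f where f: "f \<in> borel_measurable unit_square" "density unit_square f = N"
    by blast
  have "(\<integral>\<^sup>+p. f p * indicator E p \<partial>unit_square) = ennreal (?L E)" if "E \<in> sets unit_square" for E
    using emeasure_density[OF f(1) that] emeasure_N[OF that] f(2) by simp
  then show ?thesis using f(1) by blast
qed

section \<open>Graphons as families of mass functions\<close>

text \<open>The real-valued picture of a graphon. Limits are formed here, and
  \<open>exists_graphon_of_prob_kernel\<close> returns to measures.\<close>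

definition prob_kernel :: "nat \<Rightarrow> kernel \<Rightarrow> bool" where
  "prob_kernel k f \<longleftrightarrow> unit_kernel f \<and> (\<forall>p\<in>{0..1} \<times> {0..1}. (\<Sum>i = 1..k. f i p) = 1) \<and>
    (\<forall>i. \<forall>p\<in>{0..1} \<times> {0..1}. f i (prod.swap p) = f i p)"

lemma prob_kernel_twist:
  assumes f: "prob_kernel k f" and \<phi>: "\<phi> \<in> mp_maps"
  shows "prob_kernel k (twist f \<phi>)"
proof -
  have u: "unit_kernel f" using f by (simp add: prob_kernel_def)
  have m: "twist f \<phi> i \<in> borel_measurable unit_square" for i
    by (rule bounded_kernelD[OF bounded_kernel_twist[OF unit_kernel_bounded[OF u] \<phi>]])
  have sw: "square_map \<phi> (prod.swap p) = prod.swap (square_map \<phi> p)" for p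
    by (cases p) (simp add: square_map_def)
  show ?thesis
    unfolding prob_kernel_def unit_kernel_def
  proof (intro conjI allI ballI m)
    fix p :: "real \<times> real" and i assume "p \<in> {0..1} \<times> {0..1}"
    note in_square = square_map_in[OF \<phi> this]
    have "\<forall>p\<in>{0..1} \<times> {0..1}. f i p \<in> {0..1}" "\<forall>p\<in>{0..1} \<times> {0..1}. (\<Sum>i = 1..k. f i p) = 1"
      "\<forall>p\<in>{0..1} \<times> {0..1}. f i (prod.swap p) = f i p"
      using f unfolding prob_kernel_def unit_kernel_def by metis+
    note this[THEN bspec, OF in_square]
    then show "twist f \<phi> i p \<in> {0..1}" "(\<Sum>i = 1..k. twist f \<phi> i p) = 1"
      "twist f \<phi> i (prod.swap p) = twist f \<phi> i p"
      unfolding twist_def sw .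
  qed
qed

text \<open>The singleton \<open>{i}\<close> is then outside the sigma-algebra of
  \<open>W p\<close>, where \<open>measure\<close> is 0 by convention.\<close>

lemma graphon_mass_outside: "W \<in> graphons k \<Longrightarrow> p \<in> {0..1} \<times> {0..1} \<Longrightarrow> i \<notin> {1..k} \<Longrightarrow> mass W i p = 0"
proof -
  assume W: "W \<in> graphons k" and p: "p \<in> {0..1} \<times> {0..1}" and i: "i \<notin> {1..k}"
  have "W p \<in> space (prob_algebra (count_space {1..k}))"
    using W p measurable_space[of W unit_square "prob_algebra (count_space {1..k})" p] by (simp add: graphons_def)
  then have "sets (W p) = Pow {1..k}"
    by (simp add: space_prob_algebra)
  then show "mass W i p = 0"
    using i unfolding mass_def by (intro measure_notin_sets) auto
qed

lemma prob_kernel_mass: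
  assumes W: "W \<in> graphons k" shows "prob_kernel k (mass W)"
proof -
  have meas: "W \<in> unit_square \<rightarrow>\<^sub>M prob_algebra (count_space {1..k})"
    and sym: "\<And>x y. x \<in> {0..1} \<Longrightarrow> y \<in> {0..1} \<Longrightarrow> W (x, y) = W (y, x)"
    using W by (auto simp: graphons_def)
  have sp: "prob_space (W p)" "sets (W p) = Pow {1..k}" "space (W p) = {1..k}" if "p \<in> {0..1} \<times> {0..1}" for p
  proof -
    have "W p \<in> space (prob_algebra (count_space {1..k}))"
      using measurable_space[OF meas, of p] that by simp
    then show "prob_space (W p)" "sets (W p) = Pow {1..k}"
      by (simp_all add: space_prob_algebra)
    then show "space (W p) = {1..k}" using sets_eq_imp_space_eq[of "W p" "count_space {1..k}"] by simp
  qed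
  have m: "mass W i \<in> borel_measurable unit_square" for i
  proof (cases "i \<in> {1..k}")
    case True
    have "(\<lambda>M. measure M {i}) \<in> borel_measurable (prob_algebra (count_space {1..k}))"
      unfolding prob_algebra_def
      by (intro measurable_restrict_space1 measurable_measure_subprob_algebra) (use True in auto)
    from measurable_compose[OF meas this] show ?thesis by (simp add: mass_def[abs_def])
  next
    case False
    have "(\<lambda>p. 0 :: real) \<in> borel_measurable unit_square" by simp
    then show ?thesis
      using graphon_mass_outside[OF W _ False] by (subst measurable_cong[of _ _ "\<lambda>_. 0"]) auto
  qed
  have 01: "mass W i p \<in> {0..1}" if "p \<in> {0..1} \<times> {0..1}" for i p
    using prob_space.prob_le_1[OF sp(1)[OF that]] by (simp add: mass_def)
  have sum: "(\<Sum>i = 1..k. mass W i p) = 1" if p: "p \<in> {0..1} \<times> {0..1}" for p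
  proof -
    interpret prob_space "W p" by (rule sp[OF p])
    have "(\<Sum>i = 1..k. mass W i p) = prob {1..k}"
      unfolding mass_def using sp(2)[OF p] by (intro finite_measure_eq_sum_singleton[symmetric]) auto
    then show ?thesis using prob_space sp(3)[OF p] by simp
  qed
  have sw: "mass W i (prod.swap p) = mass W i p" if "p \<in> {0..1} \<times> {0..1}" for i p
    using that sym by (auto simp: mass_def)
  show ?thesis unfolding prob_kernel_def unit_kernel_def using m 01 sum sw by blast
qed

lemma exists_graphon_of_prob_kernel:
  assumes f: "prob_kernel k f"
  shows "\<exists>W\<in>graphons k. \<forall>i\<in>{1..k}. \<forall>p\<in>{0..1} \<times> {0..1}. mass W i p = f i p"
proof -
  have u: "unit_kernel f" and sum: "\<And>p. p \<in> {0..1} \<times> {0..1} \<Longrightarrow> (\<Sum>i = 1..k. f i p) = 1"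
    and sw: "\<And>i p. p \<in> {0..1} \<times> {0..1} \<Longrightarrow> f i (prod.swap p) = f i p"
    using f by (auto simp: prob_kernel_def)
  have nn: "0 \<le> f i p" if "p \<in> {0..1} \<times> {0..1}" for i p
    using u that unfolding unit_kernel_def by (metis atLeastAtMost_iff)
  define W where "W p = point_measure {1..k} (\<lambda>i. ennreal (f i p))" for p
  have em: "emeasure (W p) A = ennreal (\<Sum>i\<in>A. f i p)" if "p \<in> {0..1} \<times> {0..1}" "A \<subseteq> {1..k}" for p A
    using that nn by (simp add: W_def emeasure_point_measure_finite sum_ennreal)
  have sets: "sets (W p) = sets (count_space {1..k})" for p
    by (simp add: W_def sets_point_measure)
  have prob: "prob_space (W p)" if "p \<in> {0..1} \<times> {0..1}" for p
    using em[OF that, of "{1..k}"] sum[OF that]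
    by (intro prob_spaceI) (simp add: W_def space_point_measure)
  have "W \<in> unit_square \<rightarrow>\<^sub>M prob_algebra (count_space {1..k})"
  proof (rule measurable_prob_algebraI)
    show "prob_space (W p)" if "p \<in> space unit_square" for p using prob that by simp
    show "W \<in> unit_square \<rightarrow>\<^sub>M subprob_algebra (count_space {1..k})"
    proof (rule measurable_subprob_algebra)
      show "subprob_space (W p)" if "p \<in> space unit_square" for p
        using prob that by (simp add: prob_space_imp_subprob_space)
      show "sets (W p) = sets (count_space {1..k})" for p by (rule sets)
      fix A assume "A \<in> sets (count_space {1..k})"
      then have A: "A \<subseteq> {1..k}" by simp
      have "(\<lambda>p. ennreal (\<Sum>i\<in>A. f i p)) \<in> borel_measurable unit_square"
        using u unfolding unit_kernel_def by (intro measurable_compose[OF borel_measurable_sum measurable_ennreal]) blast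
      then show "(\<lambda>p. emeasure (W p) A) \<in> borel_measurable unit_square"
        by (subst measurable_cong[of _ _ "\<lambda>p. ennreal (\<Sum>i\<in>A. f i p)"]) (simp_all only: em A space_unit_square)
    qed
  qed
  moreover have "W (x, y) = W (y, x)" if "x \<in> {0..1}" "y \<in> {0..1}" for x y
    using sw[of "(y, x)"] that by (simp add: W_def)
  ultimately have "W \<in> graphons k" by (simp add: graphons_def)
  moreover have "mass W i p = f i p" if "i \<in> {1..k}" "p \<in> {0..1} \<times> {0..1}" for i p
    using em[OF that(2), of "{i}"] that nn[OF that(2), of i] by (simp add: mass_def measure_def)
  ultimately show ?thesis by blast
qed

lemma rect_int_swap:
  assumes g: "g \<in> borel_measurable unit_square" and S: "S \<in> sets unit_interval" "T \<in> sets unit_interval"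
  shows "rect_int (\<lambda>p. g (prod.swap p)) S T = rect_int g T S"
proof -
  have "rect_int (\<lambda>p. g (prod.swap p)) S T
    = (LINT p|unit_square. (\<lambda>p. indicator (T \<times> S) p * g p) (prod.swap p))"
    unfolding rect_int_def
    by (intro Bochner_Integration.integral_cong refl) (auto simp: indicator_def)
  also have "\<dots> = (LINT p|distr unit_square unit_square prod.swap. indicator (T \<times> S) p * g p)"
    using g Times_in_square[OF S(2,1)]
    by (intro integral_distr[symmetric] swap_mp borel_measurable_times borel_measurable_indicator)
  finally show ?thesis unfolding swap_mp(2) by (simp add: rect_int_def)
qed

lemma rect_int_cong_AE:
  assumes "AE p in unit_square. g p = h p" "g \<in> borel_measurable unit_square" "h \<in> borel_measurable unit_square"
    "S \<in> sets unit_interval" "T \<in> sets unit_interval"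
  shows "rect_int g S T = rect_int h S T"
  unfolding rect_int_def
proof (rule integral_cong_AE)
  show "AE p in unit_square. indicator (S \<times> T) p * g p = indicator (S \<times> T) p * h p"
    using assms(1) by eventually_elim simp
qed (use assms Times_in_square[OF assms(4,5)] in measurable)

text \<open>The densities of the limit measures have total 1 only almost everywhere and need not be
  symmetric, whereas a graphon satisfies both conditions on the whole square. They are averaged with
  their mirror images and then redefined on a null set.\<close>

lemma limit_prob_kernel:
  assumes v: "\<And>n :: nat. prob_kernel k (v n)" and k: "1 \<le> k"
    and conv: "\<And>i S T. i \<in> {1..k} \<Longrightarrow> S \<in> sets unit_interval \<Longrightarrow> T \<in> sets unit_interval \<Longrightarrow>
      convergent (\<lambda>n. rect_int (v n i) S T)"
  shows "\<exists>w. prob_kernel k w \<and> (\<forall>i\<in>{1..k}. \<forall>S\<in>sets unit_interval. \<forall>T\<in>sets unit_interval.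
    (\<lambda>n. rect_int (v n i) S T) \<longlonglongrightarrow> rect_int (w i) S T)"
proof -
  let ?L = "\<lambda>i E. lim (\<lambda>n. set_int (v n i) E)"
  have uf: "unit_function (v n i)" for n i
    using v[of n] by (simp add: prob_kernel_def unit_kernel_def unit_function_def)
  have vsum: "(\<Sum>i = 1..k. v n i p) = 1" if "p \<in> {0..1} \<times> {0..1}" for n p
    using v[of n] that unfolding prob_kernel_def by blast
  have vsw: "v n i (prod.swap p) = v n i p" if "p \<in> {0..1} \<times> {0..1}" for n i p
    using v[of n] that unfolding prob_kernel_def by blast
  have L: "(\<lambda>n. set_int (v n i) E) \<longlonglongrightarrow> ?L i E" if "i \<in> {1..k}" "E \<in> sets unit_square" for i E
  proof -
    have "convergent (\<lambda>n. set_int (v n i) E)"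
      using uf conv[OF that(1)] that(2) by (rule set_int_convergent)
    then show ?thesis unfolding convergent_LIMSEQ_iff .
  qed
  have L_nonneg: "0 \<le> ?L i E" if "i \<in> {1..k}" "E \<in> sets unit_square" for i E
    by (rule LIMSEQ_le_const[OF L[OF that]]) (use set_int_bounds(1)[OF uf that(2)] in auto)
  have L_sum: "(\<Sum>i = 1..k. ?L i E) = measure unit_square E" if E: "E \<in> sets unit_square" for E
  proof -
    have "(\<Sum>i = 1..k. set_int (v n i) E) = measure unit_square E" for n
    proof -
      have "(\<Sum>i = 1..k. set_int (v n i) E) = (LINT p|unit_square. (\<Sum>i = 1..k. indicator E p * v n i p))"
        unfolding set_int_def
        by (intro Bochner_Integration.integral_sum[symmetric] integrable_set_int unit_function_integrable uf E)
      also have "\<dots> = (LINT p|unit_square. indicator E p)"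
        by (intro Bochner_Integration.integral_cong refl)
          (simp only: sum_distrib_left[symmetric] vsum space_unit_square mult_1_right)
      finally show ?thesis using sets.sets_into_space[OF E] by (simp add: Int_absorb2)
    qed
    then have "(\<lambda>n. measure unit_square E) \<longlonglongrightarrow> (\<Sum>i = 1..k. ?L i E)"
      using tendsto_sum[of "{1..k}" "\<lambda>i n. set_int (v n i) E" "\<lambda>i. ?L i E" sequentially] L[OF _ E] by simp
    then show ?thesis by (simp add: LIMSEQ_const_iff)
  qed
  have "\<forall>i. \<exists>f :: real \<times> real \<Rightarrow> ennreal. i \<in> {1..k} \<longrightarrow> f \<in> borel_measurable unit_square \<and>
      (\<forall>E\<in>sets unit_square. (\<integral>\<^sup>+p. f p * indicator E p \<partial>unit_square) = ennreal (?L i E))"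
    using exists_limit_density[of "\<lambda>n. v n _", OF uf conv] by blast
  then obtain f :: "nat \<Rightarrow> real \<times> real \<Rightarrow> ennreal" where
    f: "\<And>i. i \<in> {1..k} \<Longrightarrow> f i \<in> borel_measurable unit_square"
      "\<And>i E. i \<in> {1..k} \<Longrightarrow> E \<in> sets unit_square \<Longrightarrow> (\<integral>\<^sup>+p. f i p * indicator E p \<partial>unit_square) = ennreal (?L i E)"
    by (rule choice[THEN exE]) blast
  \<comment> \<open>The limit measures of the colours add up to area because those of each
    \<open>v n\<close> do; uniqueness of densities then gives total density 1.\<close>
  have "density unit_square (\<lambda>p. \<Sum>i = 1..k. f i p) = density unit_square (\<lambda>p. 1)"
  proof (rule measure_eqI)
    fix E assume "E \<in> sets (density unit_square (\<lambda>p. \<Sum>i = 1..k. f i p))"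
    then have E: "E \<in> sets unit_square" by simp
    have "emeasure (density unit_square (\<lambda>p. \<Sum>i = 1..k. f i p)) E
        = (\<integral>\<^sup>+p. (\<Sum>i = 1..k. f i p * indicator E p) \<partial>unit_square)"
      using f(1) E by (subst emeasure_density) (auto simp: sum_distrib_right)
    also have "\<dots> = (\<Sum>i = 1..k. ennreal (?L i E))"
      using f E by (subst nn_integral_sum) auto
    also have "\<dots> = ennreal (measure unit_square E)"
      using L_nonneg[OF _ E] by (subst sum_ennreal) (simp_all only: L_sum[OF E])
    also have "\<dots> = emeasure (density unit_square (\<lambda>p. 1)) E"
      using E by (simp add: density_1 Q.emeasure_eq_measure)
    finally show "emeasure (density unit_square (\<lambda>p. \<Sum>i = 1..k. f i p)) E = emeasure (density unit_square (\<lambda>p. 1)) E" .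
  qed simp
  then have AE1: "AE p in unit_square. (\<Sum>i = 1..k. f i p) = 1"
    using f(1) by (subst (asm) Q.density_unique_iff) auto
  \<comment> \<open>Passing to real values loses nothing almost everywhere, since a nonnegative
    summand of 1 is finite.\<close>
  define h where "h i p = (if i \<in> {1..k} then enn2real (f i p) else 0)" for i p
  have hm: "h i \<in> borel_measurable unit_square" for i
    unfolding h_def[abs_def] using f(1)[of i] by (cases "i \<in> {1..k}") auto
  have h_nonneg: "0 \<le> h i p" for i p by (simp add: h_def)
  have fh: "AE p in unit_square. \<forall>i\<in>{1..k}. f i p = ennreal (h i p)"
    using AE1
  proof eventually_elim
    case (elim p)
    show ?case
    proof
      fix i assume i: "i \<in> {1..k}"
      have "f i p \<le> (\<Sum>i = 1..k. f i p)" using i by (intro member_le_sum) auto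
      then have "f i p < top" using elim by (auto intro: le_less_trans)
      then show "f i p = ennreal (h i p)" using i by (simp add: h_def)
    qed
  qed
  have AEh: "AE p in unit_square. (\<Sum>i = 1..k. h i p) = 1"
    using AE1 fh
  proof eventually_elim
    case (elim p)
    have "ennreal (\<Sum>i = 1..k. h i p) = (\<Sum>i = 1..k. ennreal (h i p))"
      by (rule sum_ennreal[symmetric]) (rule h_nonneg)
    also have "\<dots> = (\<Sum>i = 1..k. f i p)"
      by (rule sum.cong[OF refl]) (use elim(2) in simp)
    also have "\<dots> = 1" by (rule elim(1))
    finally show ?case by simp
  qed
  have h_int: "set_int (h i) E = ?L i E" if i: "i \<in> {1..k}" and E: "E \<in> sets unit_square" for i E
  proof -
    have "set_int (h i) E = enn2real (\<integral>\<^sup>+p. ennreal (indicator E p * h i p) \<partial>unit_square)"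
      unfolding set_int_def using hm E h_nonneg by (intro integral_eq_nn_integral) auto
    also have "(\<integral>\<^sup>+p. ennreal (indicator E p * h i p) \<partial>unit_square) = (\<integral>\<^sup>+p. f i p * indicator E p \<partial>unit_square)"
    proof (rule nn_integral_cong_AE)
      show "AE p in unit_square. ennreal (indicator E p * h i p) = f i p * indicator E p"
        using fh by eventually_elim (use i in \<open>auto simp: indicator_def\<close>)
    qed
    finally show ?thesis using f(2)[OF i E] L_nonneg[OF i E] by simp
  qed
  define s where "s i p = (h i p + h i (prod.swap p)) / 2" for i p
  have hsm: "(\<lambda>p. h i (prod.swap p)) \<in> borel_measurable unit_square" for i
    by (rule measurable_compose[OF swap_mp(1) hm])
  have sm: "s i \<in> borel_measurable unit_square" for i
    unfolding s_def[abs_def] using hm[of i] hsm[of i] by measurable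
  have "AE p in distr unit_square unit_square prod.swap. (\<Sum>i = 1..k. h i p) = 1"
    unfolding swap_mp(2) by (rule AEh)
  then have "AE p in unit_square. (\<Sum>i = 1..k. h i (prod.swap p)) = 1"
    by (rule AE_distrD[OF swap_mp(1)])
  with AEh have AEs: "AE p in unit_square. (\<Sum>i = 1..k. s i p) = 1"
  proof eventually_elim
    case (elim p)
    then show ?case by (simp only: s_def sum_divide_distrib[symmetric] sum.distrib) simp
  qed
  \<comment> \<open>On the exceptional null set all mass goes to colour 1, which exists because
    \<open>1 \<le> k\<close>. That set is invariant under \<open>prod.swap\<close> since
    \<open>s\<close> is symmetric, so \<open>w\<close> stays symmetric.\<close>
  define w where "w i p = (if (\<Sum>i = 1..k. s i p) = 1 then (if i \<in> {1..k} then s i p else 0)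
    else if i = 1 then 1 else 0)" for i p
  have s_nonneg: "0 \<le> s i p" for i p by (simp add: s_def h_nonneg)
  have wsum: "(\<Sum>i = 1..k. w i p) = 1" for p
  proof (cases "(\<Sum>i = 1..k. s i p) = 1")
    case True
    then show ?thesis by (simp add: w_def)
  next
    case False
    then have "(\<Sum>i = 1..k. w i p) = (\<Sum>i = 1..k. if i = 1 then 1 else 0)" by (simp only: w_def if_False)
    then show ?thesis using k by simp
  qed
  have w_nonneg: "0 \<le> w i p" for i p by (simp add: w_def s_nonneg)
  have w01: "w i p \<in> {0..1}" for i p
  proof (cases "i \<in> {1..k}")
    case True
    then have "w i p \<le> (\<Sum>i = 1..k. w i p)" using w_nonneg by (intro member_le_sum) auto
    then show ?thesis using wsum w_nonneg by simp
  next
    case False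
    then show ?thesis using k by (auto simp: w_def)
  qed
  have wm: "w i \<in> borel_measurable unit_square" for i
  proof -
    note [measurable] = sm
    show ?thesis unfolding w_def[abs_def] by measurable
  qed
  have "prod.swap (prod.swap p) = p" for p :: "real \<times> real" by simp
  then have ssw: "s i (prod.swap p) = s i p" for i p by (simp only: s_def add.commute)
  have "w i (prod.swap p) = w i p" for i p by (simp only: w_def ssw)
  then have "prob_kernel k w"
    unfolding prob_kernel_def unit_kernel_def using wm w01 wsum by blast
  moreover have "(\<lambda>n. rect_int (v n i) S T) \<longlonglongrightarrow> rect_int (w i) S T"
    if i: "i \<in> {1..k}" and S: "S \<in> sets unit_interval" "T \<in> sets unit_interval" for i S T
  proof -
    have R: "S \<times> T \<in> sets unit_square" "T \<times> S \<in> sets unit_square"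
      using S by (auto intro: Times_in_square)
    \<comment> \<open>Each \<open>v n\<close> is symmetric, so the limits over
      \<open>S \<times> T\<close> and \<open>T \<times> S\<close> agree, and the symmetrised density
      still integrates to them.\<close>
    have "rect_int (v n i) S T = rect_int (v n i) T S" for n
    proof -
      have "rect_int (v n i) S T = rect_int (\<lambda>p. v n i (prod.swap p)) S T"
        unfolding rect_int_def by (intro Bochner_Integration.integral_cong refl) (simp only: vsw space_unit_square)
      also have "\<dots> = rect_int (v n i) T S"
        using uf by (intro rect_int_swap S) (simp add: unit_function_def)
      finally show ?thesis .
    qed
    then have sym: "?L i (T \<times> S) = ?L i (S \<times> T)" by (simp add: rect_int_set_int)
    have fin: "integrable unit_square (h i)"
    proof (rule Q.integrable_const_bound[where B=1])
      show "AE p in unit_square. norm (h i p) \<le> 1"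
        using AEh
      proof eventually_elim
        case (elim p)
        have "h i p \<le> (\<Sum>i = 1..k. h i p)" using i h_nonneg by (intro member_le_sum) auto
        then show ?case using elim h_nonneg[of i p] by simp
      qed
    qed (rule hm)
    have fin': "integrable unit_square (\<lambda>p. h i (prod.swap p))"
      using fin hm swap_mp integrable_distr_eq[OF swap_mp(1) hm, of i] by simp
    have "rect_int (w i) S T = rect_int (s i) S T"
    proof (rule rect_int_cong_AE[OF _ wm sm S])
      show "AE p in unit_square. w i p = s i p"
        using AEs by eventually_elim (use i in \<open>simp add: w_def\<close>)
    qed
    also have "\<dots> = (rect_int (h i) S T + rect_int (\<lambda>p. h i (prod.swap p)) S T) / 2"
    proof -
      have "indicator (S \<times> T) p * s i p = (indicator (S \<times> T) p * h i p + indicator (S \<times> T) p * h i (prod.swap p)) / 2" for p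
        by (simp add: s_def algebra_simps)
      then have "rect_int (s i) S T
          = (LINT p|unit_square. (indicator (S \<times> T) p * h i p + indicator (S \<times> T) p * h i (prod.swap p)) / 2)"
        unfolding rect_int_def by (simp only:)
      then show ?thesis
        unfolding rect_int_def using integrable_set_int[OF fin R(1)] integrable_set_int[OF fin' R(1)] by simp
    qed
    also have "\<dots> = (?L i (S \<times> T) + ?L i (T \<times> S)) / 2"
      unfolding rect_int_swap[OF hm S] unfolding rect_int_set_int h_int[OF i R(1)] h_int[OF i R(2)] ..
    also have "\<dots> = ?L i (S \<times> T)" using sym by simp
    finally show ?thesis using L[OF i R(1)] by (simp add: rect_int_set_int)
  qed
  ultimately show ?thesis by blast
qed

lemma prob_kernel_bounded: "prob_kernel k f \<Longrightarrow> bounded_kernel f"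
  by (simp add: prob_kernel_def unit_kernel_bounded)

text \<open>In the Cauchy condition \<open>M\<close> does not depend on the rectangle. Letting
  \<open>m\<close> tend to infinity for fixed \<open>S\<close>, \<open>T\<close> and taking the
  supremum afterwards turns convergence on rectangles into convergence in the cut norm.\<close>

lemma cut_norm_complete:
  assumes v: "\<And>n :: nat. prob_kernel k (v n)" and k: "1 \<le> k"
    and cauchy: "\<And>e. 0 < e \<Longrightarrow> \<exists>M. \<forall>m\<ge>M. \<forall>n\<ge>M. cut_norm k (kdiff (v m) (v n)) \<le> e"
  shows "\<exists>W\<in>graphons k. \<forall>e>0. \<exists>M. \<forall>n\<ge>M. cut_norm k (kdiff (mass W) (v n)) \<le> e"
proof -
  note vb = prob_kernel_bounded[OF v]
  have rect_le: "\<bar>rect_int (v m i) S T - rect_int (v n i) S T\<bar> \<le> cut_norm k (kdiff (v m) (v n))"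
    if i: "i \<in> {1..k}" and S: "S \<in> sets unit_interval" "T \<in> sets unit_interval" for i S T m n
  proof -
    have "\<bar>rect_int (kdiff (v m) (v n) i) S T\<bar> \<le> (\<Sum>i = 1..k. \<bar>rect_int (kdiff (v m) (v n) i) S T\<bar>)"
      using i by (intro member_le_sum) auto
    also have "\<dots> \<le> cut_norm k (kdiff (v m) (v n))"
      by (intro cut_norm_upper bounded_kernel_kdiff vb S)
    finally show ?thesis by (simp add: rect_int_kdiff[OF vb vb S])
  qed
  have conv: "convergent (\<lambda>n. rect_int (v n i) S T)"
    if i: "i \<in> {1..k}" and S: "S \<in> sets unit_interval" "T \<in> sets unit_interval" for i S T
  proof (rule Cauchy_convergent, rule CauchyI)
    fix e :: real assume "0 < e"
    then obtain M where M: "\<forall>m\<ge>M. \<forall>n\<ge>M. cut_norm k (kdiff (v m) (v n)) \<le> e / 2"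
      using cauchy[of "e / 2"] by auto
    have "norm (rect_int (v m i) S T - rect_int (v n i) S T) < e" if "M \<le> m" "M \<le> n" for m n
      using rect_le[OF i S, of m n] M that \<open>0 < e\<close> by fastforce
    then show "\<exists>M. \<forall>m\<ge>M. \<forall>n\<ge>M. norm (rect_int (v m i) S T - rect_int (v n i) S T) < e" by blast
  qed
  obtain w where w: "prob_kernel k w" and lim: "\<And>i S T. i \<in> {1..k} \<Longrightarrow> S \<in> sets unit_interval \<Longrightarrow>
      T \<in> sets unit_interval \<Longrightarrow> (\<lambda>n. rect_int (v n i) S T) \<longlonglongrightarrow> rect_int (w i) S T"
    using limit_prob_kernel[OF v k conv] by blast
  obtain W where W: "W \<in> graphons k" and mass: "\<And>i p. i \<in> {1..k} \<Longrightarrow> p \<in> {0..1} \<times> {0..1} \<Longrightarrow> mass W i p = w i p"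
    using exists_graphon_of_prob_kernel[OF w] by blast
  have Wb: "bounded_kernel (mass W)" by (rule prob_kernel_bounded[OF prob_kernel_mass[OF W]])
  have mass_rect: "rect_int (mass W i) S T = rect_int (w i) S T" if "i \<in> {1..k}" for i S T
    unfolding rect_int_def
    by (intro Bochner_Integration.integral_cong refl) (simp only: mass[OF that] space_unit_square)
  have "\<exists>M. \<forall>n\<ge>M. cut_norm k (kdiff (mass W) (v n)) \<le> e" if e: "0 < e" for e
  proof -
    obtain M where M: "\<forall>m\<ge>M. \<forall>n\<ge>M. cut_norm k (kdiff (v m) (v n)) \<le> e"
      using cauchy[OF e] by blast
    have "cut_norm k (kdiff (mass W) (v n)) \<le> e" if n: "M \<le> n" for n
    proof (rule cut_norm_bound)
      fix S T assume S: "S \<in> sets unit_interval" "T \<in> sets unit_interval"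
      have "(\<lambda>m. \<Sum>i = 1..k. \<bar>rect_int (kdiff (v m) (v n) i) S T\<bar>)
        \<longlonglongrightarrow> (\<Sum>i = 1..k. \<bar>rect_int (kdiff (mass W) (v n) i) S T\<bar>)"
        unfolding rect_int_kdiff[OF vb vb S] rect_int_kdiff[OF Wb vb S]
        by (intro tendsto_sum tendsto_rabs tendsto_diff tendsto_const) (simp add: mass_rect lim S)
      moreover have "(\<Sum>i = 1..k. \<bar>rect_int (kdiff (v m) (v n) i) S T\<bar>) \<le> e" if "M \<le> m" for m
        using cut_norm_upper[OF bounded_kernel_kdiff[OF vb vb] S, of m n k] M n that
        by (meson order_trans)
      ultimately show "(\<Sum>i = 1..k. \<bar>rect_int (kdiff (mass W) (v n) i) S T\<bar>) \<le> e"
        by (intro LIMSEQ_le_const2) auto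
    qed
    then show ?thesis by blast
  qed
  then show ?thesis using W by blast
qed

section \<open>The space of graphons\<close>

lemma cut_dist_eq:
  "cut_dist k U W = cut_norm k (kdiff (mass U) (mass W))"
proof -
  have "(LINT p:S \<times> T|lebesgue. mass U i p - mass W i p) = rect_int (kdiff (mass U) (mass W) i) S T"
    if "S \<in> sets unit_interval" "T \<in> sets unit_interval" for S T i
  proof -
    have "S \<times> T \<subseteq> {0..1} \<times> {0..1}"
      using sets.sets_into_space[OF that(1)] sets.sets_into_space[OF that(2)] by auto
    then have "indicator ({0..1} \<times> {0..1}) p * indicator (S \<times> T) p = (indicator (S \<times> T) p :: real)" for p
      by (auto simp: indicator_def)
    then show ?thesis
      unfolding rect_int_def set_lebesgue_integral_def kdiff_def
      by (subst integral_restrict_space) (simp, simp only: real_scaleR_def mult.assoc[symmetric])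
  qed
  then show ?thesis
    unfolding cut_dist_def cut_norm_def by (intro SUP_cong refl) (auto intro!: sum.cong)
qed

lemma delta_cut_eq: "delta_cut k U W = kdelta k (mass U) (mass W)"
proof -
  have "mass (pullback W \<phi>) = twist (mass W) \<phi>" for \<phi>
    by (simp add: fun_eq_iff mass_def pullback_def twist_def square_map_def)
  then show ?thesis
    by (simp add: delta_cut_def kdelta_def cut_dist_eq)
qed

lemma graphon_bounded: "W \<in> graphons k \<Longrightarrow> bounded_kernel (mass W)"
  by (rule prob_kernel_bounded[OF prob_kernel_mass])

lemma graphon_unit: "W \<in> graphons k \<Longrightarrow> unit_kernel (mass W)"
  using prob_kernel_mass by (auto simp: prob_kernel_def)

lemma delta_cut_nonneg: "U \<in> graphons k \<Longrightarrow> W \<in> graphons k \<Longrightarrow> 0 \<le> delta_cut k U W"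
  by (simp add: delta_cut_eq kdelta_nonneg graphon_bounded)

lemma delta_cut_commute: "U \<in> graphons k \<Longrightarrow> W \<in> graphons k \<Longrightarrow> delta_cut k U W = delta_cut k W U"
  by (simp add: delta_cut_eq kdelta_commute graphon_bounded)

lemma delta_cut_triangle:
  "U \<in> graphons k \<Longrightarrow> V \<in> graphons k \<Longrightarrow> W \<in> graphons k \<Longrightarrow>
    delta_cut k U W \<le> delta_cut k U V + delta_cut k V W"
  by (simp add: delta_cut_eq kdelta_triangle graphon_bounded)

lemma delta_cut_self: "U \<in> graphons k \<Longrightarrow> delta_cut k U U = 0"
  using kdelta_le_cut_norm[OF graphon_bounded graphon_bounded, of U k U k k] delta_cut_nonneg[of U k U]
    cut_norm_AE[OF graphon_bounded graphon_bounded, of U k U k k]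
  by (simp add: delta_cut_eq)

text \<open>Over an empty set of colours the masses cannot add up to 1. Hence a sequence of graphons
  forces \<open>1 \<le> k\<close>.\<close>

lemma graphons_0: "graphons 0 = {}"
proof -
  have False if "W \<in> graphons 0" for W
  proof -
    have "\<forall>p\<in>{0..1} \<times> {0..1}. (\<Sum>i = 1..0. mass W i p) = 1"
      using prob_kernel_mass[OF that] unfolding prob_kernel_def by blast
    from bspec[OF this, of "(0, 0)"] have "(\<Sum>i = 1..0. mass W i (0, 0)) = 1"
      by simp
    then show False by simp
  qed
  then show ?thesis by blast
qed

text \<open>Composing the aligning transformations of a fast Cauchy sequence turns convergence in
  \<open>delta_cut\<close> into convergence in the cut norm.\<close>

lemma delta_cut_complete:
  assumes W: "\<And>n :: nat. W n \<in> graphons k"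
    and fast: "\<And>n. delta_cut k (W n) (W (Suc n)) < (1 / 2) ^ n"
  shows "\<exists>V\<in>graphons k. \<forall>e>0. \<exists>M. \<forall>n\<ge>M. delta_cut k V (W n) \<le> e"
proof -
  have k: "1 \<le> k"
  proof (rule ccontr)
    assume "\<not> 1 \<le> k"
    then have "k = 0" by simp
    then show False using W[of 0] graphons_0 by simp
  qed
  note Wb = graphon_bounded[OF W]
  have "\<exists>\<phi>. \<phi> \<in> mp_maps \<and> cut_norm k (kdiff (mass (W n)) (twist (mass (W (Suc n))) \<phi>)) < (1 / 2) ^ n" for n
    using kdelta_less[OF fast[of n, unfolded delta_cut_eq]] by blast
  then obtain \<phi> where \<phi>: "\<And>n. \<phi> n \<in> mp_maps"
      "\<And>n. cut_norm k (kdiff (mass (W n)) (twist (mass (W (Suc n))) (\<phi> n))) < (1 / 2) ^ n"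
    by metis
  \<comment> \<open>\<open>\<Phi> n\<close> applies \<open>\<phi> 0\<close> first and
    \<open>\<phi> (n - 1)\<close> last. In this order the difference of consecutive aligned kernels
    is the twist by \<open>\<Phi> n\<close> of the difference that \<open>\<phi> n\<close> makes
    small.\<close>
  define \<Phi> where "\<Phi> = rec_nat (\<lambda>x. x) (\<lambda>n \<psi> x. \<phi> n (\<psi> x))"
  have \<Phi>_Suc: "\<Phi> (Suc n) = (\<lambda>x. \<phi> n (\<Phi> n x))" for n by (simp add: \<Phi>_def)
  have \<Phi>: "\<Phi> n \<in> mp_maps" for n
  proof (induction n)
    case 0
    then show ?case using mp_id by (simp add: \<Phi>_def)
  next
    case (Suc n)
    then show ?case unfolding \<Phi>_Suc by (rule mp_comp[OF \<phi>(1)])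
  qed
  define v where "v n = twist (mass (W n)) (\<Phi> n)" for n
  have v: "prob_kernel k (v n)" for n
    unfolding v_def by (rule prob_kernel_twist[OF prob_kernel_mass[OF W] \<Phi>])
  note vb = prob_kernel_bounded[OF v]
  have step: "cut_norm k (kdiff (v n) (v (Suc n))) \<le> (1 / 2) ^ n" for n
  proof -
    have "kdiff (v n) (v (Suc n)) = twist (kdiff (mass (W n)) (twist (mass (W (Suc n))) (\<phi> n))) (\<Phi> n)"
      by (simp add: v_def twist_kdiff twist_twist \<Phi>_Suc)
    then have "cut_norm k (kdiff (v n) (v (Suc n))) \<le> cut_norm k (kdiff (mass (W n)) (twist (mass (W (Suc n))) (\<phi> n)))"
      using cut_norm_twist_le[OF bounded_kernel_kdiff[OF Wb bounded_kernel_twist[OF Wb \<phi>(1)]] \<Phi>, of k n "Suc n" n n] by simp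
    then show ?thesis using \<phi>(2)[of n] by simp
  qed
  \<comment> \<open>The bound is the finite geometric sum of the steps, in closed form for the
    induction.\<close>
  have far: "cut_norm k (kdiff (v n) (v (n + d))) \<le> 2 * (1 / 2) ^ n - 2 * (1 / 2) ^ (n + d)" for n d
  proof (induction d)
    case 0
    have "cut_norm k (kdiff (v n) (v n)) = 0" by (rule cut_norm_AE[OF vb vb]) simp
    then show ?case by simp
  next
    case (Suc d)
    have "cut_norm k (kdiff (v n) (v (n + Suc d)))
      \<le> cut_norm k (kdiff (v n) (v (n + d))) + cut_norm k (kdiff (v (n + d)) (v (Suc (n + d))))"
      using cut_norm_triangle[OF vb[of n] vb[of "n + d"] vb[of "Suc (n + d)"], of k] by simp
    then show ?case using Suc step[of "n + d"] by simp
  qed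
  have far': "cut_norm k (kdiff (v m) (v n)) \<le> 2 * (1 / 2) ^ min m n" for m n
  proof (cases "m \<le> n")
    case True
    then obtain d where "n = m + d" using le_Suc_ex by blast
    moreover have "0 \<le> 2 * (1 / 2 :: real) ^ (m + d)" by simp
    ultimately show ?thesis using far[of m d] by (simp only: min_absorb1 le_add1)
  next
    case False
    then obtain d where d: "m = n + d" using le_Suc_ex nat_le_linear by blast
    moreover have "0 \<le> 2 * (1 / 2 :: real) ^ (n + d)" by simp
    ultimately show ?thesis
      using far[of n d] unfolding cut_norm_kdiff_commute[of k "v m"] by (simp only: min_absorb2 le_add1)
  qed
  have "\<exists>M. \<forall>m\<ge>M. \<forall>n\<ge>M. cut_norm k (kdiff (v m) (v n)) \<le> e" if e: "0 < e" for e
  proof -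
    obtain M where M: "(1 / 2 :: real) ^ M < e / 2"
      using real_arch_pow_inv[of "e / 2" "1 / 2"] e by auto
    have "cut_norm k (kdiff (v m) (v n)) \<le> e" if "M \<le> m" "M \<le> n" for m n
    proof -
      have "(1 / 2 :: real) ^ min m n \<le> (1 / 2) ^ M" using that by (intro power_decreasing) auto
      then show ?thesis using far'[of m n] M by linarith
    qed
    then show ?thesis by blast
  qed
  from cut_norm_complete[OF v k this] obtain V where V: "V \<in> graphons k"
    and lim: "\<And>e. 0 < e \<Longrightarrow> \<exists>M. \<forall>n\<ge>M. cut_norm k (kdiff (mass V) (v n)) \<le> e" by blast
  \<comment> \<open>\<open>\<Phi> n\<close> is one of the maps over which \<open>delta_cut\<close>
    takes its infimum, so removing the alignment costs nothing.\<close>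
  have "delta_cut k V (W n) \<le> cut_norm k (kdiff (mass V) (v n))" for n
    unfolding delta_cut_eq v_def by (rule kdelta_le[OF graphon_bounded[OF V] Wb \<Phi>])
  then show ?thesis using V lim by (meson order_trans)
qed

section \<open>The quotient metric\<close>

lemma equiv_cut_equiv: "equiv (graphons k) (cut_equiv k)"
proof (rule equivI)
  show "cut_equiv k \<subseteq> graphons k \<times> graphons k" by (auto simp: cut_equiv_def)
  show "refl_on (graphons k) (cut_equiv k)" by (auto simp: refl_on_def cut_equiv_def delta_cut_self)
  show "sym (cut_equiv k)" by (auto simp: sym_def cut_equiv_def delta_cut_commute)
  show "trans (cut_equiv k)"
  proof (rule transI)
    fix U V W assume "(U, V) \<in> cut_equiv k" "(V, W) \<in> cut_equiv k"
    then show "(U, W) \<in> cut_equiv k"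
      using delta_cut_triangle[of U k V W] delta_cut_nonneg[of U k W] by (auto simp: cut_equiv_def)
  qed
qed

definition graphon_class :: "nat \<Rightarrow> (real \<times> real \<Rightarrow> nat measure) \<Rightarrow> (real \<times> real \<Rightarrow> nat measure) set" where
  "graphon_class k W = cut_equiv k `` {W}"

lemma graphon_class_in: "W \<in> graphons k \<Longrightarrow> graphon_class k W \<in> graphon_space k"
  by (simp add: graphon_class_def graphon_space_def quotientI)

lemma graphon_space_cases:
  assumes "A \<in> graphon_space k" obtains W where "W \<in> graphons k" "A = graphon_class k W"
  using assms by (auto simp: graphon_space_def graphon_class_def elim: quotientE)

lemma graphon_class_eq_iff:
  "U \<in> graphons k \<Longrightarrow> W \<in> graphons k \<Longrightarrow> graphon_class k U = graphon_class k W \<longleftrightarrow> delta_cut k U W = 0"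
  unfolding graphon_class_def
  using eq_equiv_class_iff[OF equiv_cut_equiv[of k], of U W] by (simp add: cut_equiv_def)

text \<open>Triangle inequalities through the representatives, in both directions, make the set of
  values a singleton, as \<open>the_elem\<close> requires.\<close>

lemma graphon_dist_class:
  assumes U: "U \<in> graphons k" and W: "W \<in> graphons k"
  shows "graphon_dist k (graphon_class k U) (graphon_class k W) = delta_cut k U W"
proof -
  have "delta_cut k U' W' = delta_cut k U W" if "U' \<in> graphon_class k U" "W' \<in> graphon_class k W" for U' W'
  proof -
    have g: "U' \<in> graphons k" "W' \<in> graphons k" and 0: "delta_cut k U U' = 0" "delta_cut k W W' = 0"
      using that by (auto simp: graphon_class_def cut_equiv_def)
    have "delta_cut k U' W' \<le> delta_cut k U' U + delta_cut k U W + delta_cut k W W'"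
      using delta_cut_triangle[OF g(1) U g(2)] delta_cut_triangle[OF U W g(2)] by simp
    moreover have "delta_cut k U W \<le> delta_cut k U U' + delta_cut k U' W' + delta_cut k W' W"
      using delta_cut_triangle[OF U g(1) W] delta_cut_triangle[OF g(1) g(2) W] by simp
    ultimately show ?thesis
      using 0 delta_cut_commute[OF U g(1)] delta_cut_commute[OF W g(2)] by simp
  qed
  moreover have "U \<in> graphon_class k U" "W \<in> graphon_class k W"
    using U W by (auto simp: graphon_class_def cut_equiv_def delta_cut_self)
  ultimately have "{delta_cut k U' W' | U' W'. U' \<in> graphon_class k U \<and> W' \<in> graphon_class k W} = {delta_cut k U W}"
    by blast
  then show ?thesis
    unfolding graphon_dist_def using graphon_class_in[OF U] graphon_class_in[OF W] by simp
qed

lemma Metric_space_graphon: "Metric_space (graphon_space k) (graphon_dist k)"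
proof
  fix A B C
  show "0 \<le> graphon_dist k A B"
  proof (cases "A \<in> graphon_space k \<and> B \<in> graphon_space k")
    case True
    then show ?thesis by (metis graphon_space_cases graphon_dist_class delta_cut_nonneg)
  qed (auto simp: graphon_dist_def)
  show "graphon_dist k A B = graphon_dist k B A"
  proof (cases "A \<in> graphon_space k \<and> B \<in> graphon_space k")
    case True
    then show ?thesis by (metis graphon_space_cases graphon_dist_class delta_cut_commute)
  qed (auto simp: graphon_dist_def)
  show "graphon_dist k A B = 0 \<longleftrightarrow> A = B" if "A \<in> graphon_space k" "B \<in> graphon_space k"
    using that by (metis graphon_space_cases graphon_dist_class graphon_class_eq_iff)
  show "graphon_dist k A C \<le> graphon_dist k A B + graphon_dist k B C"
    if "A \<in> graphon_space k" "B \<in> graphon_space k" "C \<in> graphon_space k"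
    using that by (metis graphon_space_cases graphon_dist_class delta_cut_triangle)
qed

interpretation G: Metric_space "graphon_space k" "graphon_dist k" for k
  by (rule Metric_space_graphon)

lemma graphon_space_totally_bounded: "G.mtotally_bounded k (graphon_space k)"
  unfolding G.mtotally_bounded_def
proof (intro allI impI)
  fix e :: real assume "0 < e"
  \<comment> \<open>Equal signatures give a weak inequality while balls are open, hence half of
    \<open>e\<close>.\<close>
  then have "0 < e / 2" by simp
  from kdelta_totally_bounded[OF this, of k]
  obtain K and sig :: "kernel \<Rightarrow> (nat \<times> nat \<times> nat \<Rightarrow> int) \<times> (nat \<Rightarrow> int)" where K: "finite K"
    "\<And>f. unit_kernel f \<Longrightarrow> sig f \<in> K"
    "\<And>f g. unit_kernel f \<Longrightarrow> unit_kernel g \<Longrightarrow> sig f = sig g \<Longrightarrow> kdelta k f g \<le> e / 2"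
    by blast
  \<comment> \<open>Only signatures attained by graphons are kept, so a graphon can be chosen as
    centre for each.\<close>
  define T where "T = (\<lambda>W. sig (mass W)) ` graphons k"
  have "T \<subseteq> K" unfolding T_def using K(2) graphon_unit by blast
  then have "finite T" using K(1) by (rule finite_subset)
  define r where "r t = (SOME W. W \<in> graphons k \<and> sig (mass W) = t)" for t
  have r: "r t \<in> graphons k \<and> sig (mass (r t)) = t" if "t \<in> T" for t
  proof -
    have "\<exists>W. W \<in> graphons k \<and> sig (mass W) = t" using that by (auto simp: T_def)
    then show ?thesis unfolding r_def by (rule someI_ex)
  qed
  let ?C = "(\<lambda>t. graphon_class k (r t)) ` T"
  have "A \<in> (\<Union>x\<in>?C. G.mball k x e)" if A: "A \<in> graphon_space k" for A
  proof -
    obtain W where W: "W \<in> graphons k" "A = graphon_class k W" using graphon_space_cases[OF A] .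
    define t where "t = sig (mass W)"
    have t: "t \<in> T" using W(1) by (auto simp: T_def t_def)
    have "delta_cut k (r t) W \<le> e / 2"
      unfolding delta_cut_eq using r[OF t] W(1) by (intro K(3) graphon_unit) (auto simp: t_def)
    then have "graphon_dist k (graphon_class k (r t)) A < e"
      unfolding W(2) using graphon_dist_class[of "r t" k W] r[OF t] W(1) \<open>0 < e\<close> by simp
    then have "A \<in> G.mball k (graphon_class k (r t)) e"
      using A r[OF t] graphon_class_in by (simp add: G.in_mball)
    then show ?thesis using t by blast
  qed
  moreover have "?C \<subseteq> graphon_space k" using r graphon_class_in by blast
  ultimately show "\<exists>K. finite K \<and> K \<subseteq> graphon_space k \<and> graphon_space k \<subseteq> (\<Union>x\<in>K. G.mball k x e)"
    using \<open>finite T\<close> by (intro exI[of _ ?C]) blast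
qed

text \<open>A Cauchy sequence converges once some subsequence does, so it suffices to treat a
  subsequence with geometric rate.\<close>

lemma graphon_space_complete: "G.mcomplete k"
  unfolding G.mcomplete_def
proof (intro allI impI)
  fix \<sigma> assume \<sigma>: "G.MCauchy k \<sigma>"
  then have in_space: "\<sigma> n \<in> graphon_space k" for n by (auto simp: G.MCauchy_def)
  have "\<exists>N. \<forall>n n'. N \<le> n \<longrightarrow> N \<le> n' \<longrightarrow> graphon_dist k (\<sigma> n) (\<sigma> n') < (1 / 2) ^ j" for j
    using \<sigma> unfolding G.MCauchy_def by (metis zero_less_power zero_less_divide_1_iff zero_less_numeral)
  then obtain N where N: "\<And>j n n'. N j \<le> n \<Longrightarrow> N j \<le> n' \<Longrightarrow> graphon_dist k (\<sigma> n) (\<sigma> n') < (1 / 2) ^ j"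
    by metis
  \<comment> \<open>The maximum makes \<open>r\<close> strictly increasing and keeps
    \<open>r n\<close> beyond the threshold for the rate \<open>(1 / 2) ^ n\<close>.\<close>
  define r where "r = rec_nat (N 0) (\<lambda>n m. max (Suc m) (N (Suc n)))"
  have r_Suc: "r (Suc n) = max (Suc (r n)) (N (Suc n))" for n by (simp add: r_def)
  have r_mono: "strict_mono r" by (rule strict_monoI_Suc) (simp add: r_Suc)
  have r_N: "N n \<le> r n" for n by (cases n) (simp_all add: r_def)
  have "\<exists>W. W \<in> graphons k \<and> \<sigma> (r n) = graphon_class k W" for n
    using graphon_space_cases[OF in_space] by metis
  then obtain W where W: "\<And>n. W n \<in> graphons k" "\<And>n. \<sigma> (r n) = graphon_class k (W n)"
    by metis
  have "delta_cut k (W n) (W (Suc n)) < (1 / 2) ^ n" for n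
    using N[OF r_N[of n], of "r (Suc n)"] r_N[of n]
    by (simp add: r_Suc W(2)[symmetric] graphon_dist_class[OF W(1) W(1), symmetric])
  from delta_cut_complete[OF W(1) this] obtain V where V: "V \<in> graphons k"
    and lim: "\<And>e. 0 < e \<Longrightarrow> \<exists>M. \<forall>n\<ge>M. delta_cut k V (W n) \<le> e" by blast
  have "limitin (G.mtopology k) (\<sigma> \<circ> r) (graphon_class k V) sequentially"
    unfolding G.limitin_metric
  proof (intro conjI allI impI graphon_class_in[OF V])
    fix e :: real assume "0 < e"
    then obtain M where M: "\<And>n. M \<le> n \<Longrightarrow> delta_cut k V (W n) \<le> e / 2" using lim[of "e / 2"] by auto
    have "graphon_dist k ((\<sigma> \<circ> r) n) (graphon_class k V) < e" if "M \<le> n" for n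
      using M[OF that] \<open>0 < e\<close> by (simp add: W(2) graphon_dist_class W(1) V delta_cut_commute[OF W(1) V])
    then show "\<forall>\<^sub>F n in sequentially. (\<sigma> \<circ> r) n \<in> graphon_space k \<and> graphon_dist k ((\<sigma> \<circ> r) n) (graphon_class k V) < e"
      using in_space by (auto simp: eventually_sequentially)
  qed
  then show "\<exists>x. limitin (G.mtopology k) \<sigma> x sequentially"
    using G.MCauchy_convergent_subsequence[OF \<sigma> r_mono] by blast
qed

theorem theorem5p5:
  fixes k :: nat
  shows "Metric_space (graphon_space k) (graphon_dist k) \<and>
         compact_space (Metric_space.mtopology (graphon_space k) (graphon_dist k))"
  using Metric_space_graphon G.compact_space_eq_mcomplete_mtotally_bounded
    graphon_space_complete graphon_space_totally_bounded by blast

end
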